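(* Let $|v_1\rangle=\frac{1}{\sqrt2}(|01\rangle-|10\rangle)$ and $|v_2\rangle=\frac{1}{\sqrt2}(|02\rangle-|20\rangle)$ in $\mathbb{C}^3\otimes\mathbb{C}^3$ (with $\{|0\rangle,|1\rangle,|2\rangle\}$ the standard orthonormal basis of $\mathbb{C}^3$), and let $\rho_v=\frac12(|v_1\rangle\langle v_1|+|v_2\rangle\langle v_2|)$. Then $$E_D(\rho_v)=R^\infty(\rho_v)=\log_2\Big(1+\frac1{\sqrt2}\Big),$$ where $E_D$ is the distillable entanglement under PPT operations and $R^\infty$ is the regularized Rains' bound.
   Context: All Hilbert spaces are finite-dimensional and $\log=\log_2$. A state is a positive semidefinite operator of trace one. $T_B$ denotes partial transpose on the second (Bob's) system: $(|i_Aj_B\rangle\langle k_Al_B|)^{T_B}=|i_Al_B\rangle\langle k_Aj_B|$. For tensor powers, the bipartition is all of Alice's systems versus all of Bob's systems. $\|\cdot\|_1$ is the trace norm. PPT operations: a CPTP map $\Lambda:\mathcal{L}(A\otimes B)\to\mathcal{L}(A'\otimes B')$ is a PPT operation if $T_{B'}\circ\Lambda\circ T_B$ is completely positive. Let $\Phi=|\phi\rangle\langle\phi|$, $|\phi\rangle=\frac1{\sqrt2}(|00\rangle+|11\rangle)$. The distillable entanglement under PPT operations is $$E_D(\rho)=\sup\Big\{r\ge0:\lim_{n\to\infty}\inf_{\Lambda\text{ PPT operation}}\|\Lambda(\rho^{\otimes n})-\Phi^{\otimes\lfloor rn\rfloor}\|_1=0\Big\}.$$ Relative entropy: $S(\rho\|\sigma)=\mathrm{Tr}(\rho\log\rho-\rho\log\sigma)$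 ($+\infty$ if $\mathrm{supp}(\rho)\not\subseteq\mathrm{supp}(\sigma)$). Rains' bound: $R(\rho)=\min\{S(\rho\|\sigma):\sigma\ge0,\ \|\sigma^{T_B}\|_1\le1\}$, and $R^\infty(\rho)=\inf_{n\ge1}R(\rho^{\otimes n})/n$. *)

theory Defs
  imports
    Complex_Main
    "HOL-Library.Extended_Real"
    "Jordan_Normal_Form.Schur_Decomposition"
begin

text \<open>
  Operators are complex matrices with an explicit dimension. A bipartite system with local
  dimensions \<open>dA\<close> and \<open>dB\<close> lives in dimension \<open>dA * dB\<close>; the
  basis vector \<open>|i\<rangle>\<^sub>A |j\<rangle>\<^sub>B\<close> has index \<open>i * dB + j\<close>, so that the index \<open>r\<close>
  decodes to \<open>(r div dB, r mod dB)\<close>.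
\<close>

section \<open>Operators\<close>

definition mat_trace :: "complex mat \<Rightarrow> complex" where
  "mat_trace A = (\<Sum>i<dim_row A. A $$ (i, i))"

text \<open>The order on complex numbers: \<open>0 \<le> z\<close> means that \<open>z\<close> is real and nonnegative.\<close>

definition positive_semidefinite :: "nat \<Rightarrow> complex mat \<Rightarrow> bool" where
  "positive_semidefinite d A \<longleftrightarrow>
     A \<in> carrier_mat d d \<and> (\<forall>v \<in> carrier_vec d. 0 \<le> (A *\<^sub>v v) \<bullet>c v)"

definition unitary_mat :: "nat \<Rightarrow> complex mat \<Rightarrow> bool" where
  "unitary_mat d U \<longleftrightarrow>
     U \<in> carrier_mat d d \<and> U * mat_adjoint U = 1\<^sub>m d \<and> mat_adjoint U * U = 1\<^sub>m d"

definition real_diag :: "nat \<Rightarrow> (nat \<Rightarrow> real) \<Rightarrow> complex mat" where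
  "real_diag d x = mat d d (\<lambda>(i, j). if i = j then complex_of_real (x i) else 0)"

text \<open>
  Functional calculus \<open>f(A) = U diag(f(x\<^sub>0), f(x\<^sub>1), \<dots>) U\<^sup>*\<close> for a Hermitian
  \<open>A = U diag(x\<^sub>0, x\<^sub>1, \<dots>) U\<^sup>*\<close>. The result does not depend on the
  diagonalization, so the choice operator selects the only candidate. For an \<open>A\<close> that is
  not Hermitian the value is unspecified.
\<close>

definition hermitian_fun :: "(real \<Rightarrow> real) \<Rightarrow> complex mat \<Rightarrow> complex mat" where
  "hermitian_fun f A =
     (SOME B. \<exists>U x. unitary_mat (dim_row A) U
        \<and> A = U * real_diag (dim_row A) x * mat_adjoint U
        \<and> B = U * real_diag (dim_row A) (f \<circ> x) * mat_adjoint U)"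

definition trace_norm :: "complex mat \<Rightarrow> real" where
  "trace_norm X = Re (mat_trace (hermitian_fun sqrt (mat_adjoint X * X)))"

text \<open>The support of a Hermitian operator is its range.\<close>

definition mat_support :: "complex mat \<Rightarrow> complex vec set" where
  "mat_support A = {A *\<^sub>v v |v. v \<in> carrier_vec (dim_col A)}"

text \<open>
  The logarithm of a positive semidefinite operator is taken on its support and extended by
  zero. This is the convention \<open>0 log 0 = 0\<close> for \<open>Tr(\<rho> log \<rho>)\<close>; in
  \<open>Tr(\<rho> log \<sigma>)\<close> the extension is immaterial, as it is used only if the support of
  \<open>\<rho>\<close> is contained in that of \<open>\<sigma>\<close>.
\<close>

definition mat_log2 :: "complex mat \<Rightarrow> complex mat" where
  "mat_log2 = hermitian_fun (\<lambda>x. if x > 0 then log 2 x else 0)"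

definition relative_entropy :: "complex mat \<Rightarrow> complex mat \<Rightarrow> ereal" where
  "relative_entropy \<rho> \<sigma> =
     (if mat_support \<rho> \<subseteq> mat_support \<sigma>
      then ereal (Re (mat_trace (\<rho> * mat_log2 \<rho> - \<rho> * mat_log2 \<sigma>)))
      else \<infinity>)"

definition rank_one :: "complex vec \<Rightarrow> complex vec \<Rightarrow> complex mat" where
  "rank_one v w = mat (dim_vec v) (dim_vec w) (\<lambda>(i, j). v $ i * cnj (w $ j))"

section \<open>Bipartite systems\<close>

definition ket2 :: "nat \<Rightarrow> nat \<Rightarrow> nat \<Rightarrow> nat \<Rightarrow> complex vec" where
  "ket2 dA dB i j = unit_vec (dA * dB) (i * dB + j)"

definition partial_transpose :: "nat \<Rightarrow> nat \<Rightarrow> complex mat \<Rightarrow> complex mat" where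
  "partial_transpose dA dB X = mat (dA * dB) (dA * dB)
     (\<lambda>(r, c). X $$ ((r div dB) * dB + c mod dB, (c div dB) * dB + r mod dB))"

lemma index_bound:
  fixes i j dA dB :: nat
  assumes "i < dA" "j < dB"
  shows "i * dB + j < dA * dB"
proof -
  have "i * dB + j < Suc i * dB" using assms(2) by simp
  also have "\<dots> \<le> dA * dB" using assms(1) by (intro mult_right_mono) auto
  finally show ?thesis .
qed

lemma index_eq_iff:
  fixes i j r dB :: nat
  assumes "j < dB"
  shows "i * dB + j = r \<longleftrightarrow> i = r div dB \<and> j = r mod dB"
  using assms by auto

lemma partial_transpose_rank_one_ket2:
  assumes "i < dA" "j < dB" "k < dA" "l < dB"
  shows "partial_transpose dA dB (rank_one (ket2 dA dB i j) (ket2 dA dB k l))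
       = rank_one (ket2 dA dB i l) (ket2 dA dB k j)"
proof (rule eq_matI)
  fix r c assume "r < dim_row (rank_one (ket2 dA dB i l) (ket2 dA dB k j))"
    and "c < dim_col (rank_one (ket2 dA dB i l) (ket2 dA dB k j))"
  then have rc: "r < dA * dB" "c < dA * dB" by (simp_all add: rank_one_def ket2_def)
  then have "dB > 0" by (cases dB) auto
  moreover have "r div dB < dA" "c div dB < dA"
    using rc by (auto simp: less_mult_imp_div_less)
  ultimately have "(r div dB) * dB + c mod dB < dA * dB" "(c div dB) * dB + r mod dB < dA * dB"
    by (auto intro!: index_bound)
  then show "partial_transpose dA dB (rank_one (ket2 dA dB i j) (ket2 dA dB k l)) $$ (r, c)
      = rank_one (ket2 dA dB i l) (ket2 dA dB k j) $$ (r, c)"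
    using rc \<open>dB > 0\<close> assms
    by (auto simp: partial_transpose_def rank_one_def ket2_def unit_vec_def index_bound
        index_eq_iff eq_commute[of _ "_ * dB + _"] split: if_splits)
qed (simp_all add: partial_transpose_def rank_one_def ket2_def)

text \<open>
  The tensor product of \<open>X\<close> on \<open>A\<^sub>1B\<^sub>1\<close> and \<open>Y\<close> on \<open>A\<^sub>2B\<^sub>2\<close>, as an operator on the
  bipartite system \<open>(A\<^sub>1A\<^sub>2)(B\<^sub>1B\<^sub>2)\<close> with local dimensions \<open>dA\<^sub>1 * dA\<^sub>2\<close> and \<open>dB\<^sub>1 * dB\<^sub>2\<close>.
\<close>

definition bipartite_tensor ::
  "nat \<Rightarrow> nat \<Rightarrow> nat \<Rightarrow> nat \<Rightarrow> complex mat \<Rightarrow> complex mat \<Rightarrow> complex mat" where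
  "bipartite_tensor dA\<^sub>1 dB\<^sub>1 dA\<^sub>2 dB\<^sub>2 X Y =
     (let
        idx1 = (\<lambda>r. (r div (dB\<^sub>1 * dB\<^sub>2) div dA\<^sub>2) * dB\<^sub>1 + r mod (dB\<^sub>1 * dB\<^sub>2) div dB\<^sub>2);
        idx2 = (\<lambda>r. (r div (dB\<^sub>1 * dB\<^sub>2) mod dA\<^sub>2) * dB\<^sub>2 + r mod (dB\<^sub>1 * dB\<^sub>2) mod dB\<^sub>2)
      in mat (dA\<^sub>1 * dA\<^sub>2 * (dB\<^sub>1 * dB\<^sub>2)) (dA\<^sub>1 * dA\<^sub>2 * (dB\<^sub>1 * dB\<^sub>2))
           (\<lambda>(r, c). X $$ (idx1 r, idx1 c) * Y $$ (idx2 r, idx2 c)))"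

lemma bipartite_tensor_index:
  assumes "a\<^sub>1 < dA\<^sub>1" "b\<^sub>1 < dB\<^sub>1" "a\<^sub>2 < dA\<^sub>2" "b\<^sub>2 < dB\<^sub>2"
    and "c\<^sub>1 < dA\<^sub>1" "d\<^sub>1 < dB\<^sub>1" "c\<^sub>2 < dA\<^sub>2" "d\<^sub>2 < dB\<^sub>2"
  shows "bipartite_tensor dA\<^sub>1 dB\<^sub>1 dA\<^sub>2 dB\<^sub>2 X Y $$
           ((a\<^sub>1 * dA\<^sub>2 + a\<^sub>2) * (dB\<^sub>1 * dB\<^sub>2) + (b\<^sub>1 * dB\<^sub>2 + b\<^sub>2),
            (c\<^sub>1 * dA\<^sub>2 + c\<^sub>2) * (dB\<^sub>1 * dB\<^sub>2) + (d\<^sub>1 * dB\<^sub>2 + d\<^sub>2))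
       = X $$ (a\<^sub>1 * dB\<^sub>1 + b\<^sub>1, c\<^sub>1 * dB\<^sub>1 + d\<^sub>1) * Y $$ (a\<^sub>2 * dB\<^sub>2 + b\<^sub>2, c\<^sub>2 * dB\<^sub>2 + d\<^sub>2)"
proof -
  have decode: "(a * D + b) div D = a" "(a * D + b) mod D = b" if "b < D" for a b D :: nat
    using that by simp_all
  have "b\<^sub>1 * dB\<^sub>2 + b\<^sub>2 < dB\<^sub>1 * dB\<^sub>2" "d\<^sub>1 * dB\<^sub>2 + d\<^sub>2 < dB\<^sub>1 * dB\<^sub>2"
    using assms by (simp_all add: index_bound)
  then show ?thesis
    using assms by (simp add: bipartite_tensor_def Let_def index_bound decode del: mult_Suc)
qed

text \<open>The \<open>n\<close>-fold tensor power, with local dimensions \<open>dA ^ n\<close> and \<open>dB ^ n\<close>.\<close>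

primrec bipartite_power :: "nat \<Rightarrow> nat \<Rightarrow> complex mat \<Rightarrow> nat \<Rightarrow> complex mat" where
  "bipartite_power dA dB X 0 = 1\<^sub>m 1"
| "bipartite_power dA dB X (Suc n) =
     bipartite_tensor dA dB (dA ^ n) (dB ^ n) X (bipartite_power dA dB X n)"

section \<open>PPT operations\<close>

definition linear_superoperator :: "nat \<Rightarrow> nat \<Rightarrow> (complex mat \<Rightarrow> complex mat) \<Rightarrow> bool" where
  "linear_superoperator d d' \<Lambda> \<longleftrightarrow>
     (\<forall>X \<in> carrier_mat d d. \<Lambda> X \<in> carrier_mat d' d') \<and>
     (\<forall>X \<in> carrier_mat d d. \<forall>Y \<in> carrier_mat d d. \<Lambda> (X + Y) = \<Lambda> X + \<Lambda> Y) \<and>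
     (\<forall>a. \<forall>X \<in> carrier_mat d d. \<Lambda> (a \<cdot>\<^sub>m X) = a \<cdot>\<^sub>m \<Lambda> X)"

text \<open>The map \<open>id\<^sub>k \<otimes> \<Lambda>\<close>: apply \<open>\<Lambda>\<close> to each \<open>d \<times> d\<close> block of a \<open>k \<times> k\<close> block matrix.\<close>

definition ampliation ::
  "nat \<Rightarrow> nat \<Rightarrow> nat \<Rightarrow> (complex mat \<Rightarrow> complex mat) \<Rightarrow> complex mat \<Rightarrow> complex mat" where
  "ampliation k d d' \<Lambda> X = mat (k * d') (k * d')
     (\<lambda>(r, c). \<Lambda> (mat d d (\<lambda>(p, q). X $$ ((r div d') * d + p, (c div d') * d + q)))
                 $$ (r mod d', c mod d'))"

definition completely_positive :: "nat \<Rightarrow> nat \<Rightarrow> (complex mat \<Rightarrow> complex mat) \<Rightarrow> bool" where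
  "completely_positive d d' \<Lambda> \<longleftrightarrow> linear_superoperator d d' \<Lambda> \<and>
     (\<forall>k X. positive_semidefinite (k * d) X \<longrightarrow>
        positive_semidefinite (k * d') (ampliation k d d' \<Lambda> X))"

definition trace_preserving :: "nat \<Rightarrow> (complex mat \<Rightarrow> complex mat) \<Rightarrow> bool" where
  "trace_preserving d \<Lambda> \<longleftrightarrow> (\<forall>X \<in> carrier_mat d d. mat_trace (\<Lambda> X) = mat_trace X)"

definition ppt_operation ::
  "nat \<Rightarrow> nat \<Rightarrow> nat \<Rightarrow> nat \<Rightarrow> (complex mat \<Rightarrow> complex mat) \<Rightarrow> bool" where
  "ppt_operation dA dB dA' dB' \<Lambda> \<longleftrightarrow>
     completely_positive (dA * dB) (dA' * dB') \<Lambda> \<and>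
     trace_preserving (dA * dB) \<Lambda> \<and>
     completely_positive (dA * dB) (dA' * dB')
       (partial_transpose dA' dB' \<circ> \<Lambda> \<circ> partial_transpose dA dB)"

section \<open>Distillable entanglement and the Rains bound\<close>

definition phi :: "complex vec" where
  "phi = complex_of_real (1 / sqrt 2) \<cdot>\<^sub>v (ket2 2 2 0 0 + ket2 2 2 1 1)"

definition Phi :: "complex mat" where
  "Phi = rank_one phi phi"

definition distillable_entanglement :: "nat \<Rightarrow> nat \<Rightarrow> complex mat \<Rightarrow> ereal" where
  "distillable_entanglement dA dB \<rho> =
     Sup (ereal ` {r. 0 \<le> r \<and>
       (\<lambda>n. let m = nat \<lfloor>r * real n\<rfloor> in
          INF \<Lambda> \<in> {\<Lambda>. ppt_operation (dA ^ n) (dB ^ n) (2 ^ m) (2 ^ m) \<Lambda>}.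
            trace_norm (\<Lambda> (bipartite_power dA dB \<rho> n) - bipartite_power 2 2 Phi m))
         \<longlonglongrightarrow> 0})"

text \<open>
  The minimum in the Rains bound is attained (the feasible set is compact and the relative
  entropy is lower semicontinuous), so it equals the infimum.
\<close>

definition rains_bound :: "nat \<Rightarrow> nat \<Rightarrow> complex mat \<Rightarrow> ereal" where
  "rains_bound dA dB \<rho> =
     (INF \<sigma> \<in> {\<sigma>. positive_semidefinite (dA * dB) \<sigma> \<and>
                     trace_norm (partial_transpose dA dB \<sigma>) \<le> 1}.
        relative_entropy \<rho> \<sigma>)"

definition regularized_rains_bound :: "nat \<Rightarrow> nat \<Rightarrow> complex mat \<Rightarrow> ereal" where
  "regularized_rains_bound dA dB \<rho> =
     (INF n \<in> {1..}. rains_bound (dA ^ n) (dB ^ n) (bipartite_power dA dB \<rho> n) / ereal (real n))"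

section \<open>The antisymmetric state\<close>

definition v1 :: "complex vec" where
  "v1 = complex_of_real (1 / sqrt 2) \<cdot>\<^sub>v (ket2 3 3 0 1 - ket2 3 3 1 0)"

definition v2 :: "complex vec" where
  "v2 = complex_of_real (1 / sqrt 2) \<cdot>\<^sub>v (ket2 3 3 0 2 - ket2 3 3 2 0)"

definition rho_v :: "complex mat" where
  "rho_v = complex_of_real (1 / 2) \<cdot>\<^sub>m (rank_one v1 v1 + rank_one v2 v2)"

end

theory Submission
  imports
    Defs
    "Jordan_Normal_Form.Spectral_Radius"
    "HOL-Analysis.L2_Norm"
begin

text \<open>
  Write \<open>\<kappa> = 1 + 1 / \<surd>2\<close>, so that \<open>1 / \<kappa> = 2 - \<surd>2\<close>, and let \<open>T\<close> be the partial transposition. Everything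
  rests on two operators on \<open>\<complex>\<^sup>3 \<otimes> \<complex>\<^sup>3\<close>.

  The first is \<open>G = |\<rho>\<^sub>v\<^sup>T|\<close>, of trace \<open>\<kappa>\<close>. Since \<open>-G \<le> \<rho>\<^sub>v\<^sup>T \<le> G\<close> is inherited by tensor powers, a PPT operation
  maps \<open>n\<close> copies of \<open>\<rho>\<^sub>v\<close> to a state of overlap at most \<open>\<kappa>\<^sup>n / 2\<^sup>m\<close> with \<open>m\<close> maximally entangled pairs, so no
  rate above \<open>log \<kappa>\<close> is achievable. Also \<open>\<rho>\<^sub>v / \<kappa>\<close> is feasible in the Rains bound, with relative entropy
  \<open>log \<kappa>\<close>.

  The second is \<open>R = 2 \<rho>\<^sub>v + (3 - 2 \<surd>2) P\<close>, with \<open>P\<close> the projection onto the vectors \<open>|01> + |10>\<close> and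
  \<open>|02> + |20>\<close>. It satisfies \<open>2 \<rho>\<^sub>v \<le> R \<le> 1\<close> and \<open>-1 / \<kappa> \<le> R\<^sup>T \<le> 1 / \<kappa>\<close>. Measuring \<open>R\<close> on all copies and preparing
  the maximally entangled state upon success is a PPT operation that distils without error at the rate
  \<open>log \<kappa>\<close>. If \<open>\<parallel>\<sigma>\<^sup>T\<parallel>\<^sub>1 \<le> 1\<close>, then \<open>2\<^sup>n Tr (\<rho>\<^sub>v\<^sup>n \<sigma>) \<le> Tr (R\<^sup>n \<sigma>) \<le> \<kappa>\<^sup>-\<^sup>n\<close>, and Jensen's inequality
  turns this into \<open>S(\<rho>\<^sub>v\<^sup>n \<parallel> \<sigma>) \<ge> n log \<kappa>\<close>.
\<close>

section \<open>Matrices and positivity\<close>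

text \<open>The constants are forced by symmetry. An operator with eigenvalue 1 on the two
  antisymmetric vectors and x on their symmetric partners has a partial transpose with eigenvalue (1
  + x) / 2 on the span of |01>, |02>, |10>, |20> and eigenvalues plus and minus sqrt 2 * (1 - x) / 2
  on the span of |00> and |11> + |22>. The larger modulus is least where the two agree, at x = (sqrt
  2 - 1)^2 = 3 - 2 sqrt 2, and its value there is 2 - sqrt 2. Jensen's inequality loses nothing at
  the minimiser because the state is flat: 2 rho_v is a projection, so Tr (rho log rho) = -n for n
  copies, and the factor 2^n cancels this term. The distillable entanglement and the regularised
  bound are computed separately; no general inequality between them is used. All estimates are kept
  as operator inequalities, since these pass to tensor powers without diagonalising them, and
  positivity of the concrete operators is certified by identities of the form H * H = c H.\<close>

lemma adjoint_dim [simp]: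
  "dim_row (mat_adjoint A) = dim_col A" "dim_col (mat_adjoint A) = dim_row A"
  by (simp_all add: mat_adjoint_def)

lemma adjoint_carrier_iff [simp]: "mat_adjoint A \<in> carrier_mat n m \<longleftrightarrow> A \<in> carrier_mat m n"
  unfolding carrier_mat_def by auto

lemma adjoint_carrier: "A \<in> carrier_mat m n \<Longrightarrow> mat_adjoint A \<in> carrier_mat n m"
  by simp

lemma mult_carrier_square [simp]:
  "A \<in> carrier_mat n n \<Longrightarrow> B \<in> carrier_mat n n \<Longrightarrow> A * B \<in> carrier_mat n n"
  by (rule mult_carrier_mat)

lemma adjoint_index [simp]:
  "i < dim_col A \<Longrightarrow> j < dim_row A \<Longrightarrow> mat_adjoint A $$ (i, j) = cnj (A $$ (j, i))"
  for A :: "complex mat"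
  by (simp add: mat_adjoint_def mat_of_rows_index)

lemma mult_index_sum:
  assumes "A \<in> carrier_mat m k" "B \<in> carrier_mat k n" "i < m" "j < n"
  shows "(A * B) $$ (i, j) = (\<Sum>l<k. A $$ (i, l) * B $$ (l, j))"
  using assms by (simp add: scalar_prod_def atLeast0LessThan)

lemma mult_vec_index_sum:
  assumes "A \<in> carrier_mat m k" "v \<in> carrier_vec k" "i < m"
  shows "(A *\<^sub>v v) $ i = (\<Sum>l<k. A $$ (i, l) * v $ l)"
  using assms by (simp add: scalar_prod_def atLeast0LessThan)

lemma cscalar_sum:
  fixes v w :: "complex vec"
  assumes "w \<in> carrier_vec n"
  shows "v \<bullet>c w = (\<Sum>i<n. v $ i * cnj (w $ i))"
  using assms by (simp add: scalar_prod_def atLeast0LessThan)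

lemma adjoint_adjoint [simp]: "mat_adjoint (mat_adjoint A) = A" for A :: "complex mat"
  by (rule eq_matI) auto

lemma adjoint_one [simp]: "mat_adjoint (1\<^sub>m n) = (1\<^sub>m n :: complex mat)"
  by (rule eq_matI) auto

lemma adjoint_mult:
  fixes A B :: "complex mat"
  assumes "A \<in> carrier_mat m k" "B \<in> carrier_mat k n"
  shows "mat_adjoint (A * B) = mat_adjoint B * mat_adjoint A"
proof (rule eq_matI)
  fix i j
  assume "i < dim_row (mat_adjoint B * mat_adjoint A)" "j < dim_col (mat_adjoint B * mat_adjoint A)"
  then have ij: "i < n" "j < m" using assms by auto
  have *: "mat_adjoint B \<in> carrier_mat n k" "mat_adjoint A \<in> carrier_mat k m"
    using assms by auto
  have "mat_adjoint (A * B) $$ (i, j) = cnj ((A * B) $$ (j, i))"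
    using assms ij by (subst adjoint_index) auto
  also have "\<dots> = (mat_adjoint B * mat_adjoint A) $$ (i, j)"
    unfolding mult_index_sum[OF assms ij(2,1)] mult_index_sum[OF * ij] cnj_sum
    using assms ij by (intro sum.cong) auto
  finally show "mat_adjoint (A * B) $$ (i, j) = (mat_adjoint B * mat_adjoint A) $$ (i, j)" .
qed (use assms in auto)

lemma adjoint_add:
  fixes A B :: "complex mat"
  assumes "A \<in> carrier_mat m n" "B \<in> carrier_mat m n"
  shows "mat_adjoint (A + B) = mat_adjoint A + mat_adjoint B"
  using assms by (intro eq_matI) auto

lemma adjoint_minus:
  fixes A B :: "complex mat"
  assumes "A \<in> carrier_mat m n" "B \<in> carrier_mat m n"
  shows "mat_adjoint (A - B) = mat_adjoint A - mat_adjoint B"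
  using assms by (intro eq_matI) auto

lemma adjoint_smult: "mat_adjoint (c \<cdot>\<^sub>m A) = cnj c \<cdot>\<^sub>m mat_adjoint A" for A :: "complex mat"
  by (intro eq_matI) auto

lemma cscalar_adjoint:
  fixes A :: "complex mat"
  assumes "A \<in> carrier_mat m n" "v \<in> carrier_vec n" "w \<in> carrier_vec m"
  shows "(A *\<^sub>v v) \<bullet>c w = v \<bullet>c (mat_adjoint A *\<^sub>v w)"
proof -
  have "(A *\<^sub>v v) \<bullet>c w = (\<Sum>i<m. \<Sum>j<n. A $$ (i, j) * v $ j * cnj (w $ i))"
    unfolding cscalar_sum[OF assms(3)]
    by (intro sum.cong refl) (simp add: mult_vec_index_sum[OF assms(1,2)] sum_distrib_right)
  also have "\<dots> = (\<Sum>j<n. \<Sum>i<m. v $ j * cnj (mat_adjoint A $$ (j, i) * w $ i))"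
    using assms by (subst sum.swap) (intro sum.cong, auto)
  also have "\<dots> = v \<bullet>c (mat_adjoint A *\<^sub>v w)"
  proof -
    have *: "mat_adjoint A \<in> carrier_mat n m" using assms by auto
    note * = this mult_mat_vec_carrier[OF this assms(3)]
    show ?thesis unfolding cscalar_sum[OF *(2)]
      by (intro sum.cong refl)
        (simp add: mult_vec_index_sum[OF *(1) assms(3)] sum_distrib_left del: index_mult_mat_vec complex_cnj_mult)
  qed
  finally show ?thesis .
qed

lemma mat_trace_add:
  "A \<in> carrier_mat n n \<Longrightarrow> B \<in> carrier_mat n n \<Longrightarrow> mat_trace (A + B) = mat_trace A + mat_trace B"
  by (simp add: mat_trace_def sum.distrib)

lemma mat_trace_minus:
  "A \<in> carrier_mat n n \<Longrightarrow> B \<in> carrier_mat n n \<Longrightarrow> mat_trace (A - B) = mat_trace A - mat_trace B"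
  by (simp add: mat_trace_def sum_subtractf)

lemma mat_trace_smult: "A \<in> carrier_mat n n \<Longrightarrow> mat_trace (c \<cdot>\<^sub>m A) = c * mat_trace A"
  by (simp add: mat_trace_def sum_distrib_left)

lemma mat_trace_one [simp]: "mat_trace (1\<^sub>m n) = of_nat n"
  by (simp add: mat_trace_def)

lemma mat_trace_mult:
  assumes "A \<in> carrier_mat m n" "B \<in> carrier_mat n m"
  shows "mat_trace (A * B) = (\<Sum>i<m. \<Sum>j<n. A $$ (i, j) * B $$ (j, i))"
  using assms by (simp add: mat_trace_def mult_index_sum[OF assms] del: index_mult_mat(1))

lemma mat_trace_comm:
  assumes "A \<in> carrier_mat m n" "B \<in> carrier_mat n m"
  shows "mat_trace (A * B) = mat_trace (B * A)"
  unfolding mat_trace_mult[OF assms] mat_trace_mult[OF assms(2,1)]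
  by (subst sum.swap) (simp add: mult.commute)

lemma cscalar_self: "v \<in> carrier_vec n \<Longrightarrow> v \<bullet>c v = complex_of_real (\<Sum>i<n. (cmod (v $ i))\<^sup>2)"
  for v :: "complex vec"
  by (simp add: cscalar_sum complex_norm_square del: of_real_power)

lemma cscalar_self_ge0: "v \<in> carrier_vec n \<Longrightarrow> 0 \<le> v \<bullet>c v"
  for v :: "complex vec"
  by (simp add: cscalar_self less_eq_complex_def sum_nonneg)

section \<open>Positive semidefinite matrices\<close>

lemma psd_gram:
  assumes "C \<in> carrier_mat m n"
  shows "positive_semidefinite n (mat_adjoint C * C)"
  unfolding positive_semidefinite_def
proof (intro conjI ballI)
  show "mat_adjoint C * C \<in> carrier_mat n n" using assms by auto
  fix v :: "complex vec" assume v: "v \<in> carrier_vec n"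
  have "(mat_adjoint C * C) *\<^sub>v v = mat_adjoint C *\<^sub>v (C *\<^sub>v v)"
    by (rule assoc_mult_mat_vec[of _ n m _ n]) (use assms v in auto)
  moreover have "(mat_adjoint C *\<^sub>v (C *\<^sub>v v)) \<bullet>c v = (C *\<^sub>v v) \<bullet>c (C *\<^sub>v v)"
    using cscalar_adjoint[of "mat_adjoint C" n m "C *\<^sub>v v" v] assms v by auto
  ultimately show "0 \<le> ((mat_adjoint C * C) *\<^sub>v v) \<bullet>c v"
    using cscalar_self_ge0[of "C *\<^sub>v v" m] assms v by auto
qed

lemma psd_carrier: "positive_semidefinite d A \<Longrightarrow> A \<in> carrier_mat d d"
  by (simp add: positive_semidefinite_def)

lemma psd_add:
  assumes "positive_semidefinite d A" "positive_semidefinite d B"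
  shows "positive_semidefinite d (A + B)"
  unfolding positive_semidefinite_def
proof (intro conjI ballI)
  have c: "A \<in> carrier_mat d d" "B \<in> carrier_mat d d" using assms psd_carrier by auto
  then show "A + B \<in> carrier_mat d d" by auto
  fix v :: "complex vec" assume v: "v \<in> carrier_vec d"
  have "((A + B) *\<^sub>v v) \<bullet>c v = (A *\<^sub>v v) \<bullet>c v + (B *\<^sub>v v) \<bullet>c v"
    using c v by (simp add: add_mult_distrib_mat_vec add_scalar_prod_distrib[of _ d])
  then show "0 \<le> ((A + B) *\<^sub>v v) \<bullet>c v"
    using assms v by (auto simp: positive_semidefinite_def)
qed

lemma psd_smult:
  assumes "positive_semidefinite d A" "0 \<le> c"
  shows "positive_semidefinite d (complex_of_real c \<cdot>\<^sub>m A)"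
  unfolding positive_semidefinite_def
proof (intro conjI ballI)
  have A: "A \<in> carrier_mat d d" using assms psd_carrier by auto
  then show "complex_of_real c \<cdot>\<^sub>m A \<in> carrier_mat d d" by auto
  fix v :: "complex vec" assume v: "v \<in> carrier_vec d"
  have "(complex_of_real c \<cdot>\<^sub>m A *\<^sub>v v) \<bullet>c v = complex_of_real c * ((A *\<^sub>v v) \<bullet>c v)"
  proof -
    have "complex_of_real c \<cdot>\<^sub>m A *\<^sub>v v = complex_of_real c \<cdot>\<^sub>v (A *\<^sub>v v)"
      using A v by (intro eq_vecI) auto
    then show ?thesis using A v by simp
  qed
  moreover have "0 \<le> (A *\<^sub>v v) \<bullet>c v" using assms v by (auto simp: positive_semidefinite_def)
  ultimately show "0 \<le> (complex_of_real c \<cdot>\<^sub>m A *\<^sub>v v) \<bullet>c v"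
    using assms(2) by (simp add: less_eq_complex_def)
qed

text \<open>Positivity is defined by the quadratic form alone, so symmetry has to be recovered by
  polarisation: the form is real on \<open>e_i + z e_j\<close>, and z = 0, z = 1 and z equal to the
  imaginary unit determine the imaginary and real parts of the entries.\<close>

lemma psd_hermitian:
  assumes "positive_semidefinite d A"
  shows "mat_adjoint A = A"
proof -
  have A: "A \<in> carrier_mat d d" using assms psd_carrier by auto
  have im: "Im ((A *\<^sub>v v) \<bullet>c v) = 0" if "v \<in> carrier_vec d" for v
    using assms that by (auto simp: positive_semidefinite_def less_eq_complex_def)
  have quad: "(A *\<^sub>v (unit_vec d i + z \<cdot>\<^sub>v unit_vec d j)) \<bullet>c (unit_vec d i + z \<cdot>\<^sub>v unit_vec d j)
      = A $$ (i, i) + z * A $$ (i, j) + cnj z * A $$ (j, i) + z * cnj z * A $$ (j, j)"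
    if "i < d" "j < d" for i j z
  proof -
    let ?w = "unit_vec d i + z \<cdot>\<^sub>v unit_vec d j"
    have w: "?w \<in> carrier_vec d" by simp
    have Aw: "(A *\<^sub>v ?w) $ k = A $$ (k, i) + z * A $$ (k, j)" if "k < d" for k
    proof -
      have "(A *\<^sub>v ?w) $ k = (\<Sum>l<d. (if l = i then A $$ (k, i) else 0) + (if l = j then z * A $$ (k, j) else 0))"
        unfolding mult_vec_index_sum[OF A w that]
        by (intro sum.cong refl) (auto simp: unit_vec_def algebra_simps)
      then show ?thesis using \<open>i < d\<close> \<open>j < d\<close> by (simp add: sum.distrib)
    qed
    have "(A *\<^sub>v ?w) \<bullet>c ?w = (\<Sum>k<d. (A $$ (k, i) + z * A $$ (k, j)) * cnj (?w $ k))"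
      unfolding cscalar_sum[OF w] by (intro sum.cong refl) (simp add: Aw del: index_mult_mat_vec)
    also have "\<dots> = (\<Sum>k<d. (if k = i then A $$ (k, i) + z * A $$ (k, j) else 0)
        + (if k = j then cnj z * (A $$ (k, i) + z * A $$ (k, j)) else 0))"
      by (intro sum.cong refl) (auto simp: unit_vec_def algebra_simps)
    also have "\<dots> = A $$ (i, i) + z * A $$ (i, j) + cnj z * A $$ (j, i) + z * cnj z * A $$ (j, j)"
      using that by (simp add: sum.distrib algebra_simps)
    finally show ?thesis .
  qed
  have quad_im: "Im (A $$ (i, i) + z * A $$ (i, j) + cnj z * A $$ (j, i) + z * cnj z * A $$ (j, j)) = 0"
    if "i < d" "j < d" for i j z
    unfolding quad[OF that, symmetric] by (rule im) simp
  have diag: "Im (A $$ (i, i)) = 0" if "i < d" for i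
    using quad_im[OF that that, of 0] by simp
  have herm: "cnj (A $$ (j, i)) = A $$ (i, j)" if ij: "i < d" "j < d" for i j
  proof -
    have "Im (A $$ (i, j)) + Im (A $$ (j, i)) = 0"
      using quad_im[OF ij, of 1] diag ij by simp
    moreover have "Re (A $$ (i, j)) - Re (A $$ (j, i)) = 0"
      using quad_im[OF ij, of \<i>] diag ij by simp
    ultimately show ?thesis by (simp add: complex_eq_iff)
  qed
  show ?thesis
  proof (rule eq_matI)
    fix i j assume "i < dim_row A" "j < dim_col A"
    then show "mat_adjoint A $$ (i, j) = A $$ (i, j)"
      using A herm[of i j] by simp
  qed (simp_all add: carrier_matD[OF A])
qed

section \<open>Real diagonal and unitary matrices\<close>

lemma real_diag_carrier [simp]: "real_diag d x \<in> carrier_mat d d"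
  by (simp add: real_diag_def)

lemma real_diag_dim [simp]: "dim_row (real_diag d x) = d" "dim_col (real_diag d x) = d"
  by (simp_all add: real_diag_def)

lemma real_diag_index [simp]:
  "i < d \<Longrightarrow> j < d \<Longrightarrow> real_diag d x $$ (i, j) = (if i = j then complex_of_real (x i) else 0)"
  by (simp add: real_diag_def)

lemma real_diag_adjoint [simp]: "mat_adjoint (real_diag d x) = real_diag d x"
  by (rule eq_matI) auto

lemma real_diag_mult_index:
  assumes "G \<in> carrier_mat d n" "i < d" "j < n"
  shows "(real_diag d x * G) $$ (i, j) = x i * G $$ (i, j)"
proof -
  have "(real_diag d x * G) $$ (i, j) = (\<Sum>l<d. if l = i then x i * G $$ (i, j) else 0)"
    unfolding mult_index_sum[OF real_diag_carrier assms]
    using assms by (intro sum.cong refl) auto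
  then show ?thesis using assms by simp
qed

lemma mult_real_diag_index:
  assumes "G \<in> carrier_mat n d" "i < n" "j < d"
  shows "(G * real_diag d x) $$ (i, j) = G $$ (i, j) * x j"
proof -
  have "(G * real_diag d x) $$ (i, j) = (\<Sum>l<d. if l = j then G $$ (i, j) * x j else 0)"
    unfolding mult_index_sum[OF assms(1) real_diag_carrier assms(2,3)]
    using assms by (intro sum.cong refl) auto
  then show ?thesis using assms by simp
qed

lemma real_diag_mult [simp]: "real_diag d x * real_diag d y = real_diag d (\<lambda>i. x i * y i)"
  by (rule eq_matI) (auto simp: real_diag_mult_index[OF real_diag_carrier] simp del: index_mult_mat(1))

lemma unitary_matD:
  assumes "unitary_mat d U"
  shows "U \<in> carrier_mat d d" "U * mat_adjoint U = 1\<^sub>m d" "mat_adjoint U * U = 1\<^sub>m d"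
  using assms by (auto simp: unitary_mat_def)

lemma unitary_mat_mult:
  assumes "unitary_mat d U" "unitary_mat d V"
  shows "unitary_mat d (U * V)"
proof -
  note U = unitary_matD[OF assms(1)] and V = unitary_matD[OF assms(2)]
  have c: "mat_adjoint U \<in> carrier_mat d d" "mat_adjoint V \<in> carrier_mat d d"
    using U V by auto
  have "U * V * (mat_adjoint V * mat_adjoint U) = U * (V * mat_adjoint V) * mat_adjoint U"
    using U(1) V(1) c by (simp add: assoc_mult_mat[of _ d d _ d _ d])
  moreover have "mat_adjoint V * mat_adjoint U * (U * V) = mat_adjoint V * (mat_adjoint U * U) * V"
    using U(1) V(1) c by (simp add: assoc_mult_mat[of _ d d _ d _ d])
  ultimately show ?thesis
    using U V c by (simp add: unitary_mat_def adjoint_mult[OF U(1) V(1)])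
qed

section \<open>The spectral theorem for Hermitian matrices\<close>

lemma extend_to_unitary:
  fixes v :: "complex vec"
  assumes "v \<in> carrier_vec n" "v \<noteq> 0\<^sub>v n"
  obtains U c where "unitary_mat n U" "c \<noteq> 0" "\<And>i. i < n \<Longrightarrow> U $$ (i, 0) = c * v $ i"
proof -
  interpret cof_vec_space n "TYPE(complex)" .
  define b where "b = basis_completion v"
  define ws where "ws = gram_schmidt n b"
  note bc = basis_completion[OF assms, folded b_def]
  have n: "0 < n" using assms by (cases n) auto
  obtain bs where bs: "b = v # bs" using bc(6,7) n by (cases b) auto
  have hd: "hd ws = v" unfolding ws_def bs by (rule gram_schmidt_hd[OF assms(1)])
  have ws: "set ws \<subseteq> carrier_vec n" "corthogonal ws" "length ws = n"
    using gram_schmidt_result[OF bc(2,4,5) refl, folded ws_def] bc(6) by auto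
  have ws0: "ws ! 0 = v" using hd ws(3) n by (metis hd_conv_nth length_0_conv less_numeral_extra(3))
  have wsc: "ws ! j \<in> carrier_vec n" if "j < n" for j using ws that by auto
  \<comment> \<open>The vectors of \<open>ws\<close> are orthogonal but not of unit length. Dividing
    by the norms \<open>q j\<close> is the reason why the first column of \<open>U\<close> is
    \<open>v\<close> only up to a factor.\<close>
  define q where "q j = sqrt (\<Sum>i<n. (cmod (ws ! j $ i))\<^sup>2)" for j
  have q2: "ws ! j \<bullet>c ws ! j = complex_of_real (q j * q j)" if "j < n" for j
    using cscalar_self[OF wsc[OF that]] by (simp add: q_def sum_nonneg)
  have qnz: "q j \<noteq> 0" if "j < n" for j
    using corthogonalD[OF ws(2), of j j] q2[OF that] that ws(3) by auto
  define U where "U = mat n n (\<lambda>(i, j). ws ! j $ i / q j)"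
  have U: "U \<in> carrier_mat n n" by (simp add: U_def)
  have aUU: "mat_adjoint U * U = 1\<^sub>m n"
  proof (rule eq_matI)
    fix i j assume "i < dim_row (1\<^sub>m n :: complex mat)" "j < dim_col (1\<^sub>m n :: complex mat)"
    then have ij: "i < n" "j < n" by auto
    have "(mat_adjoint U * U) $$ (i, j) = (\<Sum>l<n. cnj (ws ! i $ l / q i) * (ws ! j $ l / q j))"
      unfolding mult_index_sum[OF adjoint_carrier[OF U] U ij]
      using ij U by (intro sum.cong refl) (simp add: U_def)
    also have "\<dots> = (ws ! j \<bullet>c ws ! i) / (q i * q j)"
      unfolding cscalar_sum[OF wsc[OF ij(1)]] sum_divide_distrib
      by (intro sum.cong refl) (simp add: mult.commute)
    also have "\<dots> = 1\<^sub>m n $$ (i, j)"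
      using corthogonalD[OF ws(2), of j i] q2[OF ij(1)] qnz[OF ij(1)] ij ws(3) by auto
    finally show "(mat_adjoint U * U) $$ (i, j) = 1\<^sub>m n $$ (i, j)" .
  qed (use U in auto)
  have "U * mat_adjoint U = 1\<^sub>m n"
    by (rule mat_mult_left_right_inverse[OF adjoint_carrier[OF U] U aUU])
  then have "unitary_mat n U" using U aUU by (simp add: unitary_mat_def)
  moreover have "complex_of_real (1 / q 0) \<noteq> 0" using qnz[OF n] by simp
  moreover have "U $$ (i, 0) = complex_of_real (1 / q 0) * v $ i" if "i < n" for i
    using that n by (simp add: U_def ws0)
  ultimately show ?thesis by (rule that)
qed

text \<open>Deflation. In a unitary basis that starts with an eigenvector, the first column of
  \<open>B\<close> is a multiple of the first basis vector. Since \<open>B\<close> is Hermitian, its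
  first row has the same form, so \<open>B\<close> is the direct sum of a real scalar and a
  Hermitian matrix \<open>A3\<close> of dimension one less.\<close>

theorem hermitian_diagonalization:
  assumes "A \<in> carrier_mat n n" "mat_adjoint A = A"
  shows "\<exists>U x. unitary_mat n U \<and> A = U * real_diag n x * mat_adjoint U"
  using assms
proof (induction n arbitrary: A)
  case 0
  then show ?case by (intro exI[of _ "1\<^sub>m 0"] exI) (auto simp: unitary_mat_def)
next
  case (Suc m)
  note A = Suc.prems(1) and herm = Suc.prems(2)
  let ?n = "Suc m"
  obtain e where "e \<in> spectrum A" using spectrum_non_empty[OF A] by auto
  then obtain v where ev: "eigenvector A v e" by (auto simp: spectrum_def eigenvalue_def)
  then have v: "v \<in> carrier_vec ?n" "v \<noteq> 0\<^sub>v ?n" "A *\<^sub>v v = e \<cdot>\<^sub>v v"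
    using A by (auto simp: eigenvector_def)
  obtain U c where U: "unitary_mat ?n U" and c: "c \<noteq> 0"
    and U0: "\<And>i. i < ?n \<Longrightarrow> U $$ (i, 0) = c * v $ i" using extend_to_unitary[OF v(1,2)] by blast
  note U' = unitary_matD[OF U]
  have aU: "mat_adjoint U \<in> carrier_mat ?n ?n" using U' by auto
  define B where "B = mat_adjoint U * A * U"
  have B: "B \<in> carrier_mat ?n ?n" using aU A U' by (simp add: B_def)
  have A_eq: "A = U * B * mat_adjoint U"
  proof -
    have "U * B * mat_adjoint U = (U * mat_adjoint U) * A * (U * mat_adjoint U)"
      using aU A U'(1) by (simp add: B_def assoc_mult_mat[of _ ?n ?n _ ?n _ ?n])
    then show ?thesis using A U' by simp
  qed
  have Bh: "mat_adjoint B = B"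
    using aU A U'(1) herm
    by (simp add: B_def adjoint_mult[of _ ?n ?n _ ?n] assoc_mult_mat[of _ ?n ?n _ ?n _ ?n])
  have AU0: "(A * U) $$ (i, 0) = e * U $$ (i, 0)" if "i < ?n" for i
  proof -
    have "(A * U) $$ (i, 0) = c * (\<Sum>l<?n. A $$ (i, l) * v $ l)"
      unfolding mult_index_sum[OF A U'(1) that zero_less_Suc] sum_distrib_left
      by (intro sum.cong refl) (simp add: U0 ac_simps)
    also have "(\<Sum>l<?n. A $$ (i, l) * v $ l) = e * v $ i"
      using mult_vec_index_sum[OF A v(1) that] v that by simp
    finally show ?thesis using U0[OF that] by simp
  qed
  have B0: "B $$ (i, 0) = (if i = 0 then e else 0)" if "i < ?n" for i
  proof -
    have "B $$ (i, 0) = (mat_adjoint U * (A * U)) $$ (i, 0)"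
      using aU A U'(1) by (simp add: B_def assoc_mult_mat[of _ ?n ?n _ ?n _ ?n])
    also have "\<dots> = (\<Sum>l<?n. mat_adjoint U $$ (i, l) * (A * U) $$ (l, 0))"
      by (rule mult_index_sum) (use aU A U'(1) that in auto)
    also have "\<dots> = e * (\<Sum>l<?n. mat_adjoint U $$ (i, l) * U $$ (l, 0))"
      unfolding sum_distrib_left by (intro sum.cong refl) (simp add: AU0 del: index_mult_mat(1))
    also have "(\<Sum>l<?n. mat_adjoint U $$ (i, l) * U $$ (l, 0)) = (mat_adjoint U * U) $$ (i, 0)"
      by (rule mult_index_sum[symmetric]) (use aU U'(1) that in auto)
    finally show ?thesis using U'(3) that by auto
  qed
  have Bsym: "cnj (B $$ (j, i)) = B $$ (i, j)" if "i < ?n" "j < ?n" for i j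
    using adjoint_index[of i B j] that B by (simp add: Bh)
  define A3 where "A3 = mat m m (\<lambda>(i, j). B $$ (Suc i, Suc j))"
  have A3: "A3 \<in> carrier_mat m m" by (simp add: A3_def)
  have "mat_adjoint A3 = A3"
    by (rule eq_matI) (use Bsym in \<open>auto simp: A3_def\<close>)
  then obtain V x where V: "unitary_mat m V" and A3_eq: "A3 = V * real_diag m x * mat_adjoint V"
    using Suc.IH[OF A3] by auto
  note V' = unitary_matD[OF V]
  have aV: "mat_adjoint V \<in> carrier_mat m m" using V' by auto
  let ?x = "\<lambda>i. case i of 0 \<Rightarrow> Re e | Suc i \<Rightarrow> x i"
  define blk :: "complex \<Rightarrow> complex mat \<Rightarrow> complex mat"
    where "blk p X = four_block_mat (mat 1 1 (\<lambda>_. p)) (0\<^sub>m 1 m) (0\<^sub>m m 1) X" for p X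
  have e: "complex_of_real (Re e) = e"
    using Bsym[of 0 0] B0[of 0] by (simp add: complex_eq_iff)
  have blk_mult: "blk p X * blk r Y = blk (p * r) (X * Y)"
    if "X \<in> carrier_mat m m" "Y \<in> carrier_mat m m" for p r X Y
  proof -
    have "mat 1 1 (\<lambda>_. p) * mat 1 1 (\<lambda>_. r) = mat 1 1 (\<lambda>_. p * r)"
      by (rule eq_matI) (auto simp: scalar_prod_def)
    then show ?thesis
      using that unfolding blk_def by (subst mult_four_block_mat[of _ 1 1 _ m _ m]) auto
  qed
  have blk_adj: "mat_adjoint (blk p X) = blk (cnj p) (mat_adjoint X)"
    if "X \<in> carrier_mat m m" for p X
    unfolding blk_def by (rule eq_matI) (use that in auto)
  have blk_one: "blk 1 (1\<^sub>m m) = 1\<^sub>m ?n"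
    unfolding blk_def by (rule eq_matI) auto
  have blk_diag: "blk e (real_diag m x) = real_diag ?n ?x"
    unfolding blk_def by (rule eq_matI) (auto simp: e split: nat.split)
  have blk_B: "B = blk e A3"
    unfolding blk_def
  proof (rule eq_matI)
    let ?M = "four_block_mat (mat 1 1 (\<lambda>_. e)) (0\<^sub>m 1 m) (0\<^sub>m m 1) A3"
    fix i j assume "i < dim_row ?M" "j < dim_col ?M"
    then have ij: "i < ?n" "j < ?n" using A3 by auto
    show "B $$ (i, j) = ?M $$ (i, j)"
    proof (cases j)
      case 0
      then show ?thesis using B0[OF ij(1)] ij A3 by auto
    next
      case (Suc j')
      then show ?thesis using Bsym[OF ij] B0[OF ij(2)] ij A3
        by (cases i) (auto simp: A3_def)
    qed
  qed (use B A3 in auto)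
  define V1 where "V1 = blk 1 V"
  have V1: "unitary_mat ?n V1"
  proof -
    have "V1 \<in> carrier_mat ?n ?n" using V' by (auto simp: V1_def blk_def)
    then show ?thesis
      using V' aV by (simp add: unitary_mat_def V1_def blk_adj blk_mult blk_one)
  qed
  have B_eq: "B = V1 * real_diag ?n ?x * mat_adjoint V1"
    using V' aV by (simp add: blk_B A3_eq V1_def blk_adj blk_mult blk_diag[symmetric])
  note V1' = unitary_matD[OF V1]
  have "A = (U * V1) * real_diag ?n ?x * mat_adjoint (U * V1)"
    using U'(1) V1'(1) aU adjoint_carrier[OF V1'(1)]
    by (subst A_eq, subst B_eq)
      (simp add: adjoint_mult[of _ ?n ?n _ ?n] assoc_mult_mat[of _ ?n ?n _ ?n _ ?n])
  then show ?case using unitary_mat_mult[OF U V1] by blast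
qed

section \<open>Eigenvalues, square roots and traces of positive matrices\<close>

lemma psd_congruence:
  assumes "positive_semidefinite d A" "C \<in> carrier_mat d n"
  shows "positive_semidefinite n (mat_adjoint C * A * C)"
  unfolding positive_semidefinite_def
proof (intro conjI ballI)
  have A: "A \<in> carrier_mat d d" using assms psd_carrier by auto
  have aC: "mat_adjoint C \<in> carrier_mat n d" using assms by auto
  note AC = mult_carrier_mat[OF A assms(2)]
  show "mat_adjoint C * A * C \<in> carrier_mat n n"
    by (rule mult_carrier_mat[OF mult_carrier_mat[OF aC A] assms(2)])
  fix v :: "complex vec" assume v: "v \<in> carrier_vec n"
  note Cv = mult_mat_vec_carrier[OF assms(2) v]
  have "(mat_adjoint C * A * C) *\<^sub>v v = mat_adjoint C *\<^sub>v (A *\<^sub>v (C *\<^sub>v v))"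
    using assoc_mult_mat[OF aC A assms(2)] assoc_mult_mat_vec[OF aC AC v]
      assoc_mult_mat_vec[OF A assms(2) v] by simp
  moreover have "(mat_adjoint C *\<^sub>v (A *\<^sub>v (C *\<^sub>v v))) \<bullet>c v = (A *\<^sub>v (C *\<^sub>v v)) \<bullet>c (C *\<^sub>v v)"
    using cscalar_adjoint[OF aC mult_mat_vec_carrier[OF A Cv] v] by simp
  ultimately show "0 \<le> ((mat_adjoint C * A * C) *\<^sub>v v) \<bullet>c v"
    using assms(1) Cv by (simp add: positive_semidefinite_def)
qed

lemma psd_diag_ge0:
  assumes "positive_semidefinite d A" "i < d"
  shows "0 \<le> A $$ (i, i)"
proof -
  have A: "A \<in> carrier_mat d d" using assms psd_carrier by auto
  have "(A *\<^sub>v unit_vec d i) \<bullet>c unit_vec d i = (\<Sum>k<d. if k = i then A $$ (i, i) else 0)"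
    unfolding cscalar_sum[OF unit_vec_carrier] using A assms(2)
    by (intro sum.cong refl) auto
  then have "(A *\<^sub>v unit_vec d i) \<bullet>c unit_vec d i = A $$ (i, i)" using assms(2) by simp
  moreover have "0 \<le> (A *\<^sub>v unit_vec d i) \<bullet>c unit_vec d i"
    using assms(1) unit_vec_carrier unfolding positive_semidefinite_def by blast
  ultimately show ?thesis by simp
qed

lemma psd_trace_ge0: "positive_semidefinite d A \<Longrightarrow> 0 \<le> mat_trace A"
  using psd_diag_ge0[of d A] psd_carrier[of d A] by (auto simp: mat_trace_def intro!: sum_nonneg)

lemma unitary_conj_diag:
  assumes "unitary_mat d U"
  shows "mat_adjoint U * (U * real_diag d x * mat_adjoint U) * U = real_diag d x"
proof -
  note U = unitary_matD[OF assms]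
  have "mat_adjoint U * (U * real_diag d x * mat_adjoint U) * U
      = (mat_adjoint U * U) * real_diag d x * (mat_adjoint U * U)"
    using U(1) by (simp add: assoc_mult_mat[of _ d d _ d _ d])
  then show ?thesis using U by simp
qed

lemma psd_eigenvalue_ge0:
  assumes "positive_semidefinite d (U * real_diag d x * mat_adjoint U)" "unitary_mat d U" "i < d"
  shows "0 \<le> x i"
  using psd_diag_ge0[OF psd_congruence[OF assms(1) unitary_matD(1)[OF assms(2)]] assms(3)] assms(3)
  by (simp add: unitary_conj_diag[OF assms(2)] less_eq_complex_def)

lemma mult_conj_diag:
  assumes "unitary_mat d U"
  shows "(U * real_diag d x * mat_adjoint U) * (U * real_diag d y * mat_adjoint U)
    = U * real_diag d (\<lambda>i. x i * y i) * mat_adjoint U"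
proof -
  note U = unitary_matD[OF assms]
  have "(U * real_diag d x * mat_adjoint U) * (U * real_diag d y * mat_adjoint U)
      = U * real_diag d x * (mat_adjoint U * U) * real_diag d y * mat_adjoint U"
    using U(1) by (simp add: assoc_mult_mat[of _ d d _ d _ d] del: real_diag_mult)
  also have "\<dots> = U * (real_diag d x * real_diag d y) * mat_adjoint U"
    using U by (simp add: assoc_mult_mat[of _ d d _ d _ d] del: real_diag_mult)
  finally show ?thesis by simp
qed

lemma trace_unitary_conj:
  assumes "unitary_mat d U" "A \<in> carrier_mat d d"
  shows "mat_trace (U * A * mat_adjoint U) = mat_trace A"
proof -
  note U = unitary_matD[OF assms(1)]
  have "mat_trace (U * A * mat_adjoint U) = mat_trace (mat_adjoint U * (U * A))"
    by (rule mat_trace_comm[of _ d d]) (use U assms in auto)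
  also have "mat_adjoint U * (U * A) = mat_adjoint U * U * A"
    using U(1) assms by (simp add: assoc_mult_mat[of _ d d _ d _ d])
  finally show ?thesis using U assms by simp
qed

lemma trace_real_diag: "mat_trace (real_diag d x) = complex_of_real (\<Sum>i<d. x i)"
  by (simp add: mat_trace_def)

text \<open>The factor takes square roots of the eigenvalues in an eigenbasis. Written as Gram
  matrices, positive operators have positive tensor products, and traces of their products reduce to
  congruences.\<close>

lemma psd_obtain_gram:
  assumes "positive_semidefinite d A"
  obtains C where "C \<in> carrier_mat d d" "A = mat_adjoint C * C"
proof -
  have A: "A \<in> carrier_mat d d" using assms psd_carrier by auto
  obtain U x where U: "unitary_mat d U" and Ax: "A = U * real_diag d x * mat_adjoint U"
    using hermitian_diagonalization[OF A psd_hermitian[OF assms]] by blast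
  have x: "0 \<le> x i" if "i < d" for i
    using psd_eigenvalue_ge0[of d U x i] assms U Ax that by simp
  note U' = unitary_matD[OF U]
  define C where "C = real_diag d (\<lambda>i. sqrt (x i)) * mat_adjoint U"
  have "mat_adjoint C * C = U * (real_diag d (\<lambda>i. sqrt (x i)) * real_diag d (\<lambda>i. sqrt (x i))) * mat_adjoint U"
    using U'(1) by (simp add: C_def adjoint_mult[of _ d d _ d] assoc_mult_mat[of _ d d _ d _ d] del: real_diag_mult)
  also have "real_diag d (\<lambda>i. sqrt (x i)) * real_diag d (\<lambda>i. sqrt (x i)) = real_diag d x"
    unfolding real_diag_mult using x by (intro eq_matI) auto
  finally show ?thesis using that[of C] U'(1) Ax by (simp add: C_def)
qed

lemma trace_mult_psd_ge0:
  assumes "positive_semidefinite d A" "positive_semidefinite d B"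
  shows "0 \<le> mat_trace (A * B)"
proof -
  obtain C where C: "C \<in> carrier_mat d d" "A = mat_adjoint C * C" by (rule psd_obtain_gram[OF assms(1)])
  have B: "B \<in> carrier_mat d d" using assms psd_carrier by auto
  have "mat_trace (A * B) = mat_trace (mat_adjoint C * (C * B))"
    using C B by (simp add: assoc_mult_mat[of _ d d _ d _ d])
  also have "\<dots> = mat_trace (C * B * mat_adjoint C)"
    by (rule mat_trace_comm[of _ d d]) (use C B in auto)
  also have "0 \<le> \<dots>"
    using psd_trace_ge0[OF psd_congruence[OF assms(2) adjoint_carrier[OF C(1)]]] by simp
  finally show ?thesis .
qed

text \<open>Here \<open>H\<close> is \<open>c\<close> times a projection, hence a positive multiple
  of \<open>H* H\<close>. This certificate replaces eigenvalue computations: for each concrete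
  operator below, positivity comes down to one product.\<close>

lemma psd_idempotent:
  assumes "H \<in> carrier_mat d d" "mat_adjoint H = H" "H * H = complex_of_real c \<cdot>\<^sub>m H" "0 < c"
  shows "positive_semidefinite d H"
proof -
  have "H = complex_of_real (1 / c) \<cdot>\<^sub>m (mat_adjoint H * H)"
    using assms by (intro eq_matI) auto
  then show ?thesis using psd_smult[OF psd_gram[OF assms(1)], of "1 / c"] assms(4) by simp
qed

section \<open>Functional calculus and the trace norm\<close>

text \<open>Only the diagonalisation behind the chosen value is exposed. Independence of the choice
  is needed for traces alone, where \<open>sum_eigenvalues_unique\<close> supplies it.\<close>

lemma hermitian_fun_obtain:
  assumes "A \<in> carrier_mat d d" "mat_adjoint A = A"
  obtains U x where "unitary_mat d U" "A = U * real_diag d x * mat_adjoint U"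
    "hermitian_fun f A = U * real_diag d (f \<circ> x) * mat_adjoint U"
proof -
  have dim: "dim_row A = d" using assms by auto
  have "\<exists>B U x. unitary_mat d U \<and> A = U * real_diag d x * mat_adjoint U
      \<and> B = U * real_diag d (f \<circ> x) * mat_adjoint U"
    using hermitian_diagonalization[OF assms] by blast
  from someI_ex[OF this] show ?thesis
    using that unfolding hermitian_fun_def dim by blast
qed

lemma trace_norm_obtain:
  assumes "X \<in> carrier_mat d d"
  obtains U x where "unitary_mat d U" "mat_adjoint X * X = U * real_diag d x * mat_adjoint U"
    "\<And>i. i < d \<Longrightarrow> 0 \<le> x i" "trace_norm X = (\<Sum>i<d. sqrt (x i))"
proof -
  have c: "mat_adjoint X * X \<in> carrier_mat d d" "mat_adjoint (mat_adjoint X * X) = mat_adjoint X * X"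
    using assms by (simp_all add: adjoint_mult[of _ d d _ d])
  obtain U x where U: "unitary_mat d U" "mat_adjoint X * X = U * real_diag d x * mat_adjoint U"
    and f: "hermitian_fun sqrt (mat_adjoint X * X) = U * real_diag d (sqrt \<circ> x) * mat_adjoint U"
    by (rule hermitian_fun_obtain[OF c])
  have "0 \<le> x i" if "i < d" for i
    using psd_gram[OF assms] psd_eigenvalue_ge0[of d U x i] U that by simp
  moreover have "trace_norm X = (\<Sum>i<d. sqrt (x i))"
    unfolding trace_norm_def f trace_unitary_conj[OF U(1) real_diag_carrier] trace_real_diag by simp
  ultimately show ?thesis using that U by blast
qed

lemma trace_norm_ge0: "X \<in> carrier_mat d d \<Longrightarrow> 0 \<le> trace_norm X"
  by (rule trace_norm_obtain[of X d]) (auto intro!: sum_nonneg)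

text \<open>The overlaps of the two eigenbases vanish unless the eigenvalues agree.\<close>

lemma sum_eigenvalues_unique:
  fixes f :: "real \<Rightarrow> real"
  assumes "unitary_mat d U" "unitary_mat d V"
    and "U * real_diag d x * mat_adjoint U = V * real_diag d y * mat_adjoint V"
  shows "(\<Sum>i<d. f (x i)) = (\<Sum>i<d. f (y i))"
proof -
  note U = unitary_matD[OF assms(1)] and V = unitary_matD[OF assms(2)]
  define W where "W = mat_adjoint U * V"
  have W: "W \<in> carrier_mat d d" using U V by (simp add: W_def)
  have "real_diag d x * W = mat_adjoint U * (U * real_diag d x * mat_adjoint U) * U * W"
    by (simp add: unitary_conj_diag[OF assms(1)])
  also have "\<dots> = mat_adjoint U * (V * real_diag d y * mat_adjoint V) * (U * mat_adjoint U) * V"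
    using U(1) V(1) by (simp add: assms(3) W_def assoc_mult_mat[of _ d d _ d _ d])
  also have "\<dots> = mat_adjoint U * V * real_diag d y * (mat_adjoint V * V)"
    using U V(1) by (simp add: assoc_mult_mat[of _ d d _ d _ d])
  also have "\<dots> = W * real_diag d y"
    using U(1) V by (simp add: W_def)
  finally have comm: "real_diag d x * W = W * real_diag d y" .
  have eq: "f (x i) * (cmod (W $$ (i, j)))\<^sup>2 = f (y j) * (cmod (W $$ (i, j)))\<^sup>2" if "i < d" "j < d" for i j
  proof -
    have "x i * W $$ (i, j) = W $$ (i, j) * y j"
      using arg_cong[OF comm, of "\<lambda>M. M $$ (i, j)"]
      unfolding real_diag_mult_index[OF W that] mult_real_diag_index[OF W that] .
    then show ?thesis by auto
  qed
  have "W * mat_adjoint W = mat_adjoint U * (V * mat_adjoint V) * U"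
    using U(1) V(1) by (simp add: W_def adjoint_mult[of _ d d _ d] assoc_mult_mat[of _ d d _ d _ d])
  then have WW: "W * mat_adjoint W = 1\<^sub>m d" using U V by simp
  have "mat_adjoint W * W = mat_adjoint V * (U * mat_adjoint U) * V"
    using U(1) V(1) by (simp add: W_def adjoint_mult[of _ d d _ d] assoc_mult_mat[of _ d d _ d _ d])
  then have WW': "mat_adjoint W * W = 1\<^sub>m d" using U V by simp
  have row: "(\<Sum>j<d. (cmod (W $$ (i, j)))\<^sup>2) = 1" if "i < d" for i
  proof -
    have "complex_of_real (\<Sum>j<d. (cmod (W $$ (i, j)))\<^sup>2) = (W * mat_adjoint W) $$ (i, i)"
      unfolding mult_index_sum[OF W adjoint_carrier[OF W] that that] of_real_sum complex_norm_square
      using W that by (intro sum.cong) auto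
    then show ?thesis using that unfolding WW by (metis index_one_mat(1) of_real_eq_1_iff)
  qed
  have col: "(\<Sum>i<d. (cmod (W $$ (i, j)))\<^sup>2) = 1" if "j < d" for j
  proof -
    have "complex_of_real (\<Sum>i<d. (cmod (W $$ (i, j)))\<^sup>2) = (mat_adjoint W * W) $$ (j, j)"
      unfolding mult_index_sum[OF adjoint_carrier[OF W] W that that] of_real_sum complex_norm_square
      using W that by (intro sum.cong) auto
    then show ?thesis using that unfolding WW' by (metis index_one_mat(1) of_real_eq_1_iff)
  qed
  \<comment> \<open>The numbers |W_ij|^2 form a doubly stochastic matrix that is supported where
    \<open>x i = y j\<close>. Inserting its row sums and collecting its column sums carries one list
    of eigenvalues to the other.\<close>
  have "(\<Sum>i<d. f (x i)) = (\<Sum>i<d. \<Sum>j<d. f (x i) * (cmod (W $$ (i, j)))\<^sup>2)"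
    by (simp add: row flip: sum_distrib_left)
  also have "\<dots> = (\<Sum>j<d. \<Sum>i<d. f (y j) * (cmod (W $$ (i, j)))\<^sup>2)"
    by (subst sum.swap) (intro sum.cong refl, simp add: eq)
  also have "\<dots> = (\<Sum>i<d. f (y i))"
    by (simp add: col flip: sum_distrib_left)
  finally show ?thesis .
qed

text \<open>This is how trace norms are computed: an explicit positive root \<open>S\<close> of
  \<open>X* X\<close> may stand in for the one selected by the functional calculus, because both
  have the same sum of eigenvalues.\<close>

lemma trace_norm_eq_trace:
  assumes "X \<in> carrier_mat d d" "positive_semidefinite d S" "S * S = mat_adjoint X * X"
  shows "trace_norm X = Re (mat_trace S)"
proof -
  have S: "S \<in> carrier_mat d d" using assms psd_carrier by auto
  obtain U x where U: "unitary_mat d U" "mat_adjoint X * X = U * real_diag d x * mat_adjoint U"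
    and tn: "trace_norm X = (\<Sum>i<d. sqrt (x i))"
    by (rule trace_norm_obtain[OF assms(1)])
  obtain V y where V: "unitary_mat d V" "S = V * real_diag d y * mat_adjoint V"
    using hermitian_diagonalization[OF S psd_hermitian[OF assms(2)]] by blast
  have y: "0 \<le> y i" if "i < d" for i
    using psd_eigenvalue_ge0[of d V y i] assms V that by simp
  have "U * real_diag d x * mat_adjoint U = V * real_diag d (\<lambda>i. y i * y i) * mat_adjoint V"
    using assms(3) U(2) V(2) mult_conj_diag[OF V(1)] by simp
  then have "trace_norm X = (\<Sum>i<d. sqrt (y i * y i))"
    unfolding tn by (rule sum_eigenvalues_unique[OF U(1) V(1)])
  also have "\<dots> = (\<Sum>i<d. y i)" using y by (intro sum.cong) auto
  also have "\<dots> = Re (mat_trace S)"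
    unfolding V(2) trace_unitary_conj[OF V(1) real_diag_carrier] trace_real_diag by simp
  finally show ?thesis .
qed

section \<open>Hoelder's inequality for the trace norm\<close>

lemma cauchy_schwarz_sum:
  fixes a b :: "'a \<Rightarrow> complex"
  assumes "finite I"
  shows "cmod (\<Sum>i\<in>I. a i * b i) \<le> sqrt (\<Sum>i\<in>I. (cmod (a i))\<^sup>2) * sqrt (\<Sum>i\<in>I. (cmod (b i))\<^sup>2)"
proof -
  have "cmod (\<Sum>i\<in>I. a i * b i) \<le> (\<Sum>i\<in>I. \<bar>cmod (a i)\<bar> * \<bar>cmod (b i)\<bar>)"
    using norm_sum[of "\<lambda>i. a i * b i" I] by (simp add: norm_mult)
  also have "\<dots> \<le> L2_set (\<lambda>i. cmod (a i)) I * L2_set (\<lambda>i. cmod (b i)) I"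
    by (rule L2_set_mult_ineq)
  finally show ?thesis by (simp add: L2_set_def)
qed

text \<open>Duality of trace norm and operator norm, with the bound \<open>c\<close> on the operator
  norm of \<open>M\<close> expressed by \<open>M M* \<le> c^2\<close>. No polar decomposition is
  required: in an eigenbasis \<open>U\<close> of \<open>Y* Y\<close>, the rows of
  \<open>U* M\<close> have length at most \<open>c\<close>, the columns of \<open>Y U\<close> have
  length \<open>sqrt (x i)\<close>, and Cauchy-Schwarz is applied to each pair.\<close>

lemma trace_mult_le_trace_norm:
  assumes Y: "Y \<in> carrier_mat d d" and M: "M \<in> carrier_mat d d"
    and bound: "positive_semidefinite d (complex_of_real (c\<^sup>2) \<cdot>\<^sub>m 1\<^sub>m d - M * mat_adjoint M)"
    and c: "0 \<le> c"
  shows "cmod (mat_trace (M * Y)) \<le> c * trace_norm Y"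
proof -
  obtain U x where U: "unitary_mat d U" and Yx: "mat_adjoint Y * Y = U * real_diag d x * mat_adjoint U"
    and tn: "trace_norm Y = (\<Sum>i<d. sqrt (x i))"
    by (rule trace_norm_obtain[OF Y])
  note U' = unitary_matD[OF U]
  define P where "P = mat_adjoint U * M"
  define Q where "Q = Y * U"
  have P: "P \<in> carrier_mat d d" and Q: "Q \<in> carrier_mat d d"
    using U' M Y by (simp_all add: P_def Q_def)
  have "mat_trace (P * Q) = mat_trace (mat_adjoint U * (M * Y) * mat_adjoint (mat_adjoint U))"
    using U'(1) M Y by (simp add: P_def Q_def assoc_mult_mat[of _ d d _ d _ d])
  also have "\<dots> = mat_trace (M * Y)"
    by (rule trace_unitary_conj) (use U' M Y in \<open>auto simp: unitary_mat_def\<close>)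
  finally have tr: "mat_trace (M * Y) = (\<Sum>i<d. \<Sum>l<d. P $$ (i, l) * Q $$ (l, i))"
    using mat_trace_mult[OF P Q] by simp
  have Prow: "sqrt (\<Sum>l<d. (cmod (P $$ (i, l)))\<^sup>2) \<le> c" if i: "i < d" for i
  proof -
    have "complex_of_real (\<Sum>l<d. (cmod (P $$ (i, l)))\<^sup>2) = (P * mat_adjoint P) $$ (i, i)"
      unfolding mult_index_sum[OF P adjoint_carrier[OF P] i i] of_real_sum complex_norm_square
      using P i by (intro sum.cong) auto
    moreover have "P * mat_adjoint P = mat_adjoint U * (M * mat_adjoint M) * U"
      using U'(1) M by (simp add: P_def adjoint_mult[of _ d d _ d] assoc_mult_mat[of _ d d _ d _ d])
    moreover have "mat_adjoint U * (complex_of_real (c\<^sup>2) \<cdot>\<^sub>m 1\<^sub>m d - M * mat_adjoint M) * U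
        = complex_of_real (c\<^sup>2) \<cdot>\<^sub>m 1\<^sub>m d - mat_adjoint U * (M * mat_adjoint M) * U"
    proof -
      have "mat_adjoint U * (complex_of_real (c\<^sup>2) \<cdot>\<^sub>m 1\<^sub>m d - M * mat_adjoint M) * U
        = mat_adjoint U * (complex_of_real (c\<^sup>2) \<cdot>\<^sub>m 1\<^sub>m d) * U - mat_adjoint U * (M * mat_adjoint M) * U"
        using U'(1) M by (simp add: mult_minus_distrib_mat[of _ d d _ d] minus_mult_distrib_mat[of _ d d _ _ d])
      also have "mat_adjoint U * (complex_of_real (c\<^sup>2) \<cdot>\<^sub>m 1\<^sub>m d) * U = complex_of_real (c\<^sup>2) \<cdot>\<^sub>m (mat_adjoint U * U)"
        using U'(1) by (simp add: mult_smult_distrib[of _ d d _ d] mult_smult_assoc_mat[of _ d d _ d])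
      finally show ?thesis using U' by simp
    qed
    ultimately have "complex_of_real (\<Sum>l<d. (cmod (P $$ (i, l)))\<^sup>2) \<le> complex_of_real (c\<^sup>2)"
      using psd_diag_ge0[OF psd_congruence[OF bound U'(1)] i] i U'(1) M by simp
    then have "(\<Sum>l<d. (cmod (P $$ (i, l)))\<^sup>2) \<le> c\<^sup>2"
      by (simp add: less_eq_complex_def)
    then show ?thesis using c by (simp add: real_sqrt_le_iff real_le_lsqrt sum_nonneg)
  qed
  have Qcol: "(\<Sum>l<d. (cmod (Q $$ (l, i)))\<^sup>2) = x i" if i: "i < d" for i
  proof -
    have "complex_of_real (\<Sum>l<d. (cmod (Q $$ (l, i)))\<^sup>2) = (mat_adjoint Q * Q) $$ (i, i)"
      unfolding mult_index_sum[OF adjoint_carrier[OF Q] Q i i] of_real_sum complex_norm_square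
      using Q i by (intro sum.cong) auto
    also have "mat_adjoint Q * Q = mat_adjoint U * (mat_adjoint Y * Y) * U"
      using U'(1) Y by (simp add: Q_def adjoint_mult[of _ d d _ d] assoc_mult_mat[of _ d d _ d _ d])
    also have "\<dots> = real_diag d x"
      unfolding Yx by (rule unitary_conj_diag[OF U])
    finally have "complex_of_real (\<Sum>l<d. (cmod (Q $$ (l, i)))\<^sup>2) = complex_of_real (x i)"
      using i by (simp only: real_diag_index if_True refl)
    then show ?thesis by (simp only: of_real_eq_iff)
  qed
  have "cmod (mat_trace (M * Y)) \<le> (\<Sum>i<d. cmod (\<Sum>l<d. P $$ (i, l) * Q $$ (l, i)))"
    unfolding tr by (rule norm_sum)
  also have "\<dots> \<le> (\<Sum>i<d. c * sqrt (x i))"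
  proof (intro sum_mono)
    fix i assume "i \<in> {..<d}"
    then have i: "i < d" by simp
    have "cmod (\<Sum>l<d. P $$ (i, l) * Q $$ (l, i))
        \<le> sqrt (\<Sum>l<d. (cmod (P $$ (i, l)))\<^sup>2) * sqrt (\<Sum>l<d. (cmod (Q $$ (l, i)))\<^sup>2)"
      by (rule cauchy_schwarz_sum) simp
    also have "\<dots> \<le> c * sqrt (x i)"
      unfolding Qcol[OF i, symmetric] by (intro mult_right_mono Prow i) (simp add: sum_nonneg)
    finally show "cmod (\<Sum>l<d. P $$ (i, l) * Q $$ (l, i)) \<le> c * sqrt (x i)" .
  qed
  finally show ?thesis by (simp add: tn sum_distrib_left)
qed

section \<open>Tensor products and partial transposition\<close>

text \<open>The index maps hidden in the \<open>let\<close> of \<open>bipartite_tensor\<close>: a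
  basis index of A1A2 B1B2 is sent to its A1B1 component here, and to its A2B2 component by
  \<open>tensor_snd\<close>.\<close>

definition tensor_fst :: "nat \<Rightarrow> nat \<Rightarrow> nat \<Rightarrow> nat \<Rightarrow> nat" where
  "tensor_fst dB1 dA2 dB2 r = (r div (dB1 * dB2) div dA2) * dB1 + r mod (dB1 * dB2) div dB2"

definition tensor_snd :: "nat \<Rightarrow> nat \<Rightarrow> nat \<Rightarrow> nat \<Rightarrow> nat" where
  "tensor_snd dB1 dA2 dB2 r = (r div (dB1 * dB2) mod dA2) * dB2 + r mod (dB1 * dB2) mod dB2"

lemma bipartite_tensor_dim [simp]:
  "dim_row (bipartite_tensor dA1 dB1 dA2 dB2 X Y) = dA1 * dA2 * (dB1 * dB2)"
  "dim_col (bipartite_tensor dA1 dB1 dA2 dB2 X Y) = dA1 * dA2 * (dB1 * dB2)"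
  by (simp_all add: bipartite_tensor_def Let_def)

lemma bipartite_tensor_carrier [simp]:
  "bipartite_tensor dA1 dB1 dA2 dB2 X Y \<in> carrier_mat (dA1 * dA2 * (dB1 * dB2)) (dA1 * dA2 * (dB1 * dB2))"
  by (intro carrier_matI) simp_all

lemma bipartite_tensor_entry:
  assumes "r < dA1 * dA2 * (dB1 * dB2)" "c < dA1 * dA2 * (dB1 * dB2)"
  shows "bipartite_tensor dA1 dB1 dA2 dB2 X Y $$ (r, c)
    = X $$ (tensor_fst dB1 dA2 dB2 r, tensor_fst dB1 dA2 dB2 c)
    * Y $$ (tensor_snd dB1 dA2 dB2 r, tensor_snd dB1 dA2 dB2 c)"
  using assms by (simp add: bipartite_tensor_def Let_def tensor_fst_def tensor_snd_def)

lemma div_mod_decode: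
  fixes a b D :: nat
  assumes "b < D"
  shows "(a * D + b) div D = a" "(a * D + b) mod D = b"
  using assms by simp_all

lemma tensor_index_decode:
  fixes r dA1 dA2 dB1 dB2 :: nat
  assumes "r < dA1 * dA2 * (dB1 * dB2)"
  obtains a1 a2 b1 b2 where "a1 < dA1" "a2 < dA2" "b1 < dB1" "b2 < dB2"
    "r = (a1 * dA2 + a2) * (dB1 * dB2) + (b1 * dB2 + b2)"
proof
  let ?B = "dB1 * dB2"
  have pos: "0 < dA2" "0 < dB1" "0 < dB2" using assms by (auto intro: Nat.gr0I)
  have q: "r div ?B < dA1 * dA2" using assms by (simp add: less_mult_imp_div_less)
  show "r div ?B div dA2 < dA1" using q by (simp add: less_mult_imp_div_less)
  show "r div ?B mod dA2 < dA2" "r mod ?B mod dB2 < dB2" using pos by simp_all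
  have "r mod ?B < ?B" using pos by simp
  then show "r mod ?B div dB2 < dB1" by (simp add: less_mult_imp_div_less)
  show "r = (r div ?B div dA2 * dA2 + r div ?B mod dA2) * ?B + (r mod ?B div dB2 * dB2 + r mod ?B mod dB2)"
    by (metis div_mult_mod_eq)
qed

lemma tensor_fst_encode [simp]:
  assumes "a2 < dA2" "b1 < dB1" "b2 < dB2"
  shows "tensor_fst dB1 dA2 dB2 ((a1 * dA2 + a2) * (dB1 * dB2) + (b1 * dB2 + b2)) = a1 * dB1 + b1"
  unfolding tensor_fst_def using assms div_mod_decode[OF index_bound[OF assms(2,3)]]
  by (simp add: div_mod_decode)

lemma tensor_snd_encode [simp]:
  assumes "a2 < dA2" "b1 < dB1" "b2 < dB2"
  shows "tensor_snd dB1 dA2 dB2 ((a1 * dA2 + a2) * (dB1 * dB2) + (b1 * dB2 + b2)) = a2 * dB2 + b2"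
  unfolding tensor_snd_def using assms div_mod_decode[OF index_bound[OF assms(2,3)]]
  by (simp add: div_mod_decode)

lemma tensor_index_bound:
  assumes "r < dA1 * dA2 * (dB1 * dB2)"
  shows "tensor_fst dB1 dA2 dB2 r < dA1 * dB1" "tensor_snd dB1 dA2 dB2 r < dA2 * dB2"
  using assms by (auto elim!: tensor_index_decode intro!: index_bound)

text \<open>Regrouping A1A2 : B1B2 as A1B1 : A2B2 permutes the basis. Hence sums over the composite
  index split into double sums, from which products and traces of tensors follow.\<close>

lemma tensor_index_bij:
  "bij_betw (\<lambda>r. (tensor_fst dB1 dA2 dB2 r, tensor_snd dB1 dA2 dB2 r))
     {..<dA1 * dA2 * (dB1 * dB2)} ({..<dA1 * dB1} \<times> {..<dA2 * dB2})"
proof (rule bij_betwI')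
  fix r s
  assume "r \<in> {..<dA1 * dA2 * (dB1 * dB2)}" "s \<in> {..<dA1 * dA2 * (dB1 * dB2)}"
  then obtain a1 a2 b1 b2 a1' a2' b1' b2'
    where r: "a1 < dA1" "a2 < dA2" "b1 < dB1" "b2 < dB2"
        "r = (a1 * dA2 + a2) * (dB1 * dB2) + (b1 * dB2 + b2)"
      and s: "a1' < dA1" "a2' < dA2" "b1' < dB1" "b2' < dB2"
        "s = (a1' * dA2 + a2') * (dB1 * dB2) + (b1' * dB2 + b2')"
    by (auto elim!: tensor_index_decode)
  have inj: "a = a' \<and> b = b'" if "a * D + b = a' * D + b'" "b < D" "b' < D" for a b a' b' D :: nat
    using that by (metis div_mod_decode)
  have "a1 * dB1 + b1 = a1' * dB1 + b1' \<Longrightarrow> a2 * dB2 + b2 = a2' * dB2 + b2' \<Longrightarrow> r = s"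
    using inj[of a1 dB1 b1 a1' b1'] inj[of a2 dB2 b2 a2' b2'] r s by auto
  moreover have "tensor_fst dB1 dA2 dB2 r = a1 * dB1 + b1" "tensor_snd dB1 dA2 dB2 r = a2 * dB2 + b2"
    unfolding r(5) by (simp_all add: r)
  moreover have "tensor_fst dB1 dA2 dB2 s = a1' * dB1 + b1'" "tensor_snd dB1 dA2 dB2 s = a2' * dB2 + b2'"
    unfolding s(5) by (simp_all add: s)
  ultimately show "((tensor_fst dB1 dA2 dB2 r, tensor_snd dB1 dA2 dB2 r)
      = (tensor_fst dB1 dA2 dB2 s, tensor_snd dB1 dA2 dB2 s)) \<longleftrightarrow> r = s"
    unfolding prod.inject by metis
next
  fix r assume "r \<in> {..<dA1 * dA2 * (dB1 * dB2)}"
  then show "(tensor_fst dB1 dA2 dB2 r, tensor_snd dB1 dA2 dB2 r) \<in> {..<dA1 * dB1} \<times> {..<dA2 * dB2}"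
    using tensor_index_bound by auto
next
  fix y assume "y \<in> {..<dA1 * dB1} \<times> {..<dA2 * dB2}"
  then obtain p q where y: "y = (p, q)" "p < dA1 * dB1" "q < dA2 * dB2" by auto
  have pos: "0 < dB1" "0 < dB2" using y by (auto intro: Nat.gr0I)
  have b: "p div dB1 < dA1" "q div dB2 < dA2" "p mod dB1 < dB1" "q mod dB2 < dB2"
    using y pos by (simp_all add: less_mult_imp_div_less)
  let ?r = "(p div dB1 * dA2 + q div dB2) * (dB1 * dB2) + (p mod dB1 * dB2 + q mod dB2)"
  have "?r < dA1 * dA2 * (dB1 * dB2)" using b by (intro index_bound)
  moreover have "y = (tensor_fst dB1 dA2 dB2 ?r, tensor_snd dB1 dA2 dB2 ?r)"
    using b y(1) by simp
  ultimately show "\<exists>r\<in>{..<dA1 * dA2 * (dB1 * dB2)}. y = (tensor_fst dB1 dA2 dB2 r, tensor_snd dB1 dA2 dB2 r)"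
    by blast
qed

lemma sum_tensor_index:
  "(\<Sum>r<dA1 * dA2 * (dB1 * dB2). f (tensor_fst dB1 dA2 dB2 r) (tensor_snd dB1 dA2 dB2 r))
    = (\<Sum>p<dA1 * dB1. \<Sum>q<dA2 * dB2. f p q)"
  using sum.reindex_bij_betw[OF tensor_index_bij, of "\<lambda>(p, q). f p q"]
  by (simp add: sum.cartesian_product)

section \<open>Algebra and order of tensor products\<close>

lemma bipartite_tensor_mult:
  assumes "X \<in> carrier_mat (dA1 * dB1) (dA1 * dB1)" "X' \<in> carrier_mat (dA1 * dB1) (dA1 * dB1)"
    and "Y \<in> carrier_mat (dA2 * dB2) (dA2 * dB2)" "Y' \<in> carrier_mat (dA2 * dB2) (dA2 * dB2)"
  shows "bipartite_tensor dA1 dB1 dA2 dB2 X Y * bipartite_tensor dA1 dB1 dA2 dB2 X' Y'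
    = bipartite_tensor dA1 dB1 dA2 dB2 (X * X') (Y * Y')" (is "?P * ?Q = ?R")
proof (rule eq_matI)
  let ?N = "dA1 * dA2 * (dB1 * dB2)"
  let ?f = "tensor_fst dB1 dA2 dB2" and ?s = "tensor_snd dB1 dA2 dB2"
  fix r c assume "r < dim_row ?R" "c < dim_col ?R"
  then have rc: "r < ?N" "c < ?N" by simp_all
  have "(?P * ?Q) $$ (r, c) = (\<Sum>k<?N. X $$ (?f r, ?f k) * Y $$ (?s r, ?s k) * (X' $$ (?f k, ?f c) * Y' $$ (?s k, ?s c)))"
    unfolding mult_index_sum[OF bipartite_tensor_carrier bipartite_tensor_carrier rc]
    by (intro sum.cong refl) (simp only: bipartite_tensor_entry rc lessThan_iff)
  also have "\<dots> = (\<Sum>p<dA1 * dB1. \<Sum>q<dA2 * dB2. X $$ (?f r, p) * Y $$ (?s r, q) * (X' $$ (p, ?f c) * Y' $$ (q, ?s c)))"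
    by (rule sum_tensor_index)
  also have "\<dots> = (X * X') $$ (?f r, ?f c) * (Y * Y') $$ (?s r, ?s c)"
    unfolding mult_index_sum[OF assms(1,2) tensor_index_bound(1)[OF rc(1)] tensor_index_bound(1)[OF rc(2)]]
      mult_index_sum[OF assms(3,4) tensor_index_bound(2)[OF rc(1)] tensor_index_bound(2)[OF rc(2)]]
    by (simp add: sum_product ac_simps)
  finally show "(?P * ?Q) $$ (r, c) = ?R $$ (r, c)" by (simp only: bipartite_tensor_entry rc)
qed simp_all

lemma bipartite_tensor_adjoint:
  assumes "X \<in> carrier_mat (dA1 * dB1) (dA1 * dB1)" "Y \<in> carrier_mat (dA2 * dB2) (dA2 * dB2)"
  shows "mat_adjoint (bipartite_tensor dA1 dB1 dA2 dB2 X Y)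
    = bipartite_tensor dA1 dB1 dA2 dB2 (mat_adjoint X) (mat_adjoint Y)"
  by (rule eq_matI) (use assms in \<open>auto simp: bipartite_tensor_entry tensor_index_bound\<close>)

lemma bipartite_tensor_trace:
  assumes "X \<in> carrier_mat (dA1 * dB1) (dA1 * dB1)" "Y \<in> carrier_mat (dA2 * dB2) (dA2 * dB2)"
  shows "mat_trace (bipartite_tensor dA1 dB1 dA2 dB2 X Y) = mat_trace X * mat_trace Y"
proof -
  have "mat_trace (bipartite_tensor dA1 dB1 dA2 dB2 X Y)
    = (\<Sum>r<dA1 * dA2 * (dB1 * dB2). X $$ (tensor_fst dB1 dA2 dB2 r, tensor_fst dB1 dA2 dB2 r)
        * Y $$ (tensor_snd dB1 dA2 dB2 r, tensor_snd dB1 dA2 dB2 r))"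
    unfolding mat_trace_def by (intro sum.cong) (simp_all add: bipartite_tensor_entry)
  also have "\<dots> = (\<Sum>p<dA1 * dB1. \<Sum>q<dA2 * dB2. X $$ (p, p) * Y $$ (q, q))"
    by (rule sum_tensor_index)
  finally show ?thesis using assms by (simp add: mat_trace_def sum_product)
qed

lemma bipartite_tensor_one:
  "bipartite_tensor dA1 dB1 dA2 dB2 (1\<^sub>m (dA1 * dB1)) (1\<^sub>m (dA2 * dB2)) = 1\<^sub>m (dA1 * dA2 * (dB1 * dB2))"
proof (rule eq_matI)
  let ?N = "dA1 * dA2 * (dB1 * dB2)"
  fix r c assume "r < dim_row (1\<^sub>m ?N :: complex mat)" "c < dim_col (1\<^sub>m ?N :: complex mat)"
  then have rc: "r < ?N" "c < ?N" by simp_all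
  have "tensor_fst dB1 dA2 dB2 r = tensor_fst dB1 dA2 dB2 c \<and> tensor_snd dB1 dA2 dB2 r = tensor_snd dB1 dA2 dB2 c
    \<longleftrightarrow> r = c"
    using inj_onD[OF bij_betw_imp_inj_on[OF tensor_index_bij], of dB1 dA2 dB2 r c dA1] rc by auto
  then show "bipartite_tensor dA1 dB1 dA2 dB2 (1\<^sub>m (dA1 * dB1)) (1\<^sub>m (dA2 * dB2)) $$ (r, c) = 1\<^sub>m ?N $$ (r, c)"
    using rc tensor_index_bound[OF rc(1)] tensor_index_bound[OF rc(2)] by (auto simp: bipartite_tensor_entry)
qed simp_all

lemma bipartite_tensor_smult:
  assumes "X \<in> carrier_mat (dA1 * dB1) (dA1 * dB1)" "Y \<in> carrier_mat (dA2 * dB2) (dA2 * dB2)"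
  shows "bipartite_tensor dA1 dB1 dA2 dB2 (a \<cdot>\<^sub>m X) (b \<cdot>\<^sub>m Y) = (a * b) \<cdot>\<^sub>m bipartite_tensor dA1 dB1 dA2 dB2 X Y"
  by (rule eq_matI) (use assms in \<open>auto simp: bipartite_tensor_entry tensor_index_bound\<close>)

lemma psd_bipartite_tensor:
  assumes "positive_semidefinite (dA1 * dB1) X" "positive_semidefinite (dA2 * dB2) Y"
  shows "positive_semidefinite (dA1 * dA2 * (dB1 * dB2)) (bipartite_tensor dA1 dB1 dA2 dB2 X Y)"
proof -
  obtain C where C: "C \<in> carrier_mat (dA1 * dB1) (dA1 * dB1)" "X = mat_adjoint C * C"
    by (rule psd_obtain_gram[OF assms(1)])
  obtain D where D: "D \<in> carrier_mat (dA2 * dB2) (dA2 * dB2)" "Y = mat_adjoint D * D"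
    by (rule psd_obtain_gram[OF assms(2)])
  have "bipartite_tensor dA1 dB1 dA2 dB2 X Y
    = mat_adjoint (bipartite_tensor dA1 dB1 dA2 dB2 C D) * bipartite_tensor dA1 dB1 dA2 dB2 C D"
    using C D by (simp add: bipartite_tensor_adjoint bipartite_tensor_mult)
  then show ?thesis using psd_gram[OF bipartite_tensor_carrier] by metis
qed

text \<open>Telescoping: X' (x) Y' - X (x) Y = (X' - X) (x) Y' + X (x) (Y' - Y), where (x) is the
  tensor product. Both summands are tensor products of positive operators.\<close>

lemma psd_tensor_mono:
  assumes X: "positive_semidefinite (dA1 * dB1) X" "positive_semidefinite (dA1 * dB1) (X' - X)"
    and Y: "positive_semidefinite (dA2 * dB2) (Y' - Y)" "positive_semidefinite (dA2 * dB2) Y'"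
    and c: "X' \<in> carrier_mat (dA1 * dB1) (dA1 * dB1)" "Y \<in> carrier_mat (dA2 * dB2) (dA2 * dB2)"
  shows "positive_semidefinite (dA1 * dA2 * (dB1 * dB2))
    (bipartite_tensor dA1 dB1 dA2 dB2 X' Y' - bipartite_tensor dA1 dB1 dA2 dB2 X Y)"
proof -
  have "bipartite_tensor dA1 dB1 dA2 dB2 X' Y' - bipartite_tensor dA1 dB1 dA2 dB2 X Y
    = bipartite_tensor dA1 dB1 dA2 dB2 (X' - X) Y' + bipartite_tensor dA1 dB1 dA2 dB2 X (Y' - Y)"
    by (rule eq_matI) (use c psd_carrier[OF X(1)] psd_carrier[OF Y(2)]
        in \<open>auto simp: bipartite_tensor_entry tensor_index_bound left_diff_distrib right_diff_distrib\<close>)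
  then show ?thesis
    using psd_add[OF psd_bipartite_tensor[OF X(2) Y(2)] psd_bipartite_tensor[OF X(1) Y(1)]] by simp
qed

text \<open>The two-sided operator bound \<open>-G \<le> X \<le> G\<close>. For \<open>G\<close> a
  multiple of the identity it bounds the operator norm, and for general \<open>G\<close> it serves
  in place of the modulus of \<open>X\<close>; unlike a one-sided bound it is stable under tensor
  products.\<close>

definition dominates :: "nat \<Rightarrow> complex mat \<Rightarrow> complex mat \<Rightarrow> bool" where
  "dominates d G X \<longleftrightarrow> G \<in> carrier_mat d d \<and> X \<in> carrier_mat d d \<and>
     positive_semidefinite d (G + X) \<and> positive_semidefinite d (G - X)"

text \<open>G (x) H + X (x) Y is the mean of (G + X) (x) (H + Y) and (G - X) (x) (H - Y); exchanging
  the signs in the second factors gives G (x) H - X (x) Y.\<close>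

lemma dominates_tensor:
  assumes "dominates (dA1 * dB1) G X" "dominates (dA2 * dB2) H Y"
  shows "dominates (dA1 * dA2 * (dB1 * dB2)) (bipartite_tensor dA1 dB1 dA2 dB2 G H) (bipartite_tensor dA1 dB1 dA2 dB2 X Y)"
proof -
  let ?t = "bipartite_tensor dA1 dB1 dA2 dB2" and ?N = "dA1 * dA2 * (dB1 * dB2)"
  note c = assms[unfolded dominates_def]
  have half: "0 \<le> (1/2 :: real)" by simp
  have mix: "(g + x) * (h + y) + (g - x) * (h - y) = g * h * 2 + x * y * 2"
    "(g + x) * (h - y) + (g - x) * (h + y) = g * h * 2 - x * y * 2" for g x h y :: complex
    by (simp_all add: field_simps)
  have "?t G H + ?t X Y = complex_of_real (1/2) \<cdot>\<^sub>m (?t (G + X) (H + Y) + ?t (G - X) (H - Y))"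
    by (rule eq_matI) (use c in \<open>auto simp: bipartite_tensor_entry tensor_index_bound mix\<close>)
  moreover have "?t G H - ?t X Y = complex_of_real (1/2) \<cdot>\<^sub>m (?t (G + X) (H - Y) + ?t (G - X) (H + Y))"
    by (rule eq_matI) (use c in \<open>auto simp: bipartite_tensor_entry tensor_index_bound mix\<close>)
  moreover have "positive_semidefinite ?N (complex_of_real (1/2) \<cdot>\<^sub>m (?t (G + X) (H + Y) + ?t (G - X) (H - Y)))"
    "positive_semidefinite ?N (complex_of_real (1/2) \<cdot>\<^sub>m (?t (G + X) (H - Y) + ?t (G - X) (H + Y)))"
    using c by (blast intro: psd_smult[of _ _ "1/2", OF _ half] psd_add psd_bipartite_tensor)+
  ultimately show ?thesis by (simp only: dominates_def bipartite_tensor_carrier simp_thms)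
qed

section \<open>Partial transposition\<close>

lemma partial_transpose_dim [simp]:
  "dim_row (partial_transpose dA dB X) = dA * dB" "dim_col (partial_transpose dA dB X) = dA * dB"
  by (simp_all add: partial_transpose_def)

lemma partial_transpose_carrier [simp]:
  "partial_transpose dA dB X \<in> carrier_mat (dA * dB) (dA * dB)"
  by (simp add: partial_transpose_def)

lemma partial_transpose_entry:
  "r < dA * dB \<Longrightarrow> c < dA * dB \<Longrightarrow> partial_transpose dA dB X $$ (r, c)
    = X $$ ((r div dB) * dB + c mod dB, (c div dB) * dB + r mod dB)"
  by (simp add: partial_transpose_def)

lemma swap_index_bound:
  fixes r c dA dB :: nat
  assumes "r < dA * dB" "c < dA * dB"
  shows "(r div dB) * dB + c mod dB < dA * dB"
proof -
  have "0 < dB" using assms by (auto intro: Nat.gr0I)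
  then show ?thesis using assms by (intro index_bound) (simp_all add: less_mult_imp_div_less)
qed

lemma swap_index_decode:
  fixes r c dA dB :: nat
  assumes "r < dA * dB"
  shows "((r div dB) * dB + c mod dB) div dB = r div dB" "((r div dB) * dB + c mod dB) mod dB = c mod dB"
proof -
  have "0 < dB" using assms by (auto intro: Nat.gr0I)
  then show "((r div dB) * dB + c mod dB) div dB = r div dB" "((r div dB) * dB + c mod dB) mod dB = c mod dB"
    by (simp_all add: div_mod_decode)
qed

lemma partial_transpose_involutive:
  assumes "X \<in> carrier_mat (dA * dB) (dA * dB)"
  shows "partial_transpose dA dB (partial_transpose dA dB X) = X"
  by (rule eq_matI) (use assms in \<open>auto simp: partial_transpose_entry swap_index_bound swap_index_decode\<close>)

lemma partial_transpose_add:
  assumes "X \<in> carrier_mat (dA * dB) (dA * dB)" "Y \<in> carrier_mat (dA * dB) (dA * dB)"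
  shows "partial_transpose dA dB (X + Y) = partial_transpose dA dB X + partial_transpose dA dB Y"
  by (rule eq_matI) (use assms in \<open>auto simp: partial_transpose_entry swap_index_bound\<close>)

lemma partial_transpose_minus:
  assumes "X \<in> carrier_mat (dA * dB) (dA * dB)" "Y \<in> carrier_mat (dA * dB) (dA * dB)"
  shows "partial_transpose dA dB (X - Y) = partial_transpose dA dB X - partial_transpose dA dB Y"
  by (rule eq_matI) (use assms in \<open>auto simp: partial_transpose_entry swap_index_bound\<close>)

lemma partial_transpose_smult:
  assumes "X \<in> carrier_mat (dA * dB) (dA * dB)"
  shows "partial_transpose dA dB (a \<cdot>\<^sub>m X) = a \<cdot>\<^sub>m partial_transpose dA dB X"
  by (rule eq_matI) (use assms in \<open>auto simp: partial_transpose_entry swap_index_bound\<close>)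

lemma partial_transpose_one [simp]: "partial_transpose dA dB (1\<^sub>m (dA * dB)) = 1\<^sub>m (dA * dB)"
proof (rule eq_matI)
  fix r c assume "r < dim_row (1\<^sub>m (dA * dB) :: complex mat)" "c < dim_col (1\<^sub>m (dA * dB) :: complex mat)"
  then have rc: "r < dA * dB" "c < dA * dB" by simp_all
  have "r div dB * dB + c mod dB = c div dB * dB + r mod dB \<longleftrightarrow> r = c"
    using swap_index_decode[OF rc(1), of c] swap_index_decode[OF rc(2), of r] by (metis div_mult_mod_eq)
  then show "partial_transpose dA dB (1\<^sub>m (dA * dB)) $$ (r, c) = 1\<^sub>m (dA * dB) $$ (r, c)"
    using rc by (simp add: partial_transpose_entry swap_index_bound)
qed simp_all

lemma partial_transpose_trace [simp]:
  assumes "X \<in> carrier_mat (dA * dB) (dA * dB)"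
  shows "mat_trace (partial_transpose dA dB X) = mat_trace X"
  using assms by (simp add: mat_trace_def partial_transpose_entry)

text \<open>Partial transposition permutes the positions (row, column) by an involution that
  commutes with exchanging row and column, so it only reorders the terms of the double sum for the
  trace.\<close>

lemma trace_partial_transpose_mult:
  assumes "X \<in> carrier_mat (dA * dB) (dA * dB)" "Y \<in> carrier_mat (dA * dB) (dA * dB)"
  shows "mat_trace (partial_transpose dA dB X * partial_transpose dA dB Y) = mat_trace (X * Y)"
proof -
  let ?N = "dA * dB"
  let ?t = "\<lambda>(r, c). ((r div dB) * dB + c mod dB, (c div dB) * dB + r mod dB)"
  have bij: "bij_betw ?t ({..<?N} \<times> {..<?N}) ({..<?N} \<times> {..<?N})"
    by (rule bij_betw_byWitness[of _ ?t]) (auto simp: swap_index_bound swap_index_decode)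
  have "mat_trace (partial_transpose dA dB X * partial_transpose dA dB Y)
    = (\<Sum>(r, c)\<in>{..<?N} \<times> {..<?N}. (\<lambda>(r, c). X $$ (r, c) * Y $$ (c, r)) (?t (r, c)))"
    unfolding mat_trace_mult[OF partial_transpose_carrier partial_transpose_carrier] sum.cartesian_product
    by (intro sum.cong) (auto simp: partial_transpose_entry)
  also have "\<dots> = (\<Sum>(r, c)\<in>{..<?N} \<times> {..<?N}. X $$ (r, c) * Y $$ (c, r))"
    using sum.reindex_bij_betw[OF bij, of "\<lambda>(r, c). X $$ (r, c) * Y $$ (c, r)"]
    by (simp add: case_prod_unfold)
  also have "\<dots> = mat_trace (X * Y)"
    unfolding mat_trace_mult[OF assms] sum.cartesian_product ..
  finally show ?thesis .
qed

lemma trace_partial_transpose_swap: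
  assumes "X \<in> carrier_mat (dA * dB) (dA * dB)" "Y \<in> carrier_mat (dA * dB) (dA * dB)"
  shows "mat_trace (X * partial_transpose dA dB Y) = mat_trace (partial_transpose dA dB X * Y)"
  using trace_partial_transpose_mult[OF partial_transpose_carrier assms(2), of X]
    partial_transpose_involutive[OF assms(1)] by simp

lemma partial_transpose_tensor:
  assumes "X \<in> carrier_mat (dA1 * dB1) (dA1 * dB1)" "Y \<in> carrier_mat (dA2 * dB2) (dA2 * dB2)"
  shows "partial_transpose (dA1 * dA2) (dB1 * dB2) (bipartite_tensor dA1 dB1 dA2 dB2 X Y)
    = bipartite_tensor dA1 dB1 dA2 dB2 (partial_transpose dA1 dB1 X) (partial_transpose dA2 dB2 Y)"
proof (rule eq_matI)
  let ?N = "dA1 * dA2 * (dB1 * dB2)"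
  let ?L = "partial_transpose (dA1 * dA2) (dB1 * dB2) (bipartite_tensor dA1 dB1 dA2 dB2 X Y)"
  let ?R = "bipartite_tensor dA1 dB1 dA2 dB2 (partial_transpose dA1 dB1 X) (partial_transpose dA2 dB2 Y)"
  fix r c assume "r < dim_row ?R" "c < dim_col ?R"
  then have rc: "r < ?N" "c < ?N" by simp_all
  obtain a1 a2 b1 b2 where r: "a1 < dA1" "a2 < dA2" "b1 < dB1" "b2 < dB2"
      "r = (a1 * dA2 + a2) * (dB1 * dB2) + (b1 * dB2 + b2)" by (rule tensor_index_decode[OF rc(1)])
  obtain c1 c2 d1 d2 where c: "c1 < dA1" "c2 < dA2" "d1 < dB1" "d2 < dB2"
      "c = (c1 * dA2 + c2) * (dB1 * dB2) + (d1 * dB2 + d2)" by (rule tensor_index_decode[OF rc(2)])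
  have bd: "b1 * dB2 + b2 < dB1 * dB2" "d1 * dB2 + d2 < dB1 * dB2"
    using r c by (simp_all add: index_bound)
  have dm: "r div (dB1 * dB2) = a1 * dA2 + a2" "r mod (dB1 * dB2) = b1 * dB2 + b2"
      "c div (dB1 * dB2) = c1 * dA2 + c2" "c mod (dB1 * dB2) = d1 * dB2 + d2"
    unfolding r(5) c(5) using bd by (simp_all only: div_mod_decode)
  have "?L $$ (r, c) = bipartite_tensor dA1 dB1 dA2 dB2 X Y
      $$ ((a1 * dA2 + a2) * (dB1 * dB2) + (d1 * dB2 + d2), (c1 * dA2 + c2) * (dB1 * dB2) + (b1 * dB2 + b2))"
    unfolding partial_transpose_entry[OF rc] dm ..
  also have "\<dots> = X $$ (a1 * dB1 + d1, c1 * dB1 + b1) * Y $$ (a2 * dB2 + d2, c2 * dB2 + b2)"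
    by (rule bipartite_tensor_index) fact+
  also have "\<dots> = ?R $$ (r, c)"
    unfolding r(5) c(5)
    by (subst bipartite_tensor_index)
      (use r c in \<open>simp_all add: partial_transpose_entry index_bound div_mod_decode\<close>)
  finally show "?L $$ (r, c) = ?R $$ (r, c)" .
qed simp_all

lemma psd_zero [simp]: "positive_semidefinite d (0\<^sub>m d d)"
  using psd_gram[of "0\<^sub>m d d" d d] by (simp add: adjoint_carrier[THEN right_mult_zero_mat])

lemma psd_one [simp]: "positive_semidefinite d (1\<^sub>m d)"
  using psd_gram[of "1\<^sub>m d" d d] by simp

lemma psd_one_diff_one [simp]: "positive_semidefinite d (1\<^sub>m d - 1\<^sub>m d)"
  by (subst minus_r_inv_mat[of _ d d]) simp_all

lemma smult_one_mat [simp]: "1 \<cdot>\<^sub>m A = A" for A :: "complex mat"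
  by (rule eq_matI) auto

lemma smult_smult_mat: "a \<cdot>\<^sub>m (b \<cdot>\<^sub>m A) = (a * b) \<cdot>\<^sub>m A" for A :: "complex mat"
  by (rule eq_matI) auto

section \<open>Tensor powers\<close>

lemma bipartite_power_carrier [simp]:
  "bipartite_power dA dB X n \<in> carrier_mat (dA ^ n * dB ^ n) (dA ^ n * dB ^ n)"
  by (cases n) simp_all

lemma bipartite_power_mult:
  assumes "X \<in> carrier_mat (dA * dB) (dA * dB)" "Y \<in> carrier_mat (dA * dB) (dA * dB)"
  shows "bipartite_power dA dB X n * bipartite_power dA dB Y n = bipartite_power dA dB (X * Y) n"
  using assms by (induction n) (simp_all add: bipartite_tensor_mult)

lemma bipartite_power_adjoint:
  assumes "X \<in> carrier_mat (dA * dB) (dA * dB)"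
  shows "mat_adjoint (bipartite_power dA dB X n) = bipartite_power dA dB (mat_adjoint X) n"
  using assms by (induction n) (simp_all add: bipartite_tensor_adjoint)

lemma bipartite_power_trace:
  assumes "X \<in> carrier_mat (dA * dB) (dA * dB)"
  shows "mat_trace (bipartite_power dA dB X n) = mat_trace X ^ n"
  using assms by (induction n) (simp_all add: bipartite_tensor_trace)

lemma bipartite_power_one: "bipartite_power dA dB (1\<^sub>m (dA * dB)) n = 1\<^sub>m (dA ^ n * dB ^ n)"
  by (induction n) (simp_all add: bipartite_tensor_one)

lemma bipartite_power_smult:
  assumes "X \<in> carrier_mat (dA * dB) (dA * dB)"
  shows "bipartite_power dA dB (a \<cdot>\<^sub>m X) n = a ^ n \<cdot>\<^sub>m bipartite_power dA dB X n"
  using assms by (induction n) (simp_all add: bipartite_tensor_smult)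

lemma psd_bipartite_power:
  "positive_semidefinite (dA * dB) X \<Longrightarrow> positive_semidefinite (dA ^ n * dB ^ n) (bipartite_power dA dB X n)"
  by (induction n) (use psd_one[of 1] in \<open>simp_all add: psd_bipartite_tensor\<close>)

lemma partial_transpose_power:
  assumes "X \<in> carrier_mat (dA * dB) (dA * dB)"
  shows "partial_transpose (dA ^ n) (dB ^ n) (bipartite_power dA dB X n) = bipartite_power dA dB (partial_transpose dA dB X) n"
proof (induction n)
  case 0
  then show ?case using partial_transpose_one[of 1 1] by simp
next
  case (Suc n)
  then show ?case using assms by (simp add: partial_transpose_tensor)
qed

lemma psd_power_mono:
  assumes "positive_semidefinite (dA * dB) X" "positive_semidefinite (dA * dB) (Y - X)"
    and "Y \<in> carrier_mat (dA * dB) (dA * dB)"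
  shows "positive_semidefinite (dA ^ n * dB ^ n) (bipartite_power dA dB Y n - bipartite_power dA dB X n)"
proof (induction n)
  case 0
  then show ?case using psd_one_diff_one[of 1] by simp
next
  case (Suc n)
  have "Y = X + (Y - X)" using assms(3) psd_carrier[OF assms(1)] by (intro eq_matI) auto
  then have "positive_semidefinite (dA * dB) Y" using psd_add[OF assms(1,2)] by simp
  then show ?case
    using psd_tensor_mono[OF assms(1,2) Suc psd_bipartite_power assms(3) bipartite_power_carrier] by simp
qed

lemma dominates_power:
  assumes "dominates (dA * dB) G X"
  shows "dominates (dA ^ n * dB ^ n) (bipartite_power dA dB G n) (bipartite_power dA dB X n)"
proof (induction n)
  case 0
  then show ?case using psd_one_diff_one[of 1] psd_add[OF psd_one psd_one, of 1] by (simp add: dominates_def)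
next
  case (Suc n)
  then show ?case using dominates_tensor[OF assms Suc] by simp
qed

lemma bipartite_power_1:
  assumes "X \<in> carrier_mat (dA * dB) (dA * dB)"
  shows "bipartite_power dA dB X 1 = X"
proof -
  have "tensor_fst dB 1 1 r = r" "tensor_snd dB 1 1 r = 0" for r
    by (simp_all add: tensor_fst_def tensor_snd_def)
  then show ?thesis
    using assms by (intro eq_matI) (auto simp: bipartite_tensor_entry)
qed

text \<open>Converts the two-sided bound into the form that \<open>trace_mult_le_trace_norm\<close>
  expects. The commuting positive operators A = c + M and B = c - M have product K = c^2 - M^2, and
  K is positive because B A B + A B A = K (A + B) = 2 c K is a sum of two congruences.\<close>

lemma dominated_square_bound:
  assumes "dominates d (complex_of_real c \<cdot>\<^sub>m 1\<^sub>m d) M" "0 < c"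
  shows "mat_adjoint M = M" "positive_semidefinite d (complex_of_real (c\<^sup>2) \<cdot>\<^sub>m 1\<^sub>m d - M * mat_adjoint M)"
proof -
  let ?I = "complex_of_real c \<cdot>\<^sub>m 1\<^sub>m d"
  define A where "A = ?I + M"
  define B where "B = ?I - M"
  have M: "M \<in> carrier_mat d d" and psd: "positive_semidefinite d A" "positive_semidefinite d B"
    using assms by (simp_all add: dominates_def A_def B_def)
  have c: "A \<in> carrier_mat d d" "B \<in> carrier_mat d d" using M by (simp_all add: A_def B_def minus_carrier_mat)
  have aA: "mat_adjoint A = A" and aB: "mat_adjoint B = B" using psd psd_hermitian by auto
  show aM: "mat_adjoint M = M"
  proof -
    have "M = A - ?I" using M by (intro eq_matI) (auto simp: A_def)
    then have "mat_adjoint M = A - ?I"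
      using c aA by (metis adjoint_minus adjoint_one adjoint_smult complex_cnj_complex_of_real
          one_carrier_mat smult_carrier_mat)
    then show ?thesis using M by (intro eq_matI) (auto simp: A_def)
  qed
  define K where "K = complex_of_real (c\<^sup>2) \<cdot>\<^sub>m 1\<^sub>m d - M * M"
  have K: "K \<in> carrier_mat d d" using M by (simp add: K_def minus_carrier_mat)
  have IM: "?I * M = complex_of_real c \<cdot>\<^sub>m M" "M * ?I = complex_of_real c \<cdot>\<^sub>m M"
    "?I * ?I = complex_of_real (c\<^sup>2) \<cdot>\<^sub>m 1\<^sub>m d"
    using M by (simp_all add: mult_smult_assoc_mat[of _ d d _ d] mult_smult_distrib[of _ d d _ d] power2_eq_square
        smult_smult_mat)
  have AB: "A * B = K"
  proof -
    have "A * B = ?I * ?I + M * ?I - (?I * M + M * M)"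
      using M by (simp add: A_def B_def add_mult_distrib_mat[of _ d d _ _ d] mult_minus_distrib_mat[of _ d d _ d])
    then show ?thesis unfolding IM K_def using M by (intro eq_matI) auto
  qed
  have BA: "B * A = K"
  proof -
    have "B * A = ?I * ?I + ?I * M - (M * ?I + M * M)"
      using M by (simp add: A_def B_def minus_mult_distrib_mat[of _ d d _ _ d] mult_add_distrib_mat[of _ d d _ d])
    then show ?thesis unfolding IM K_def using M by (intro eq_matI) auto
  qed
  have "B * A * B + A * B * A = K * (B + A)"
    unfolding AB BA using c K by (simp add: mult_add_distrib_mat[of _ d d _ d])
  also have "B + A = complex_of_real (2 * c) \<cdot>\<^sub>m 1\<^sub>m d"
    using M by (intro eq_matI) (auto simp: A_def B_def)
  also have "K * (complex_of_real (2 * c) \<cdot>\<^sub>m 1\<^sub>m d) = complex_of_real (2 * c) \<cdot>\<^sub>m K"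
    using K by (simp add: mult_smult_distrib[of _ d d _ d])
  finally have eq: "B * A * B + A * B * A = complex_of_real (2 * c) \<cdot>\<^sub>m K" .
  have "positive_semidefinite d (B * A * B + A * B * A)"
    using psd_add[OF psd_congruence[OF psd(1) c(2)] psd_congruence[OF psd(2) c(1)]] aA aB by simp
  then have "positive_semidefinite d (complex_of_real (1 / (2 * c)) \<cdot>\<^sub>m (complex_of_real (2 * c) \<cdot>\<^sub>m K))"
    unfolding eq by (rule psd_smult) (use assms(2) in simp)
  moreover have "complex_of_real (1 / (2 * c)) \<cdot>\<^sub>m (complex_of_real (2 * c) \<cdot>\<^sub>m K) = K"
    using assms(2) K by (intro eq_matI) auto
  ultimately show "positive_semidefinite d (complex_of_real (c\<^sup>2) \<cdot>\<^sub>m 1\<^sub>m d - M * mat_adjoint M)"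
    unfolding aM K_def by simp
qed

section \<open>Completely positive maps\<close>

lemma sum_lessThan_mult:
  fixes f :: "nat \<Rightarrow> 'a :: comm_monoid_add"
  shows "(\<Sum>r<k * d. f r) = (\<Sum>a<k. \<Sum>p<d. f (a * d + p))"
proof (induction k)
  case (Suc k)
  have "(\<Sum>r<Suc k * d. f r) = (\<Sum>r<k * d. f r) + (\<Sum>r=k * d..<k * d + d. f r)"
    by (simp add: lessThan_atLeast0 sum.atLeastLessThan_concat add.commute)
  also have "(\<Sum>r=k * d..<k * d + d. f r) = (\<Sum>p<d. f (k * d + p))"
    using sum.shift_bounds_nat_ivl[of f 0 "k * d" d] by (simp add: lessThan_atLeast0 add.commute)
  finally show ?case using Suc by simp
qed simp

lemma quadratic_form_sum:
  fixes A :: "complex mat"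
  assumes "A \<in> carrier_mat n n" "v \<in> carrier_vec n"
  shows "(A *\<^sub>v v) \<bullet>c v = (\<Sum>i<n. \<Sum>j<n. A $$ (i, j) * v $ j * cnj (v $ i))"
  unfolding cscalar_sum[OF assms(2)]
  by (intro sum.cong refl) (simp add: mult_vec_index_sum[OF assms] sum_distrib_right del: index_mult_mat_vec)

text \<open>The matrix is the partial trace of (1 (x) E) X over the second factor. With
  \<open>E = C* C\<close>, its quadratic form at \<open>v\<close> is the sum over \<open>m\<close>
  of the quadratic forms of \<open>X\<close> at \<open>w m\<close>, the tensor product of
  \<open>v\<close> with the conjugated row \<open>m\<close> of \<open>C\<close>.\<close>

lemma psd_block_trace:
  assumes X: "positive_semidefinite (k * d) X" and E: "positive_semidefinite d E"
  shows "positive_semidefinite k (mat k k (\<lambda>(a, b).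
    mat_trace (E * mat d d (\<lambda>(p, q). X $$ (a * d + p, b * d + q)))))" (is "positive_semidefinite k ?T")
  unfolding positive_semidefinite_def
proof (intro conjI ballI)
  show "?T \<in> carrier_mat k k" by simp
  fix v :: "complex vec" assume v: "v \<in> carrier_vec k"
  obtain C where C: "C \<in> carrier_mat d d" "E = mat_adjoint C * C" by (rule psd_obtain_gram[OF E])
  have tr: "mat_trace (E * Y) = (\<Sum>m<d. \<Sum>q<d. \<Sum>p<d. C $$ (m, p) * Y $$ (p, q) * cnj (C $$ (m, q)))"
    if Y: "Y \<in> carrier_mat d d" for Y
  proof -
    have "mat_trace (E * Y) = mat_trace (mat_adjoint C * (C * Y))"
      using C Y by (simp add: assoc_mult_mat[of _ d d _ d _ d])
    also have "\<dots> = mat_trace (C * Y * mat_adjoint C)"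
      by (rule mat_trace_comm[of _ d d]) (use C Y in auto)
    also have "\<dots> = (\<Sum>m<d. \<Sum>q<d. (C * Y) $$ (m, q) * mat_adjoint C $$ (q, m))"
      by (rule mat_trace_mult) (use C Y in auto)
    also have "\<dots> = (\<Sum>m<d. \<Sum>q<d. \<Sum>p<d. C $$ (m, p) * Y $$ (p, q) * cnj (C $$ (m, q)))"
      using C(1) by (intro sum.cong refl)
        (simp add: mult_index_sum[OF C(1) Y] sum_distrib_right del: index_mult_mat(1))
    finally show ?thesis .
  qed
  define g where "g m a q b p = C $$ (m, p) * X $$ (a * d + p, b * d + q) * cnj (C $$ (m, q)) * v $ b * cnj (v $ a)"
    for m a q b p
  define w where "w m = vec (k * d) (\<lambda>r. v $ (r div d) * cnj (C $$ (m, r mod d)))" for m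
  have w: "w m \<in> carrier_vec (k * d)" for m by (simp add: w_def)
  have w_entry: "w m $ (a * d + p) = v $ a * cnj (C $$ (m, p))" if "a < k" "p < d" for m a p
    using that index_bound[of a k p d] by (simp add: w_def)
  have "(?T *\<^sub>v v) \<bullet>c v = (\<Sum>a<k. \<Sum>b<k. \<Sum>m<d. \<Sum>q<d. \<Sum>p<d. g m a q b p)"
    unfolding quadratic_form_sum[OF mat_carrier v]
    by (intro sum.cong refl) (simp add: tr sum_distrib_right g_def)
  also have "\<dots> = (\<Sum>m<d. \<Sum>a<k. \<Sum>p<d. \<Sum>b<k. \<Sum>q<d. g m a q b p)"
  proof -
    have "(\<Sum>a<k. \<Sum>b<k. \<Sum>m<d. \<Sum>q<d. \<Sum>p<d. g m a q b p)
      = (\<Sum>a<k. \<Sum>m<d. \<Sum>b<k. \<Sum>q<d. \<Sum>p<d. g m a q b p)"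
      by (rule sum.cong[OF refl], rule sum.swap)
    also have "\<dots> = (\<Sum>m<d. \<Sum>a<k. \<Sum>b<k. \<Sum>q<d. \<Sum>p<d. g m a q b p)"
      by (rule sum.swap)
    also have "\<dots> = (\<Sum>m<d. \<Sum>a<k. \<Sum>b<k. \<Sum>p<d. \<Sum>q<d. g m a q b p)"
      by (rule sum.cong[OF refl], rule sum.cong[OF refl], rule sum.cong[OF refl], rule sum.swap)
    also have "\<dots> = (\<Sum>m<d. \<Sum>a<k. \<Sum>p<d. \<Sum>b<k. \<Sum>q<d. g m a q b p)"
      by (rule sum.cong[OF refl], rule sum.cong[OF refl], rule sum.swap)
    finally show ?thesis .
  qed
  also have "\<dots> = (\<Sum>m<d. (X *\<^sub>v w m) \<bullet>c w m)"
    unfolding quadratic_form_sum[OF psd_carrier[OF X] w] sum_lessThan_mult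
    by (intro sum.cong refl) (simp add: w_entry g_def)
  also have "0 \<le> \<dots>"
    using X w by (intro sum_nonneg) (auto simp: positive_semidefinite_def)
  finally show "0 \<le> (?T *\<^sub>v v) \<bullet>c v" .
qed

text \<open>The only source of complete positivity here: every explicit channel below is a sum of
  such maps, and so is its conjugate under partial transposition.\<close>

lemma completely_positive_measure_prepare:
  assumes "positive_semidefinite d E" "positive_semidefinite d' S"
  shows "completely_positive d d' (\<lambda>X. mat_trace (E * X) \<cdot>\<^sub>m S)"
  unfolding completely_positive_def linear_superoperator_def
proof (intro conjI allI ballI impI)
  have E: "E \<in> carrier_mat d d" and S: "S \<in> carrier_mat d' d'" using assms psd_carrier by auto
  show "mat_trace (E * X) \<cdot>\<^sub>m S \<in> carrier_mat d' d'" for X using S by simp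
  show "mat_trace (E * (X + Y)) \<cdot>\<^sub>m S = mat_trace (E * X) \<cdot>\<^sub>m S + mat_trace (E * Y) \<cdot>\<^sub>m S"
    if "X \<in> carrier_mat d d" "Y \<in> carrier_mat d d" for X Y
    using that E S by (simp add: mult_add_distrib_mat[of _ d d _ d] mat_trace_add[of _ d] add_smult_distrib_right_mat)
  show "mat_trace (E * (a \<cdot>\<^sub>m X)) \<cdot>\<^sub>m S = a \<cdot>\<^sub>m (mat_trace (E * X) \<cdot>\<^sub>m S)"
    if "X \<in> carrier_mat d d" for a X
    using that E S by (simp add: mult_smult_distrib[of _ d d _ d] mat_trace_smult[of _ d] smult_smult_mat)
  fix k X assume X: "positive_semidefinite (k * d) X"
  let ?T = "mat k k (\<lambda>(a, b). mat_trace (E * mat d d (\<lambda>(p, q). X $$ (a * d + p, b * d + q))))"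
  \<comment> \<open>The ampliation yields the tensor product of the block traces with
    \<open>S\<close>. It is written as a bipartite tensor with trivial second parties, so that
    positivity of tensor products applies.\<close>
  have "ampliation k d d' (\<lambda>X. mat_trace (E * X) \<cdot>\<^sub>m S) X = bipartite_tensor k 1 d' 1 ?T S"
  proof (rule eq_matI)
    fix r c
    assume "r < dim_row (bipartite_tensor k 1 d' 1 ?T S)" "c < dim_col (bipartite_tensor k 1 d' 1 ?T S)"
    then have rc: "r < k * d' * (1 * 1)" "c < k * d' * (1 * 1)" "r < k * d'" "c < k * d'" by simp_all
    have "0 < d'" using rc by (auto intro: Nat.gr0I)
    then have m: "r mod d' < d'" "c mod d' < d'" "r div d' < k" "c div d' < k"
      using rc(3,4) by (simp_all add: less_mult_imp_div_less)
    have t: "tensor_fst 1 d' 1 x = x div d'" "tensor_snd 1 d' 1 x = x mod d'" for x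
      by (simp_all add: tensor_fst_def tensor_snd_def)
    show "ampliation k d d' (\<lambda>X. mat_trace (E * X) \<cdot>\<^sub>m S) X $$ (r, c) = bipartite_tensor k 1 d' 1 ?T S $$ (r, c)"
      unfolding bipartite_tensor_entry[OF rc(1,2)] t using rc(3,4) m S by (simp add: ampliation_def)
  qed (simp_all add: ampliation_def)
  moreover have "positive_semidefinite (k * d' * (1 * 1)) (bipartite_tensor k 1 d' 1 ?T S)"
    using psd_bipartite_tensor[of k 1 ?T d' 1 S] psd_block_trace[OF X assms(1)] assms(2) by simp
  ultimately show "positive_semidefinite (k * d') (ampliation k d d' (\<lambda>X. mat_trace (E * X) \<cdot>\<^sub>m S) X)"
    by simp
qed

lemma completely_positive_add:
  assumes "completely_positive d d' f" "completely_positive d d' g"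
  shows "completely_positive d d' (\<lambda>X. f X + g X)"
proof -
  have lin: "linear_superoperator d d' f" "linear_superoperator d d' g"
    using assms by (auto simp: completely_positive_def)
  have c: "f X \<in> carrier_mat d' d'" "g X \<in> carrier_mat d' d'" if "X \<in> carrier_mat d d" for X
    using lin that by (auto simp: linear_superoperator_def)
  have "linear_superoperator d d' (\<lambda>X. f X + g X)"
    unfolding linear_superoperator_def
  proof (intro conjI ballI allI)
    show "f X + g X \<in> carrier_mat d' d'" if "X \<in> carrier_mat d d" for X using c[OF that] by simp
    show "f (X + Y) + g (X + Y) = f X + g X + (f Y + g Y)"
      if "X \<in> carrier_mat d d" "Y \<in> carrier_mat d d" for X Y
    proof -
      have "f (X + Y) = f X + f Y" "g (X + Y) = g X + g Y"
        using lin that by (auto simp: linear_superoperator_def)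
      then show ?thesis using c[OF that(1)] c[OF that(2)] by (intro eq_matI) auto
    qed
    show "f (a \<cdot>\<^sub>m X) + g (a \<cdot>\<^sub>m X) = a \<cdot>\<^sub>m (f X + g X)" if "X \<in> carrier_mat d d" for a X
    proof -
      have "f (a \<cdot>\<^sub>m X) = a \<cdot>\<^sub>m f X" "g (a \<cdot>\<^sub>m X) = a \<cdot>\<^sub>m g X"
        using lin that by (auto simp: linear_superoperator_def)
      then show ?thesis using c[OF that] by (simp add: add_smult_distrib_left_mat)
    qed
  qed
  moreover have "positive_semidefinite (k * d') (ampliation k d d' (\<lambda>X. f X + g X) X)"
    if X: "positive_semidefinite (k * d) X" for k X
  proof -
    have "ampliation k d d' (\<lambda>X. f X + g X) X = ampliation k d d' f X + ampliation k d d' g X"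
    proof (rule eq_matI)
      fix r s
      assume "r < dim_row (ampliation k d d' f X + ampliation k d d' g X)"
        "s < dim_col (ampliation k d d' f X + ampliation k d d' g X)"
      then have rs: "r < k * d'" "s < k * d'" by (simp_all add: ampliation_def)
      have "0 < d'" using rs by (auto intro: Nat.gr0I)
      then have m: "r mod d' < d'" "s mod d' < d'" by simp_all
      show "ampliation k d d' (\<lambda>X. f X + g X) X $$ (r, s) = (ampliation k d d' f X + ampliation k d d' g X) $$ (r, s)"
        using rs m c[OF mat_carrier, of "\<lambda>(p, q). X $$ (r div d' * d + p, s div d' * d + q)"]
        by (simp add: ampliation_def)
    qed (simp_all add: ampliation_def)
    then show ?thesis
      using assms X psd_add by (auto simp: completely_positive_def)
  qed
  ultimately show ?thesis by (auto simp: completely_positive_def)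
qed

text \<open>The ampliation evaluates a map on blocks of size \<open>d\<close> only. A conjugated map
  may therefore be replaced by a formula that is valid on matrices of that size.\<close>

lemma completely_positive_cong:
  assumes "completely_positive d d' g" "\<And>X. X \<in> carrier_mat d d \<Longrightarrow> f X = g X"
  shows "completely_positive d d' f"
proof -
  have "ampliation k d d' f X = ampliation k d d' g X" for k X
    unfolding ampliation_def by (simp add: assms(2))
  then show ?thesis
    using assms by (simp add: completely_positive_def linear_superoperator_def)
qed

lemma completely_positive_psd:
  assumes "completely_positive d d' f" "positive_semidefinite d X"
  shows "positive_semidefinite d' (f X)"
proof -
  have X: "X \<in> carrier_mat d d" using assms psd_carrier by auto
  then have fX: "f X \<in> carrier_mat d' d'"
    using assms by (auto simp: completely_positive_def linear_superoperator_def)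
  have blk: "mat d d (\<lambda>(p, q). X $$ (0 * d + p, 0 * d + q)) = X"
    using X by (intro eq_matI) auto
  have "ampliation 1 d d' f X = f X"
    using fX blk by (intro eq_matI) (auto simp: ampliation_def)
  then show ?thesis
    using assms unfolding completely_positive_def by (metis mult_1)
qed

section \<open>The maximally entangled state\<close>

definition swap_op :: "complex mat" where
  "swap_op = mat 4 4 (\<lambda>(i, j). if (i, j) \<in> {(0, 0), (1, 2), (2, 1), (3, 3)} then 1 else 0)"

lemma less_4_cases: "i < 4 \<Longrightarrow> i = 0 \<or> i = 1 \<or> i = 2 \<or> i = (3 :: nat)"
  by auto

lemma less_9_cases:
  "i < 9 \<Longrightarrow> i = 0 \<or> i = 1 \<or> i = 2 \<or> i = 3 \<or> i = 4 \<or> i = 5 \<or> i = 6 \<or> i = 7 \<or> i = (8 :: nat)"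
  by auto

lemma lessThan_4: "{..<4} = {0, 1, 2, 3 :: nat}" by auto

lemma lessThan_9: "{..<9} = {0, 1, 2, 3, 4, 5, 6, 7, 8 :: nat}" by auto

lemma inverse_sqrt2_square: "complex_of_real (1 / sqrt 2) * complex_of_real (1 / sqrt 2) = 1 / 2"
proof -
  have "1 / sqrt 2 * (1 / sqrt 2) = 1 / (2 :: real)" by (simp add: field_simps)
  then show ?thesis unfolding of_real_mult[symmetric] by simp
qed

lemma Phi_eq: "Phi = mat 4 4 (\<lambda>(i, j). if i \<in> {0, 3} \<and> j \<in> {0, 3} then 1 / 2 else 0)"
proof -
  have phi: "phi = vec 4 (\<lambda>i. if i \<in> {0, 3} then complex_of_real (1 / sqrt 2) else 0)"
    unfolding phi_def ket2_def by (rule eq_vecI) (auto simp: unit_vec_def)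
  show ?thesis unfolding Phi_def rank_one_def phi
    by (rule eq_matI) (auto simp: inverse_sqrt2_square[unfolded of_real_divide, simplified])
qed

lemma Phi_carrier [simp]: "Phi \<in> carrier_mat (2 * 2) (2 * 2)"
  by (simp add: Phi_eq)

lemma swap_op_carrier [simp]: "swap_op \<in> carrier_mat (2 * 2) (2 * 2)"
  by (simp add: swap_op_def)

lemma Phi_adjoint: "mat_adjoint Phi = Phi"
  by (rule eq_matI) (auto simp: Phi_eq)

lemma swap_op_adjoint: "mat_adjoint swap_op = swap_op"
  by (rule eq_matI) (auto simp: swap_op_def)

lemma Phi_trace: "mat_trace Phi = 1"
  by (simp add: Phi_eq mat_trace_def lessThan_4)

lemma Phi_idem: "Phi * Phi = Phi"
proof (rule eq_matI)
  fix i j assume "i < dim_row Phi" "j < dim_col Phi"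
  then have ij: "i < 4" "j < 4" by (auto simp: Phi_eq)
  have c: "Phi \<in> carrier_mat 4 4" by (simp add: Phi_eq)
  show "(Phi * Phi) $$ (i, j) = Phi $$ (i, j)"
    unfolding mult_index_sum[OF c c ij] using ij
    by (simp add: lessThan_4 Phi_eq)
qed (simp_all add: Phi_eq)

lemma swap_op_square: "swap_op * swap_op = 1\<^sub>m (2 * 2)"
proof (rule eq_matI)
  fix i j assume "i < dim_row (1\<^sub>m (2 * 2) :: complex mat)" "j < dim_col (1\<^sub>m (2 * 2) :: complex mat)"
  then have ij: "i < 4" "j < 4" by auto
  have c: "swap_op \<in> carrier_mat 4 4" by (simp add: swap_op_def)
  show "(swap_op * swap_op) $$ (i, j) = 1\<^sub>m (2 * 2) $$ (i, j)"
    unfolding mult_index_sum[OF c c ij] lessThan_4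
    using less_4_cases[OF ij(1)] less_4_cases[OF ij(2)]
    by (elim disjE) (simp_all add: swap_op_def)
qed (simp_all add: swap_op_def)

lemma Phi_partial_transpose: "partial_transpose 2 2 Phi = complex_of_real (1 / 2) \<cdot>\<^sub>m swap_op"
proof (rule eq_matI)
  fix i j
  assume "i < dim_row (complex_of_real (1 / 2) \<cdot>\<^sub>m swap_op)" "j < dim_col (complex_of_real (1 / 2) \<cdot>\<^sub>m swap_op)"
  then have ij: "i < 4" "j < 4" by (auto simp: swap_op_def)
  show "partial_transpose 2 2 Phi $$ (i, j) = (complex_of_real (1 / 2) \<cdot>\<^sub>m swap_op) $$ (i, j)"
    using less_4_cases[OF ij(1)] less_4_cases[OF ij(2)]
    by (elim disjE) (simp_all add: swap_op_def Phi_eq partial_transpose_def)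
qed (simp_all add: swap_op_def)

abbreviation Phi_pow :: "nat \<Rightarrow> complex mat" where
  "Phi_pow m \<equiv> bipartite_power 2 2 Phi m"

abbreviation swap_pow :: "nat \<Rightarrow> complex mat" where
  "swap_pow m \<equiv> bipartite_power 2 2 swap_op m"

lemma Phi_pow_props:
  "Phi_pow m * Phi_pow m = Phi_pow m" "mat_adjoint (Phi_pow m) = Phi_pow m" "mat_trace (Phi_pow m) = 1"
  "positive_semidefinite (2 ^ m * 2 ^ m) (Phi_pow m)"
  "partial_transpose (2 ^ m) (2 ^ m) (Phi_pow m) = complex_of_real ((1 / 2) ^ m) \<cdot>\<^sub>m swap_pow m"
proof -
  show 1: "Phi_pow m * Phi_pow m = Phi_pow m"
    using bipartite_power_mult[OF Phi_carrier Phi_carrier] by (simp add: Phi_idem)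
  show 2: "mat_adjoint (Phi_pow m) = Phi_pow m"
    using bipartite_power_adjoint[OF Phi_carrier] by (simp add: Phi_adjoint)
  show "mat_trace (Phi_pow m) = 1"
    using bipartite_power_trace[OF Phi_carrier] by (simp add: Phi_trace)
  show "positive_semidefinite (2 ^ m * 2 ^ m) (Phi_pow m)"
    by (rule psd_idempotent[OF bipartite_power_carrier 2, of 1]) (use 1 in simp_all)
  show "partial_transpose (2 ^ m) (2 ^ m) (Phi_pow m) = complex_of_real ((1 / 2) ^ m) \<cdot>\<^sub>m swap_pow m"
    unfolding partial_transpose_power[OF Phi_carrier] Phi_partial_transpose
    by (subst bipartite_power_smult[OF swap_op_carrier]) simp
qed

lemma psd_complement_projection:
  assumes P: "P \<in> carrier_mat d d" "mat_adjoint P = P" "P * P = P"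
  shows "positive_semidefinite d (1\<^sub>m d - P)"
proof (rule psd_idempotent[of _ _ 1])
  show "mat_adjoint (1\<^sub>m d - P) = 1\<^sub>m d - P"
    using adjoint_minus[OF one_carrier_mat P(1)] P(2) by simp
  have "(1\<^sub>m d - P) * (1\<^sub>m d - P) = 1\<^sub>m d - P - (P - P * P)"
    using P(1) by (simp add: mult_minus_distrib_mat[of _ d d _ d] minus_mult_distrib_mat[of _ d d _ _ d] minus_carrier_mat)
  also have "\<dots> = complex_of_real 1 \<cdot>\<^sub>m (1\<^sub>m d - P)"
    unfolding P(3) using P(1) by (intro eq_matI) auto
  finally show "(1\<^sub>m d - P) * (1\<^sub>m d - P) = complex_of_real 1 \<cdot>\<^sub>m (1\<^sub>m d - P)" .
qed (use P in \<open>simp_all add: minus_carrier_mat\<close>)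

lemma psd_one_diff_Phi_pow: "positive_semidefinite (2 ^ m * 2 ^ m) (1\<^sub>m (2 ^ m * 2 ^ m) - Phi_pow m)"
  by (rule psd_complement_projection[OF bipartite_power_carrier Phi_pow_props(2,1)])

text \<open>A Hermitian involution has eigenvalues 1 and -1; concretely, 1 + F and 1 - F both
  satisfy H * H = 2 H.\<close>

lemma dominates_one_involution:
  assumes F: "F \<in> carrier_mat d d" "mat_adjoint F = F" "F * F = 1\<^sub>m d"
  shows "dominates d (1\<^sub>m d) F"
proof -
  have "positive_semidefinite d (1\<^sub>m d + F)"
  proof (rule psd_idempotent[of _ _ 2])
    show "mat_adjoint (1\<^sub>m d + F) = 1\<^sub>m d + F"
      using adjoint_add[OF one_carrier_mat F(1)] F(2) by simp
    have "(1\<^sub>m d + F) * (1\<^sub>m d + F) = 1\<^sub>m d + F + (F + F * F)"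
      using F(1) by (simp add: mult_add_distrib_mat[of _ d d _ d] add_mult_distrib_mat[of _ d d _ _ d])
    also have "\<dots> = complex_of_real 2 \<cdot>\<^sub>m (1\<^sub>m d + F)"
      unfolding F(3) using F(1) by (intro eq_matI) auto
    finally show "(1\<^sub>m d + F) * (1\<^sub>m d + F) = complex_of_real 2 \<cdot>\<^sub>m (1\<^sub>m d + F)" .
  qed (use F in simp_all)
  moreover have "positive_semidefinite d (1\<^sub>m d - F)"
  proof (rule psd_idempotent[of _ _ 2])
    show "mat_adjoint (1\<^sub>m d - F) = 1\<^sub>m d - F"
      using adjoint_minus[OF one_carrier_mat F(1)] F(2) by simp
    have "(1\<^sub>m d - F) * (1\<^sub>m d - F) = 1\<^sub>m d - F - (F - F * F)"
      using F(1) by (simp add: mult_minus_distrib_mat[of _ d d _ d] minus_mult_distrib_mat[of _ d d _ _ d] minus_carrier_mat)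
    also have "\<dots> = complex_of_real 2 \<cdot>\<^sub>m (1\<^sub>m d - F)"
      unfolding F(3) using F(1) by (intro eq_matI) auto
    finally show "(1\<^sub>m d - F) * (1\<^sub>m d - F) = complex_of_real 2 \<cdot>\<^sub>m (1\<^sub>m d - F)" .
  qed (use F in \<open>simp_all add: minus_carrier_mat\<close>)
  ultimately show ?thesis using F(1) by (simp add: dominates_def)
qed

lemma dominates_one_swap_pow: "dominates (2 ^ m * 2 ^ m) (1\<^sub>m (2 ^ m * 2 ^ m)) (swap_pow m)"
proof (rule dominates_one_involution)
  show "mat_adjoint (swap_pow m) = swap_pow m"
    using bipartite_power_adjoint[OF swap_op_carrier] by (simp add: swap_op_adjoint)
  show "swap_pow m * swap_pow m = 1\<^sub>m (2 ^ m * 2 ^ m)"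
    unfolding bipartite_power_mult[OF swap_op_carrier swap_op_carrier] swap_op_square
    by (rule bipartite_power_one)
qed simp

section \<open>Operators with the symmetry of the antisymmetric state\<close>

text \<open>
  On \<open>span {|01>, |02>, |10>, |20>}\<close> the operator is \<open>e + w\<close> times the swap; on
  \<open>span {|00>, |11>, |22>}\<close> the coefficient \<open>v\<close> belongs to \<open>V = |00>(<11| + <22|) + h.c.\<close>
  and \<open>z\<close> to the projection \<open>V\<^sup>2 / 2\<close>; \<open>n\<close> is the weight of the remaining projection.
\<close>

definition sym_entry :: "real \<Rightarrow> real \<Rightarrow> real \<Rightarrow> real \<Rightarrow> real \<Rightarrow> nat \<Rightarrow> nat \<Rightarrow> real" where
  "sym_entry e w v z n i j =
     (if i = j then (if i \<in> {1, 2, 3, 6} then e else if i = 0 then z else if i \<in> {4, 8} then (z + n) / 2 else n)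
      else if (i, j) \<in> {(1, 3), (3, 1), (2, 6), (6, 2)} then w
      else if (i, j) \<in> {(0, 4), (4, 0), (0, 8), (8, 0)} then v
      else if (i, j) \<in> {(4, 8), (8, 4)} then (z - n) / 2 else 0)"

definition sym_mat :: "real \<Rightarrow> real \<Rightarrow> real \<Rightarrow> real \<Rightarrow> real \<Rightarrow> complex mat" where
  "sym_mat e w v z n = mat 9 9 (\<lambda>(i, j). complex_of_real (sym_entry e w v z n i j))"

lemma sym_mat_carrier [simp]: "sym_mat e w v z n \<in> carrier_mat 9 9"
  by (simp add: sym_mat_def)

lemma sym_mat_dim [simp]: "dim_row (sym_mat e w v z n) = 9" "dim_col (sym_mat e w v z n) = 9"
  by (simp_all add: sym_mat_def)

lemma sym_mat_index [simp]:
  "i < 9 \<Longrightarrow> j < 9 \<Longrightarrow> sym_mat e w v z n $$ (i, j) = complex_of_real (sym_entry e w v z n i j)"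
  by (simp add: sym_mat_def)

lemma sym_mat_adjoint [simp]: "mat_adjoint (sym_mat e w v z n) = sym_mat e w v z n"
  by (rule eq_matI) (auto simp: sym_entry_def)

lemma sym_mat_add: "sym_mat e w v z n + sym_mat e' w' v' z' n' = sym_mat (e + e') (w + w') (v + v') (z + z') (n + n')"
proof (rule eq_matI; simp)
  fix i j
  show "complex_of_real (sym_entry e w v z n i j) + complex_of_real (sym_entry e' w' v' z' n' i j)
    = complex_of_real (sym_entry (e + e') (w + w') (v + v') (z + z') (n + n') i j)"
    unfolding of_real_add[symmetric] by (simp add: sym_entry_def field_simps)
qed

lemma sym_mat_smult: "complex_of_real c \<cdot>\<^sub>m sym_mat e w v z n = sym_mat (c * e) (c * w) (c * v) (c * z) (c * n)"
proof (rule eq_matI; simp)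
  fix i j
  show "complex_of_real c * complex_of_real (sym_entry e w v z n i j)
    = complex_of_real (sym_entry (c * e) (c * w) (c * v) (c * z) (c * n) i j)"
    unfolding of_real_mult[symmetric] by (simp add: sym_entry_def field_simps)
qed

lemma sym_mat_minus: "sym_mat e w v z n - sym_mat e' w' v' z' n' = sym_mat (e - e') (w - w') (v - v') (z - z') (n - n')"
proof (rule eq_matI; simp)
  fix i j
  show "complex_of_real (sym_entry e w v z n i j) - complex_of_real (sym_entry e' w' v' z' n' i j)
    = complex_of_real (sym_entry (e - e') (w - w') (v - v') (z - z') (n - n') i j)"
    unfolding of_real_diff[symmetric] by (simp add: sym_entry_def field_simps)
qed

lemma sym_mat_one: "1\<^sub>m 9 = sym_mat 1 0 0 1 1"
  by (rule eq_matI) (auto simp: sym_entry_def)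

text \<open>The operators form a commutative algebra, so later products become arithmetic in five
  real parameters. The factor 2 in the fourth slot is V^2 = 2 (V^2 / 2): the nonzero eigenvalues of
  V are plus and minus sqrt 2.\<close>

lemma sym_entry_mult:
  assumes "i < 9" "j < 9"
  shows "(\<Sum>l<9. sym_entry e w v z n i l * sym_entry e' w' v' z' n' l j)
    = sym_entry (e * e' + w * w') (e * w' + w * e') (v * z' + z * v') (z * z' + 2 * v * v') (n * n') i j"
  unfolding lessThan_9 using less_9_cases[OF assms(1)] less_9_cases[OF assms(2)]
  by (elim disjE; simp add: sym_entry_def; simp add: field_simps)

lemma sym_mat_mult:
  "sym_mat e w v z n * sym_mat e' w' v' z' n'
    = sym_mat (e * e' + w * w') (e * w' + w * e') (v * z' + z * v') (z * z' + 2 * v * v') (n * n')"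
proof (rule eq_matI)
  let ?R = "sym_mat (e * e' + w * w') (e * w' + w * e') (v * z' + z * v') (z * z' + 2 * v * v') (n * n')"
  fix i j assume "i < dim_row ?R" "j < dim_col ?R"
  then have ij: "i < 9" "j < 9" by simp_all
  have "(sym_mat e w v z n * sym_mat e' w' v' z' n') $$ (i, j)
    = complex_of_real (\<Sum>l<9. sym_entry e w v z n i l * sym_entry e' w' v' z' n' l j)"
    unfolding mult_index_sum[OF sym_mat_carrier sym_mat_carrier ij] of_real_sum
    using ij by (intro sum.cong) auto
  then show "(sym_mat e w v z n * sym_mat e' w' v' z' n') $$ (i, j) = ?R $$ (i, j)"
    unfolding sym_entry_mult[OF ij] using ij by simp
qed simp_all

lemma sym_mat_trace: "mat_trace (sym_mat e w v z n) = complex_of_real (4 * e + 2 * z + 3 * n)"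
proof -
  have "mat_trace (sym_mat e w v z n) = complex_of_real (\<Sum>i<9. sym_entry e w v z n i i)"
    by (simp add: mat_trace_def)
  also have "(\<Sum>i<9. sym_entry e w v z n i i) = 4 * e + 2 * z + 3 * n"
    unfolding lessThan_9 by (simp add: sym_entry_def field_simps)
  finally show ?thesis .
qed

text \<open>Partial transposition exchanges |01><10| with |00><11|, hence the swap coefficient with
  that of V. For \<open>z\<close> different from \<open>n\<close> there would be an entry at
  |11><22|, which moves to |12><21| and leaves the family.\<close>

lemma sym_mat_partial_transpose:
  "partial_transpose 3 3 (sym_mat e w v 0 0) = sym_mat e v w 0 0"
proof (rule eq_matI)
  fix i j assume "i < dim_row (sym_mat e v w 0 0)" "j < dim_col (sym_mat e v w 0 0)"
  then have ij: "i < 9" "j < 9" by simp_all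
  show "partial_transpose 3 3 (sym_mat e w v 0 0) $$ (i, j) = sym_mat e v w 0 0 $$ (i, j)"
    using less_9_cases[OF ij(1)] less_9_cases[OF ij(2)]
    by (elim disjE) (simp_all add: partial_transpose_def sym_entry_def)
qed simp_all

lemma rho_v_eq: "rho_v = sym_mat (1 / 4) (- 1 / 4) 0 0 0"
proof -
  let ?s = "complex_of_real (1 / sqrt 2)"
  \<comment> \<open>The integer coefficients are kept apart from the factor 1 / sqrt 2, which then
    occurs only squared.\<close>
  define c :: "nat \<Rightarrow> nat \<Rightarrow> nat \<Rightarrow> real" where "c k l i = (if i = k then 1 else if i = l then - 1 else 0)" for k l i
  have v1: "v1 = vec 9 (\<lambda>i. ?s * complex_of_real (c 1 3 i))"
    unfolding v1_def ket2_def by (rule eq_vecI) (auto simp: unit_vec_def c_def)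
  have v2: "v2 = vec 9 (\<lambda>i. ?s * complex_of_real (c 2 6 i))"
    unfolding v2_def ket2_def by (rule eq_vecI) (auto simp: unit_vec_def c_def)
  have prod: "(?s * complex_of_real x) * cnj (?s * complex_of_real y) = complex_of_real (1 / 2 * (x * y))" for x y
  proof -
    have "(?s * complex_of_real x) * cnj (?s * complex_of_real y) = (?s * ?s) * complex_of_real (x * y)"
      by (simp only: complex_cnj_mult complex_cnj_complex_of_real of_real_mult ac_simps)
    then show ?thesis unfolding inverse_sqrt2_square by simp
  qed
  have entry: "1 / 2 * (1 / 2 * (c 1 3 i * c 1 3 j) + 1 / 2 * (c 2 6 i * c 2 6 j)) = sym_entry (1 / 4) (- 1 / 4) 0 0 0 i j"
    if "i < 9" "j < 9" for i j
    using less_9_cases[OF that(1)] less_9_cases[OF that(2)]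
    by (elim disjE) (simp_all add: sym_entry_def c_def)
  show ?thesis
  proof (rule eq_matI)
    fix i j assume "i < dim_row (sym_mat (1 / 4) (- 1 / 4) 0 0 0)" "j < dim_col (sym_mat (1 / 4) (- 1 / 4) 0 0 0)"
    then have ij: "i < 9" "j < 9" by simp_all
    have "rho_v $$ (i, j) = complex_of_real (1 / 2) * (v1 $ i * cnj (v1 $ j) + v2 $ i * cnj (v2 $ j))"
      using ij by (simp add: rho_v_def rank_one_def v1 v2)
    also have "v1 $ i * cnj (v1 $ j) = complex_of_real (1 / 2 * (c 1 3 i * c 1 3 j))"
      unfolding v1 index_vec[OF ij(1)] index_vec[OF ij(2)] by (rule prod)
    also have "v2 $ i * cnj (v2 $ j) = complex_of_real (1 / 2 * (c 2 6 i * c 2 6 j))"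
      unfolding v2 index_vec[OF ij(1)] index_vec[OF ij(2)] by (rule prod)
    finally show "rho_v $$ (i, j) = sym_mat (1 / 4) (- 1 / 4) 0 0 0 $$ (i, j)"
      unfolding of_real_add[symmetric] of_real_mult[symmetric] entry[OF ij] sym_mat_index[OF ij] .
  qed (simp_all add: rho_v_def rank_one_def v1 v2)
qed

text \<open>The hypotheses say that all eigenvalues are nonnegative: \<open>e + w\<close> and
  \<open>e - w\<close> on the swap block, \<open>z + sqrt 2 v\<close> and
  \<open>z - sqrt 2 v\<close> on the range of V, and \<open>n\<close>. The proof writes the operator
  as a nonnegative combination of five multiples of projections; \<open>p\<close> and
  \<open>r\<close> solve p - r = v and sqrt 2 (p + r) = z.\<close>

lemma psd_sym_mat:
  assumes "\<bar>w\<bar> \<le> e" "sqrt 2 * \<bar>v\<bar> \<le> z" "0 \<le> n"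
  shows "positive_semidefinite 9 (sym_mat e w v z n)"
proof -
  define p where "p = (z / sqrt 2 + v) / 2"
  define r where "r = (z / sqrt 2 - v) / 2"
  have "\<bar>v\<bar> \<le> z / sqrt 2" using assms(2) by (simp add: field_simps)
  then have pr: "0 \<le> p" "0 \<le> r" by (auto simp: p_def r_def)
  have psd: "positive_semidefinite 9 (sym_mat 1 1 0 0 0)" "positive_semidefinite 9 (sym_mat 1 (- 1) 0 0 0)"
    "positive_semidefinite 9 (sym_mat 0 0 1 (sqrt 2) 0)" "positive_semidefinite 9 (sym_mat 0 0 (- 1) (sqrt 2) 0)"
    "positive_semidefinite 9 (sym_mat 0 0 0 0 1)"
  proof -
    show "positive_semidefinite 9 (sym_mat 1 1 0 0 0)"
      by (rule psd_idempotent[of _ _ 2]) (simp_all only: sym_mat_carrier sym_mat_adjoint sym_mat_mult sym_mat_smult, simp_all)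
    show "positive_semidefinite 9 (sym_mat 1 (- 1) 0 0 0)"
      by (rule psd_idempotent[of _ _ 2]) (simp_all only: sym_mat_carrier sym_mat_adjoint sym_mat_mult sym_mat_smult, simp_all)
    show "positive_semidefinite 9 (sym_mat 0 0 1 (sqrt 2) 0)"
      by (rule psd_idempotent[of _ _ "2 * sqrt 2"]) (simp_all only: sym_mat_carrier sym_mat_adjoint sym_mat_mult sym_mat_smult, simp_all add: mult.assoc)
    show "positive_semidefinite 9 (sym_mat 0 0 (- 1) (sqrt 2) 0)"
      by (rule psd_idempotent[of _ _ "2 * sqrt 2"]) (simp_all only: sym_mat_carrier sym_mat_adjoint sym_mat_mult sym_mat_smult, simp_all add: mult.assoc)
    show "positive_semidefinite 9 (sym_mat 0 0 0 0 1)"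
      by (rule psd_idempotent[of _ _ 1]) (simp_all only: sym_mat_carrier sym_mat_adjoint sym_mat_mult sym_mat_smult, simp_all)
  qed
  have "positive_semidefinite 9 (complex_of_real ((e + w) / 2) \<cdot>\<^sub>m sym_mat 1 1 0 0 0
      + complex_of_real ((e - w) / 2) \<cdot>\<^sub>m sym_mat 1 (- 1) 0 0 0
      + complex_of_real p \<cdot>\<^sub>m sym_mat 0 0 1 (sqrt 2) 0
      + complex_of_real r \<cdot>\<^sub>m sym_mat 0 0 (- 1) (sqrt 2) 0
      + complex_of_real n \<cdot>\<^sub>m sym_mat 0 0 0 0 1)"
    by (intro psd_add psd_smult psd pr) (use assms in auto)
  also have "(complex_of_real ((e + w) / 2) \<cdot>\<^sub>m sym_mat 1 1 0 0 0
      + complex_of_real ((e - w) / 2) \<cdot>\<^sub>m sym_mat 1 (- 1) 0 0 0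
      + complex_of_real p \<cdot>\<^sub>m sym_mat 0 0 1 (sqrt 2) 0
      + complex_of_real r \<cdot>\<^sub>m sym_mat 0 0 (- 1) (sqrt 2) 0
      + complex_of_real n \<cdot>\<^sub>m sym_mat 0 0 0 0 1) = sym_mat e w v z n"
  proof -
    have "(e + w) / 2 + (e - w) / 2 = e" "(e + w) / 2 - (e - w) / 2 = w" "p - r = v"
      "p * sqrt 2 + r * sqrt 2 = z"
      by (simp_all add: p_def r_def field_simps)
    then show ?thesis unfolding sym_mat_smult sym_mat_add by simp
  qed
  finally show ?thesis .
qed

section \<open>Relative entropy\<close>

lemma conj_diag_carrier:
  "unitary_mat d U \<Longrightarrow> U * real_diag d x * mat_adjoint U \<in> carrier_mat d d"
  using unitary_matD(1)[of d U] by simp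

lemma smult_conj_diag:
  assumes "unitary_mat d U"
  shows "complex_of_real c \<cdot>\<^sub>m (U * real_diag d x * mat_adjoint U) = U * real_diag d (\<lambda>i. c * x i) * mat_adjoint U"
proof -
  have U: "U \<in> carrier_mat d d" "mat_adjoint U \<in> carrier_mat d d" using unitary_matD[OF assms] by auto
  have D: "real_diag d (\<lambda>i. c * x i) = complex_of_real c \<cdot>\<^sub>m real_diag d x"
    by (rule eq_matI) auto
  show ?thesis unfolding D mult_smult_distrib[OF U(1) real_diag_carrier]
    by (rule mult_smult_assoc_mat[OF mult_carrier_square[OF U(1) real_diag_carrier] U(2), symmetric])
qed

lemma conj_diag_inject:
  assumes "unitary_mat d U"
    and "U * real_diag d x * mat_adjoint U = U * real_diag d y * mat_adjoint U" "i < d"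
  shows "x i = y i"
proof -
  have "real_diag d x = real_diag d y"
    using arg_cong[OF assms(2), of "\<lambda>M. mat_adjoint U * M * U"] unfolding unitary_conj_diag[OF assms(1)] .
  then have "real_diag d x $$ (i, i) = real_diag d y $$ (i, i)" by simp
  then show ?thesis using assms(3) by simp
qed

lemma trace_mult_conj_diag:
  assumes "unitary_mat d U" "A \<in> carrier_mat d d"
  shows "mat_trace (A * (U * real_diag d y * mat_adjoint U)) = (\<Sum>i<d. (mat_adjoint U * A * U) $$ (i, i) * y i)"
proof -
  note U = unitary_matD[OF assms(1)]
  have c: "mat_adjoint U * A * U \<in> carrier_mat d d" using U(1) assms(2) by simp
  have "mat_trace (A * (U * real_diag d y * mat_adjoint U)) = mat_trace (A * U * real_diag d y * mat_adjoint U)"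
    using U(1) assms(2) by (simp add: assoc_mult_mat[of _ d d _ d _ d])
  also have "\<dots> = mat_trace (mat_adjoint U * (A * U * real_diag d y))"
    by (rule mat_trace_comm[of _ d d]) (use U assms in auto)
  also have "mat_adjoint U * (A * U * real_diag d y) = mat_adjoint U * A * U * real_diag d y"
    using U(1) assms(2) by (simp add: assoc_mult_mat[of _ d d _ d _ d])
  finally show ?thesis
    using U(1) by (simp add: mat_trace_def mult_real_diag_index[OF c] del: index_mult_mat(1))
qed

lemma mat_log2_carrier:
  assumes "A \<in> carrier_mat d d" "mat_adjoint A = A"
  shows "mat_log2 A \<in> carrier_mat d d"
proof -
  obtain U x where "unitary_mat d U" "mat_log2 A = U * real_diag d ((\<lambda>x. if x > 0 then log 2 x else 0) \<circ> x) * mat_adjoint U"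
    unfolding mat_log2_def by (rule hermitian_fun_obtain[OF assms, of "\<lambda>x. if x > 0 then log 2 x else 0"])
  then show ?thesis using conj_diag_carrier by simp
qed

text \<open>\<open>\<rho>\<close> is flat: \<rho> * \<rho> = p \<rho> leaves 0 and p as the only
  possible eigenvalues, so the logarithm of t \<rho> is constant on the support of \<rho>. The case
  t = 1 gives Tr (\<rho> log \<rho>) = log p.\<close>

lemma trace_mult_log_scaled:
  assumes \<rho>: "\<rho> \<in> carrier_mat d d" "mat_adjoint \<rho> = \<rho>" "mat_trace \<rho> = 1"
    and p: "\<rho> * \<rho> = complex_of_real p \<cdot>\<^sub>m \<rho>" "0 < p" and t: "0 < t"
  shows "Re (mat_trace (\<rho> * mat_log2 (complex_of_real t \<cdot>\<^sub>m \<rho>))) = log 2 (t * p)"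
proof -
  let ?A = "complex_of_real t \<cdot>\<^sub>m \<rho>" and ?f = "\<lambda>x::real. if x > 0 then log 2 x else 0"
  have A: "?A \<in> carrier_mat d d" "mat_adjoint ?A = ?A" using \<rho> by (simp_all add: adjoint_smult)
  obtain U x where U: "unitary_mat d U" and Ax: "?A = U * real_diag d x * mat_adjoint U"
    and L: "mat_log2 ?A = U * real_diag d (?f \<circ> x) * mat_adjoint U"
    unfolding mat_log2_def by (rule hermitian_fun_obtain[OF A, of ?f])
  have sum_x: "(\<Sum>i<d. x i) = t"
  proof -
    have "complex_of_real (\<Sum>i<d. x i) = mat_trace ?A"
      unfolding Ax trace_unitary_conj[OF U real_diag_carrier] trace_real_diag ..
    also have "\<dots> = complex_of_real t" using \<rho> by (simp add: mat_trace_smult)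
    finally show ?thesis by (simp only: of_real_eq_iff)
  qed
  have "?A * ?A = complex_of_real (t * p) \<cdot>\<^sub>m ?A"
    using \<rho>(1) p(1) by (simp add: mult_smult_assoc_mat[of _ d d _ d] mult_smult_distrib[of _ d d _ d] smult_smult_mat ac_simps)
  then have "x i * x i = t * p * x i" if "i < d" for i
    using conj_diag_inject[OF U _ that] unfolding Ax mult_conj_diag[OF U] smult_conj_diag[OF U] by blast
  \<comment> \<open>Each eigenvalue is 0 or t p. At 0 the factor \<open>x i\<close> removes the
    value of the extended logarithm.\<close>
  then have xf: "x i * ?f (x i) = x i * log 2 (t * p)" if "i < d" for i
    using that p(2) t by force
  have "\<rho> = complex_of_real (1 / t) \<cdot>\<^sub>m ?A" using t by (intro eq_matI) auto
  then have "\<rho> * mat_log2 ?A = complex_of_real (1 / t) \<cdot>\<^sub>m (?A * mat_log2 ?A)"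
    using mult_smult_assoc_mat[OF A(1) mat_log2_carrier[OF A]] by metis
  also have "?A * mat_log2 ?A = U * real_diag d (\<lambda>i. x i * ?f (x i)) * mat_adjoint U"
    unfolding L unfolding Ax mult_conj_diag[OF U] by simp
  finally have "mat_trace (\<rho> * mat_log2 ?A) = complex_of_real (1 / t) * complex_of_real (\<Sum>i<d. x i * ?f (x i))"
    by (simp only: mat_trace_smult[OF conj_diag_carrier[OF U]] trace_unitary_conj[OF U real_diag_carrier] trace_real_diag)
  also have "(\<Sum>i<d. x i * ?f (x i)) = t * log 2 (t * p)"
    by (simp add: xf sum_x flip: sum_distrib_right)
  finally show ?thesis using t by simp
qed

text \<open>Jensen's inequality for the distribution of \<open>\<rho>\<close> over the eigenbasis of \<open>\<sigma>\<close>.\<close>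

lemma trace_mult_log_le:
  assumes \<rho>: "positive_semidefinite d \<rho>" "mat_trace \<rho> = 1" and \<sigma>: "positive_semidefinite d \<sigma>"
    and supp: "mat_support \<rho> \<subseteq> mat_support \<sigma>"
  shows "0 < Re (mat_trace (\<rho> * \<sigma>))"
    and "Re (mat_trace (\<rho> * mat_log2 \<sigma>)) \<le> log 2 (Re (mat_trace (\<rho> * \<sigma>)))"
proof -
  let ?f = "\<lambda>x::real. if x > 0 then log 2 x else 0"
  have c: "\<rho> \<in> carrier_mat d d" "\<sigma> \<in> carrier_mat d d" using \<rho> \<sigma> psd_carrier by auto
  obtain U x where U: "unitary_mat d U" and \<sigma>x: "\<sigma> = U * real_diag d x * mat_adjoint U"
    and L: "mat_log2 \<sigma> = U * real_diag d (?f \<circ> x) * mat_adjoint U"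
    unfolding mat_log2_def by (rule hermitian_fun_obtain[OF c(2) psd_hermitian[OF \<sigma>], of ?f])
  note U' = unitary_matD[OF U]
  have x: "0 \<le> x i" if "i < d" for i using psd_eigenvalue_ge0[of d U x i] \<sigma> \<sigma>x U that by simp
  define G where "G = mat_adjoint U * \<rho> * U"
  define g where "g i = Re (G $$ (i, i))" for i
  have G: "positive_semidefinite d G" unfolding G_def by (rule psd_congruence[OF \<rho>(1) U'(1)])
  have Gg: "G $$ (i, i) = complex_of_real (g i)" "0 \<le> g i" if "i < d" for i
    using psd_diag_ge0[OF G that] by (simp_all add: g_def less_eq_complex_def complex_eq_iff)
  have tr: "mat_trace (\<rho> * (U * real_diag d y * mat_adjoint U)) = complex_of_real (\<Sum>i<d. g i * y i)" for y
    unfolding trace_mult_conj_diag[OF U c(1)] G_def[symmetric] of_real_sum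
    by (intro sum.cong refl) (simp add: Gg)
  have sum_g: "(\<Sum>i<d. g i) = 1"
  proof -
    have "U * real_diag d (\<lambda>_. 1) * mat_adjoint U = 1\<^sub>m d"
    proof -
      have "real_diag d (\<lambda>_. 1) = 1\<^sub>m d" by (rule eq_matI) auto
      then show ?thesis using U' by simp
    qed
    then have "complex_of_real (\<Sum>i<d. g i) = mat_trace \<rho>"
      using tr[of "\<lambda>_. 1"] c(1) by simp
    then show ?thesis using \<rho>(2) by (metis of_real_eq_1_iff)
  qed
  \<comment> \<open>Inclusion of supports puts no weight on the kernel of \<sigma>: for a zero
    eigenvalue the image of \<sigma> has no component along that eigenvector, and \<rho> maps into
    this image.\<close>
  have g0: "g i = 0" if i: "i < d" "x i = 0" for i
  proof -
    let ?u = "U *\<^sub>v unit_vec d i"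
    have u: "?u \<in> carrier_vec d" using U'(1) by (rule mult_mat_vec_carrier) simp
    then have "\<rho> *\<^sub>v ?u \<in> mat_support \<sigma>" using supp c by (auto simp: mat_support_def)
    then obtain w where w: "w \<in> carrier_vec d" "\<rho> *\<^sub>v ?u = \<sigma> *\<^sub>v w" using c by (auto simp: mat_support_def)
    note aU = adjoint_carrier[OF U'(1)]
    have "G *\<^sub>v unit_vec d i = mat_adjoint U *\<^sub>v (\<rho> *\<^sub>v ?u)"
      unfolding G_def assoc_mult_mat_vec[OF mult_carrier_square[OF aU c(1)] U'(1) unit_vec_carrier]
        assoc_mult_mat_vec[OF aU c(1) u] ..
    also have "\<dots> = mat_adjoint U * \<sigma> *\<^sub>v w"
      unfolding w(2) assoc_mult_mat_vec[OF aU c(2) w(1)] ..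
    also have "mat_adjoint U * \<sigma> = real_diag d x * mat_adjoint U"
    proof -
      have "mat_adjoint U * \<sigma> = mat_adjoint U * U * real_diag d x * mat_adjoint U"
        unfolding \<sigma>x using U'(1) by (simp add: assoc_mult_mat[of _ d d _ d _ d])
      then show ?thesis using U' by simp
    qed
    finally have *: "G *\<^sub>v unit_vec d i = real_diag d x * mat_adjoint U *\<^sub>v w" .
    have "(real_diag d x * mat_adjoint U *\<^sub>v w) $ i = (\<Sum>l<d. (real_diag d x * mat_adjoint U) $$ (i, l) * w $ l)"
      by (rule mult_vec_index_sum) (use aU w i in auto)
    also have "\<dots> = 0"
      using i by (intro sum.neutral) (simp add: real_diag_mult_index[OF aU] del: index_mult_mat(1))
    finally have "(G *\<^sub>v unit_vec d i) $ i = 0" unfolding * .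
    then have "G $$ (i, i) = 0" using i psd_carrier[OF G] by simp
    then show ?thesis by (simp add: g_def)
  qed
  define s where "s = (\<Sum>i<d. g i * x i)"
  have s_eq: "Re (mat_trace (\<rho> * \<sigma>)) = s" unfolding s_def \<sigma>x tr by simp
  obtain k where k: "k < d" "g k \<noteq> 0" using sum_g by (metis lessThan_iff sum.neutral zero_neq_one)
  have "x k \<noteq> 0" using k g0 by blast
  then have "0 < g k * x k" using k x[OF k(1)] Gg(2)[OF k(1)] by simp
  also have "\<dots> \<le> s" unfolding s_def
    by (rule member_le_sum) (use k x Gg(2) in auto)
  finally have s: "0 < s" .
  then show "0 < Re (mat_trace (\<rho> * \<sigma>))" by (simp add: s_eq)
  \<comment> \<open>Jensen's inequality by the tangent of the logarithm at the mean
    \<open>s\<close>, that is ln y \<le> y - 1 for y = x i / s. After summation with the weights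
    \<open>g\<close> the linear terms cancel.\<close>
  have bound: "g i * ?f (x i) \<le> g i * (log 2 s) + (g i * x i / s - g i) / ln 2" if i: "i < d" for i
  proof (cases "x i = 0")
    case True
    then show ?thesis using g0[OF i True] by simp
  next
    case False
    then have xi: "0 < x i" using x[OF i] by simp
    have "ln (x i / s) \<le> x i / s - 1" using xi s by (intro ln_le_minus_one) simp
    then have "log 2 (x i) \<le> log 2 s + (x i / s - 1) / ln 2"
      using xi s by (simp add: log_def ln_div field_simps)
    then have "g i * log 2 (x i) \<le> g i * (log 2 s + (x i / s - 1) / ln 2)"
      using Gg(2)[OF i] by (rule mult_left_mono)
    then show ?thesis using xi by (simp add: algebra_simps diff_divide_distrib)
  qed
  have "Re (mat_trace (\<rho> * mat_log2 \<sigma>)) = (\<Sum>i<d. g i * ?f (x i))" unfolding L tr by simp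
  also have "\<dots> \<le> (\<Sum>i<d. g i * (log 2 s) + (g i * x i / s - g i) / ln 2)"
    by (intro sum_mono bound) simp
  also have "\<dots> = (\<Sum>i<d. g i) * log 2 s + ((\<Sum>i<d. g i * x i) / s - (\<Sum>i<d. g i)) / ln 2"
    by (simp add: sum.distrib sum_subtractf sum_distrib_right flip: sum_divide_distrib)
  also have "\<dots> = log 2 s" using s by (simp add: sum_g flip: s_def)
  finally show "Re (mat_trace (\<rho> * mat_log2 \<sigma>)) \<le> log 2 (Re (mat_trace (\<rho> * \<sigma>)))" by (simp add: s_eq)
qed

lemma relative_entropy_scaled:
  assumes \<rho>: "\<rho> \<in> carrier_mat d d" "mat_adjoint \<rho> = \<rho>" "mat_trace \<rho> = 1"
    and p: "\<rho> * \<rho> = complex_of_real p \<cdot>\<^sub>m \<rho>" "0 < p" and t: "0 < t"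
  shows "relative_entropy \<rho> (complex_of_real t \<cdot>\<^sub>m \<rho>) = ereal (- log 2 t)"
proof -
  let ?A = "complex_of_real t \<cdot>\<^sub>m \<rho>"
  have A: "?A \<in> carrier_mat d d" "mat_adjoint ?A = ?A" using \<rho> by (simp_all add: adjoint_smult)
  have "mat_support \<rho> \<subseteq> mat_support ?A"
  proof
    fix y assume "y \<in> mat_support \<rho>"
    then obtain v where v: "v \<in> carrier_vec d" "y = \<rho> *\<^sub>v v" using \<rho> by (auto simp: mat_support_def)
    have "y = ?A *\<^sub>v (complex_of_real (1 / t) \<cdot>\<^sub>v v)"
      using v \<rho>(1) t by (intro eq_vecI) auto
    then show "y \<in> mat_support ?A" using v \<rho>(1) unfolding mat_support_def by auto
  qed
  moreover have "Re (mat_trace (\<rho> * mat_log2 \<rho> - \<rho> * mat_log2 ?A)) = - log 2 t"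
  proof -
    have "Re (mat_trace (\<rho> * mat_log2 \<rho> - \<rho> * mat_log2 ?A))
      = Re (mat_trace (\<rho> * mat_log2 \<rho>)) - Re (mat_trace (\<rho> * mat_log2 ?A))"
      using mat_trace_minus[OF mult_carrier_square[OF \<rho>(1) mat_log2_carrier[OF \<rho>(1,2)]]
          mult_carrier_square[OF \<rho>(1) mat_log2_carrier[OF A]]] by simp
    also have "\<dots> = log 2 (1 * p) - log 2 (t * p)"
      using trace_mult_log_scaled[OF \<rho> p, of 1] trace_mult_log_scaled[OF \<rho> p t] by simp
    finally show ?thesis using p t by (simp add: log_mult)
  qed
  ultimately show ?thesis by (simp add: relative_entropy_def)
qed

text \<open>Flatness evaluates the first term of the relative entropy exactly as log p, and Jensen's
  inequality bounds the second by the logarithm of the overlap. Without inclusion of supports the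
  value is infinite.\<close>

lemma relative_entropy_ge:
  assumes \<rho>: "positive_semidefinite d \<rho>" "mat_trace \<rho> = 1" and \<sigma>: "positive_semidefinite d \<sigma>"
    and p: "\<rho> * \<rho> = complex_of_real p \<cdot>\<^sub>m \<rho>" "0 < p"
    and b: "Re (mat_trace (\<rho> * \<sigma>)) \<le> b"
  shows "ereal (log 2 p - log 2 b) \<le> relative_entropy \<rho> \<sigma>"
proof (cases "mat_support \<rho> \<subseteq> mat_support \<sigma>")
  case True
  have c: "\<rho> \<in> carrier_mat d d" "\<sigma> \<in> carrier_mat d d" using \<rho> \<sigma> psd_carrier by auto
  have h: "mat_adjoint \<rho> = \<rho>" "mat_adjoint \<sigma> = \<sigma>" using \<rho> \<sigma> psd_hermitian by auto
  note J = trace_mult_log_le[OF \<rho> \<sigma> True]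
  have "Re (mat_trace (\<rho> * mat_log2 \<sigma>)) \<le> log 2 b"
    using J b by (smt (verit) log_le_cancel_iff)
  moreover have "Re (mat_trace (\<rho> * mat_log2 \<rho>)) = log 2 p"
    using trace_mult_log_scaled[OF c(1) h(1) \<rho>(2) p, of 1] by simp
  moreover have "mat_trace (\<rho> * mat_log2 \<rho> - \<rho> * mat_log2 \<sigma>) = mat_trace (\<rho> * mat_log2 \<rho>) - mat_trace (\<rho> * mat_log2 \<sigma>)"
    using c h by (intro mat_trace_minus[of _ d] mult_carrier_square mat_log2_carrier)
  ultimately show ?thesis using True by (simp add: relative_entropy_def)
qed (simp add: relative_entropy_def)

section \<open>Entanglement distillation\<close>

lemma ppt_operationD:
  assumes "ppt_operation dA dB dA' dB' \<Lambda>"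
  shows "\<And>X. X \<in> carrier_mat (dA * dB) (dA * dB) \<Longrightarrow> \<Lambda> X \<in> carrier_mat (dA' * dB') (dA' * dB')"
    and "trace_preserving (dA * dB) \<Lambda>"
    and "completely_positive (dA * dB) (dA' * dB') (partial_transpose dA' dB' \<circ> \<Lambda> \<circ> partial_transpose dA dB)"
  using assms by (auto simp: ppt_operation_def completely_positive_def linear_superoperator_def)

lemma Re_trace_mult_mono:
  assumes "positive_semidefinite d A" "positive_semidefinite d (C - B)"
    and "B \<in> carrier_mat d d" "C \<in> carrier_mat d d"
  shows "Re (mat_trace (A * B)) \<le> Re (mat_trace (A * C))"
proof -
  have A: "A \<in> carrier_mat d d" using assms psd_carrier by auto
  have "mat_trace (A * (C - B)) = mat_trace (A * C) - mat_trace (A * B)"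
    using A assms by (simp add: mult_minus_distrib_mat[of _ d d _ d] mat_trace_minus[of _ d])
  then show ?thesis
    using trace_mult_psd_ge0[OF assms(1,2)] by (simp add: less_eq_complex_def)
qed

text \<open>
  The conjugated map \<open>T \<circ> \<Lambda> \<circ> T\<close> is positive and trace preserving, so it does not increase the
  trace of the parts \<open>(G \<plusminus> \<rho>\<^sup>T) / 2\<close> into which the partial transpose splits.
\<close>

lemma ppt_overlap_bound:
  assumes ppt: "ppt_operation dA dB dA' dB' \<Lambda>"
    and \<rho>: "\<rho> \<in> carrier_mat (dA * dB) (dA * dB)"
    and G: "dominates (dA * dB) G (partial_transpose dA dB \<rho>)"
    and F: "dominates (dA' * dB') (1\<^sub>m (dA' * dB')) F"
  shows "Re (mat_trace (\<Lambda> \<rho> * partial_transpose dA' dB' F)) \<le> Re (mat_trace G)"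
proof -
  let ?d = "dA * dB" and ?d' = "dA' * dB'"
  let ?X = "partial_transpose dA dB \<rho>"
  define N where "N = partial_transpose dA' dB' \<circ> \<Lambda> \<circ> partial_transpose dA dB"
  note D = ppt_operationD[OF ppt]
  have cp: "completely_positive ?d ?d' N" using D(3) by (simp add: N_def)
  have Nc: "N Y \<in> carrier_mat ?d' ?d'" for Y by (simp add: N_def)
  have Gc: "G \<in> carrier_mat ?d ?d" "?X \<in> carrier_mat ?d ?d" and Gp: "positive_semidefinite ?d (G + ?X)"
    "positive_semidefinite ?d (G - ?X)" using G by (simp_all add: dominates_def)
  have Fc: "F \<in> carrier_mat ?d' ?d'" and Fp: "positive_semidefinite ?d' (1\<^sub>m ?d' + F)"
    "positive_semidefinite ?d' (1\<^sub>m ?d' - F)" using F by (simp_all add: dominates_def)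
  have Ntr: "mat_trace (N Y) = mat_trace Y" if "Y \<in> carrier_mat ?d ?d" for Y
    using D(1,2) that by (simp add: N_def trace_preserving_def)
  have Nadd: "N (Y + Z) = N Y + N Z" if "Y \<in> carrier_mat ?d ?d" "Z \<in> carrier_mat ?d ?d" for Y Z
    using cp that by (auto simp: completely_positive_def linear_superoperator_def)
  have trF: "mat_trace ((A + B) * F) = mat_trace (A * F) + mat_trace (B * F)"
    if "A \<in> carrier_mat ?d' ?d'" "B \<in> carrier_mat ?d' ?d'" for A B
    using that Fc by (simp add: add_mult_distrib_mat[of _ ?d' ?d' _ _ ?d'] mat_trace_add[of _ ?d'])
  have le: "Re (mat_trace (N Y * F)) \<le> Re (mat_trace Y)" "- Re (mat_trace (N Y * F)) \<le> Re (mat_trace Y)"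
    if Y: "positive_semidefinite ?d Y" for Y
  proof -
    have NY: "positive_semidefinite ?d' (N Y)" by (rule completely_positive_psd[OF cp Y])
    show "Re (mat_trace (N Y * F)) \<le> Re (mat_trace Y)"
      using Re_trace_mult_mono[OF NY Fp(2) Fc one_carrier_mat] Nc[of Y] Ntr[OF psd_carrier[OF Y]] by simp
    have "0 \<le> Re (mat_trace (N Y * (1\<^sub>m ?d' + F)))"
      using trace_mult_psd_ge0[OF NY Fp(1)] by (simp add: less_eq_complex_def)
    also have "mat_trace (N Y * (1\<^sub>m ?d' + F)) = mat_trace (N Y) + mat_trace (N Y * F)"
      using Nc[of Y] Fc by (simp add: mult_add_distrib_mat[of _ ?d' ?d' _ ?d'] mat_trace_add[of _ ?d'])
    finally show "- Re (mat_trace (N Y * F)) \<le> Re (mat_trace Y)"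
      using Ntr[OF psd_carrier[OF Y]] by simp
  qed
  \<comment> \<open>The estimates for G + X and G - X are added: the terms with N G and the traces
    of X cancel, and twice the overlap with N X is at most twice the trace of G.\<close>
  have 1: "Re (mat_trace (N G * F)) + Re (mat_trace (N ?X * F)) \<le> Re (mat_trace G) + Re (mat_trace ?X)"
    using le(1)[OF Gp(1)] unfolding Nadd[OF Gc] trF[OF Nc Nc] mat_trace_add[OF Gc] by simp
  have "G = (G - ?X) + ?X" using Gc by (intro eq_matI) auto
  then have "N G = N (G - ?X) + N ?X" using Nadd[OF psd_carrier[OF Gp(2)] Gc(2)] by simp
  then have "Re (mat_trace (N G * F)) = Re (mat_trace (N (G - ?X) * F)) + Re (mat_trace (N ?X * F))"
    using trF[OF Nc Nc] by simp
  moreover have "- Re (mat_trace (N (G - ?X) * F)) \<le> Re (mat_trace G) - Re (mat_trace ?X)"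
    using le(2)[OF Gp(2)] unfolding mat_trace_minus[OF Gc] by simp
  ultimately have 2: "Re (mat_trace (N ?X * F)) \<le> Re (mat_trace G)" using 1 by linarith
  have "mat_trace (\<Lambda> \<rho> * partial_transpose dA' dB' F) = mat_trace (partial_transpose dA' dB' (\<Lambda> \<rho>) * F)"
    by (rule trace_partial_transpose_swap[OF D(1)[OF \<rho>] Fc])
  also have "partial_transpose dA' dB' (\<Lambda> \<rho>) = N ?X"
    by (simp add: N_def partial_transpose_involutive[OF \<rho>])
  finally show ?thesis using 2 by simp
qed

text \<open>Keeps the infimum of the distillation error from running over the empty set. The map
  discards its input and prepares the maximally mixed state, which partial transposition
  fixes.\<close>

lemma ppt_operation_discard: "0 < dA' * dB' \<Longrightarrow> \<exists>\<Lambda>. ppt_operation dA dB dA' dB' \<Lambda>"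
proof -
  assume pos: "0 < dA' * dB'"
  let ?d = "dA * dB" and ?d' = "dA' * dB'"
  define S where "S = complex_of_real (1 / real ?d') \<cdot>\<^sub>m 1\<^sub>m ?d'"
  define f where "f X = mat_trace (1\<^sub>m ?d * X) \<cdot>\<^sub>m S" for X
  have S: "positive_semidefinite ?d' S" unfolding S_def by (intro psd_smult psd_one) simp
  have Sc: "S \<in> carrier_mat ?d' ?d'" by (simp add: S_def)
  have cp: "completely_positive ?d ?d' f"
    unfolding f_def by (rule completely_positive_measure_prepare[OF psd_one S])
  have PS: "partial_transpose dA' dB' S = S"
    by (simp add: S_def partial_transpose_smult)
  have "completely_positive ?d ?d' (partial_transpose dA' dB' \<circ> f \<circ> partial_transpose dA dB)"
    by (rule completely_positive_cong[OF cp]) (simp add: f_def partial_transpose_smult[OF Sc] PS)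
  moreover have "trace_preserving ?d f"
    using pos Sc unfolding trace_preserving_def f_def
    by (simp add: mat_trace_smult[of _ ?d'] S_def)
  ultimately show ?thesis using cp by (auto simp: ppt_operation_def)
qed

text \<open>
  With \<open>K = 2 ^ m\<close>, the swap operator and \<open>\<Phi>\<^sup>T = swap / K\<close>, the conjugated map is a
  measurement of \<open>(1 + K R\<^sup>T) / (K (K + 1))\<close> and \<open>(1 - K R\<^sup>T) / (K (K - 1))\<close> followed by the
  preparation of the projections onto the symmetric and the antisymmetric subspace; this is where
  \<open>-1 / K \<le> R\<^sup>T \<le> 1 / K\<close> enters.
\<close>

lemma ppt_distillation:
  assumes R: "positive_semidefinite (dA * dB) R" "positive_semidefinite (dA * dB) (1\<^sub>m (dA * dB) - R)"
    and dom: "dominates (dA * dB) (complex_of_real c \<cdot>\<^sub>m 1\<^sub>m (dA * dB)) (partial_transpose dA dB R)"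
    and c: "2 ^ m * c \<le> 1" and m: "1 \<le> m"
  obtains \<Lambda> where "ppt_operation dA dB (2 ^ m) (2 ^ m) \<Lambda>"
    "\<And>\<rho>. \<rho> \<in> carrier_mat (dA * dB) (dA * dB) \<Longrightarrow> R * \<rho> = \<rho> \<Longrightarrow> mat_trace \<rho> = 1 \<Longrightarrow> \<Lambda> \<rho> = Phi_pow m"
proof -
  define d where "d = dA * dB"
  define d' :: nat where "d' = 2 ^ m * 2 ^ m"
  define K :: real where "K = 2 ^ m"
  have "(2 :: real) ^ 1 \<le> 2 ^ m" using m by (intro power_increasing) auto
  \<comment> \<open>The failure state and the second measurement operator have K - 1 in their
    denominators, so m = 0 is excluded.\<close>
  then have K: "2 \<le> K" by (simp add: K_def)
  have Rc: "R \<in> carrier_mat d d" using R psd_carrier by (simp add: d_def)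
  note R = R[folded d_def]
  define P where "P = Phi_pow m"
  define F where "F = swap_pow m"
  have Pc: "P \<in> carrier_mat d' d'" and Fc: "F \<in> carrier_mat d' d'" by (simp_all add: P_def F_def d'_def)
  have Ppsd: "positive_semidefinite d' P" "positive_semidefinite d' (1\<^sub>m d' - P)"
    using Phi_pow_props(4) psd_one_diff_Phi_pow by (simp_all only: P_def d'_def)
  have Fpsd: "positive_semidefinite d' (1\<^sub>m d' + F)" "positive_semidefinite d' (1\<^sub>m d' - F)"
    using dominates_one_swap_pow[of m] by (simp_all only: dominates_def F_def d'_def)
  let ?PT = "partial_transpose dA dB" and ?PT' = "partial_transpose (2 ^ m) (2 ^ m)"
  have PTP: "?PT' P = complex_of_real (1 / K) \<cdot>\<^sub>m F"
    unfolding P_def F_def Phi_pow_props(5) by (simp add: K_def power_one_over)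
  \<comment> \<open>On failure the map prepares the maximally mixed state on the complement of
    \<open>P\<close>, which has rank K^2 - 1. All outputs then lie in the span of 1 and P, and their
    partial transposes in the span of 1 and the swap.\<close>
  define Q where "Q = complex_of_real (1 / ((K - 1) * (K + 1))) \<cdot>\<^sub>m (1\<^sub>m d' - P)"
  have Qc: "Q \<in> carrier_mat d' d'" using Pc by (simp add: Q_def minus_carrier_mat)
  have Qpsd: "positive_semidefinite d' Q" unfolding Q_def by (intro psd_smult Ppsd) (use K in simp)
  have Qtr: "mat_trace Q = 1"
  proof -
    have "mat_trace Q = complex_of_real (1 / ((K - 1) * (K + 1))) * (of_nat d' - mat_trace P)"
      using Pc by (simp add: Q_def mat_trace_smult[of _ d'] mat_trace_minus[of _ d'] minus_carrier_mat)
    also have "of_nat d' - mat_trace P = complex_of_real ((K - 1) * (K + 1))"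
      unfolding P_def Phi_pow_props(3) by (simp add: d'_def K_def algebra_simps)
    also have "complex_of_real (1 / ((K - 1) * (K + 1))) * complex_of_real ((K - 1) * (K + 1)) = 1"
      unfolding of_real_mult[symmetric] using K by (simp del: of_real_mult)
    finally show ?thesis .
  qed
  define \<Lambda> where "\<Lambda> X = mat_trace (R * X) \<cdot>\<^sub>m P + mat_trace ((1\<^sub>m d - R) * X) \<cdot>\<^sub>m Q" for X
  have tr_compl: "mat_trace ((1\<^sub>m d - R) * X) = mat_trace X - mat_trace (R * X)" if "X \<in> carrier_mat d d" for X
    using that Rc by (simp add: minus_mult_distrib_mat[of _ d d _ _ d] mat_trace_minus[of _ d])
  have cp: "completely_positive d d' \<Lambda>"
    unfolding \<Lambda>_def by (intro completely_positive_add completely_positive_measure_prepare R Ppsd Qpsd)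
  have tp: "trace_preserving d \<Lambda>"
    unfolding trace_preserving_def \<Lambda>_def
  proof
    fix X :: "complex mat" assume X: "X \<in> carrier_mat d d"
    have "mat_trace P = 1" by (simp add: P_def Phi_pow_props(3))
    then show "mat_trace (mat_trace (R * X) \<cdot>\<^sub>m P + mat_trace ((1\<^sub>m d - R) * X) \<cdot>\<^sub>m Q) = mat_trace X"
      using Pc Qc by (simp add: mat_trace_add[of _ d'] mat_trace_smult[of _ d'] Qtr tr_compl[OF X])
  qed
  define R' where "R' = ?PT R"
  have R'c: "R' \<in> carrier_mat d d" by (simp add: R'_def d_def)
  define E1 where "E1 = complex_of_real (1 / (K * (K + 1))) \<cdot>\<^sub>m (1\<^sub>m d + complex_of_real K \<cdot>\<^sub>m R')"
  define E2 where "E2 = complex_of_real (1 / (K * (K - 1))) \<cdot>\<^sub>m (1\<^sub>m d - complex_of_real K \<cdot>\<^sub>m R')"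
  define S1 where "S1 = complex_of_real (1 / 2) \<cdot>\<^sub>m (1\<^sub>m d' + F)"
  define S2 where "S2 = complex_of_real (1 / 2) \<cdot>\<^sub>m (1\<^sub>m d' - F)"
  have S: "positive_semidefinite d' S1" "positive_semidefinite d' S2"
    unfolding S1_def S2_def by (intro psd_smult Fpsd; simp)+
  have domp: "positive_semidefinite d (complex_of_real c \<cdot>\<^sub>m 1\<^sub>m d + R')"
    "positive_semidefinite d (complex_of_real c \<cdot>\<^sub>m 1\<^sub>m d - R')"
    using dom by (simp_all only: dominates_def d_def R'_def)
  \<comment> \<open>The slack 1 - K c turns the bound by c into one by 1 / K: adding that multiple
    of the identity to K (c + R') gives 1 + K R', and likewise with the other sign.\<close>
  have Kc: "0 \<le> 1 - K * c" "0 \<le> K" using c K by (simp_all add: K_def)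
  have "1\<^sub>m d + complex_of_real K \<cdot>\<^sub>m R' = complex_of_real K \<cdot>\<^sub>m (complex_of_real c \<cdot>\<^sub>m 1\<^sub>m d + R') + complex_of_real (1 - K * c) \<cdot>\<^sub>m 1\<^sub>m d"
    using R'c by (intro eq_matI) (auto simp: algebra_simps)
  then have "positive_semidefinite d (1\<^sub>m d + complex_of_real K \<cdot>\<^sub>m R')"
    using psd_add[OF psd_smult[OF domp(1) Kc(2)] psd_smult[OF psd_one Kc(1)]] by simp
  then have E1: "positive_semidefinite d E1" unfolding E1_def by (rule psd_smult) (use K in simp)
  have "1\<^sub>m d - complex_of_real K \<cdot>\<^sub>m R' = complex_of_real K \<cdot>\<^sub>m (complex_of_real c \<cdot>\<^sub>m 1\<^sub>m d - R') + complex_of_real (1 - K * c) \<cdot>\<^sub>m 1\<^sub>m d"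
    using R'c by (intro eq_matI) (auto simp: algebra_simps)
  then have "positive_semidefinite d (1\<^sub>m d - complex_of_real K \<cdot>\<^sub>m R')"
    using psd_add[OF psd_smult[OF domp(2) Kc(2)] psd_smult[OF psd_one Kc(1)]] by simp
  then have E2: "positive_semidefinite d E2" unfolding E2_def by (rule psd_smult) (use K in simp)
  \<comment> \<open>The identity of the two forms of the conjugated map, read at one matrix entry: e
    and f are the entries of 1 and of the swap, s = Tr X and t = Tr (R' X). It is verified after
    multiplication by the common denominator 2 k (k - 1) (k + 1).\<close>
  have scalar: "t * (f / k) + (s - t) * ((e - f / k) / ((k - 1) * (k + 1)))
      = (s + k * t) / (k * (k + 1)) * ((e + f) / 2) + (s - k * t) / (k * (k - 1)) * ((e - f) / 2)"
    if "k \<noteq> 0" "k - 1 \<noteq> 0" "k + 1 \<noteq> 0" for t f s e k :: complex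
  proof -
    define D where "D = 2 * k * ((k - 1) * (k + 1))"
    have D: "D \<noteq> 0" using that by (simp add: D_def)
    have "(t * (f / k) + (s - t) * ((e - f / k) / ((k - 1) * (k + 1)))) * D
        = 2 * t * f * ((k - 1) * (k + 1)) + 2 * (s - t) * (e * k - f)"
    proof -
      have "t * (f / k) * D = 2 * t * f * ((k - 1) * (k + 1))"
        unfolding D_def using that(1) by simp
      moreover have "(s - t) * ((e - f / k) / x) * (2 * k * x) = 2 * (s - t) * (e * k - f)" if "x \<noteq> 0" for x
        using that \<open>k \<noteq> 0\<close> by (simp add: field_simps)
      ultimately show ?thesis using that(2,3) unfolding D_def distrib_right by (metis no_zero_divisors)
    qed
    also have "\<dots> = (s + k * t) * (e + f) * (k - 1) + (s - k * t) * (e - f) * (k + 1)"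
      by (simp add: algebra_simps)
    also have "\<dots> = ((s + k * t) / (k * (k + 1)) * ((e + f) / 2) + (s - k * t) / (k * (k - 1)) * ((e - f) / 2)) * D"
    proof -
      have "(s + k * t) / (k * x) * ((e + f) / 2) * (2 * k * (y * x)) = (s + k * t) * (e + f) * y"
        "(s - k * t) / (k * x) * ((e - f) / 2) * (2 * k * (x * y)) = (s - k * t) * (e - f) * y" if "x \<noteq> 0" for x y
        using that \<open>k \<noteq> 0\<close> by simp_all
      then show ?thesis using that(2,3) unfolding D_def distrib_right by metis
    qed
    finally show ?thesis using D by simp
  qed
  have knz: "complex_of_real K \<noteq> 0" "complex_of_real K - 1 \<noteq> 0" "complex_of_real K + 1 \<noteq> 0"
  proof -
    have "complex_of_real K - 1 = complex_of_real (K - 1)" "complex_of_real K + 1 = complex_of_real (K + 1)" by simp_all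
    then show "complex_of_real K \<noteq> 0" "complex_of_real K - 1 \<noteq> 0" "complex_of_real K + 1 \<noteq> 0"
      using K by (simp_all only: of_real_eq_0_iff)
  qed
  have "completely_positive d d' (?PT' \<circ> \<Lambda> \<circ> ?PT)"
  proof (rule completely_positive_cong)
    show "completely_positive d d' (\<lambda>X. mat_trace (E1 * X) \<cdot>\<^sub>m S1 + mat_trace (E2 * X) \<cdot>\<^sub>m S2)"
      by (intro completely_positive_add completely_positive_measure_prepare E1 E2 S)
    fix X :: "complex mat" assume X: "X \<in> carrier_mat d d"
    define s where "s = mat_trace X"
    define t where "t = mat_trace (R' * X)"
    have PTX: "?PT X \<in> carrier_mat d d" by (simp add: d_def)
    have t: "mat_trace (R * ?PT X) = t"
      unfolding t_def R'_def by (rule trace_partial_transpose_swap) (use Rc X in \<open>simp_all add: d_def\<close>)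
    have s: "mat_trace (?PT X) = s" unfolding s_def by (rule partial_transpose_trace) (use X in \<open>simp add: d_def\<close>)
    have e1: "mat_trace (E1 * X) = (s + complex_of_real K * t) / (complex_of_real K * (complex_of_real K + 1))"
      using X R'c unfolding E1_def s_def t_def
      by (simp add: mult_smult_assoc_mat[of _ d d _ d] add_mult_distrib_mat[of _ d d _ _ d]
          mat_trace_smult[of _ d] mat_trace_add[of _ d])
    have e2: "mat_trace (E2 * X) = (s - complex_of_real K * t) / (complex_of_real K * (complex_of_real K - 1))"
      using X R'c unfolding E2_def s_def t_def
      by (simp add: mult_smult_assoc_mat[of _ d d _ d] minus_mult_distrib_mat[of _ d d _ _ d]
          mat_trace_smult[of _ d] mat_trace_minus[of _ d] minus_carrier_mat)
    have PTQ: "?PT' Q = complex_of_real (1 / ((K - 1) * (K + 1))) \<cdot>\<^sub>m (1\<^sub>m d' - complex_of_real (1 / K) \<cdot>\<^sub>m F)"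
    proof -
      have "?PT' (1\<^sub>m d' - P) = 1\<^sub>m d' - complex_of_real (1 / K) \<cdot>\<^sub>m F"
        using partial_transpose_minus[of "1\<^sub>m d'" "2 ^ m" "2 ^ m" P] Pc partial_transpose_one[of "2 ^ m" "2 ^ m"] PTP
        by (simp only: d'_def one_carrier_mat)
      then show ?thesis
        unfolding Q_def using partial_transpose_smult[of "1\<^sub>m d' - P" "2 ^ m" "2 ^ m"] Pc
        by (simp only: d'_def minus_carrier_mat)
    qed
    have "(?PT' \<circ> \<Lambda> \<circ> ?PT) X = ?PT' (t \<cdot>\<^sub>m P + (s - t) \<cdot>\<^sub>m Q)"
      by (simp add: \<Lambda>_def tr_compl[OF PTX] t s)
    also have "\<dots> = t \<cdot>\<^sub>m ?PT' P + (s - t) \<cdot>\<^sub>m ?PT' Q"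
      using Pc Qc unfolding d'_def by (simp only: partial_transpose_add partial_transpose_smult smult_carrier_mat)
    also have "\<dots> = mat_trace (E1 * X) \<cdot>\<^sub>m S1 + mat_trace (E2 * X) \<cdot>\<^sub>m S2"
    proof (rule eq_matI)
      fix i j
      assume "i < dim_row (mat_trace (E1 * X) \<cdot>\<^sub>m S1 + mat_trace (E2 * X) \<cdot>\<^sub>m S2)"
        "j < dim_col (mat_trace (E1 * X) \<cdot>\<^sub>m S1 + mat_trace (E2 * X) \<cdot>\<^sub>m S2)"
      then have ij: "i < d'" "j < d'" using Fc by (simp_all add: S2_def)
      show "(t \<cdot>\<^sub>m ?PT' P + (s - t) \<cdot>\<^sub>m ?PT' Q) $$ (i, j) = (mat_trace (E1 * X) \<cdot>\<^sub>m S1 + mat_trace (E2 * X) \<cdot>\<^sub>m S2) $$ (i, j)"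
        using scalar[OF knz, of t "F $$ (i, j)" s "1\<^sub>m d' $$ (i, j)"] ij Fc
        unfolding PTP PTQ e1 e2 S1_def S2_def by (simp del: index_one_mat(1))
    qed (use Fc in \<open>simp_all add: PTP PTQ S2_def\<close>)
    finally show "(?PT' \<circ> \<Lambda> \<circ> ?PT) X = mat_trace (E1 * X) \<cdot>\<^sub>m S1 + mat_trace (E2 * X) \<cdot>\<^sub>m S2" .
  qed
  then have "ppt_operation dA dB (2 ^ m) (2 ^ m) \<Lambda>"
    using cp tp by (simp only: ppt_operation_def d_def d'_def simp_thms)
  moreover have "\<Lambda> \<rho> = Phi_pow m" if "\<rho> \<in> carrier_mat (dA * dB) (dA * dB)" "R * \<rho> = \<rho>" "mat_trace \<rho> = 1" for \<rho>
  proof -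
    have "\<rho> \<in> carrier_mat d d" using that by (simp add: d_def)
    then have "\<Lambda> \<rho> = P" using that Pc Qc by (intro eq_matI) (auto simp: \<Lambda>_def tr_compl)
    then show ?thesis by (simp add: P_def)
  qed
  ultimately show ?thesis by (rule that)
qed

section \<open>The antisymmetric state\<close>

text \<open>The operator R of the overview in these coordinates: e - w = 1 is its eigenvalue on the
  antisymmetric vectors, and e + w = 3 - 2 sqrt 2 the one on their symmetric partners.\<close>

definition test_op :: "complex mat" where
  "test_op = sym_mat (2 - sqrt 2) (1 - sqrt 2) 0 0 0"

text \<open>The modulus of the partial transpose of \<open>\<rho>\<^sub>v\<close>.\<close>

definition modulus_op :: "complex mat" where
  "modulus_op = sym_mat (1 / 4) 0 0 (sqrt 2 / 4) 0"

lemma sqrt2_bounds: "1 \<le> sqrt 2" "sqrt 2 \<le> 3 / 2"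
  by (simp, rule real_le_lsqrt) (simp_all add: power2_eq_square)

lemma rho_v_carrier [simp]: "rho_v \<in> carrier_mat (3 * 3) (3 * 3)"
  by (simp add: rho_v_eq)

lemma test_op_carrier [simp]: "test_op \<in> carrier_mat (3 * 3) (3 * 3)"
  by (simp add: test_op_def)

lemma modulus_op_carrier [simp]: "modulus_op \<in> carrier_mat (3 * 3) (3 * 3)"
  by (simp add: modulus_op_def)

lemma psd_rho_v: "positive_semidefinite (3 * 3) rho_v"
  using psd_sym_mat[of "- 1 / 4" "1 / 4" 0 0 0] by (simp add: rho_v_eq)

lemma rho_v_trace: "mat_trace rho_v = 1"
  by (simp add: rho_v_eq sym_mat_trace)

lemma rho_v_square: "rho_v * rho_v = complex_of_real (1 / 2) \<cdot>\<^sub>m rho_v"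
  unfolding rho_v_eq sym_mat_mult sym_mat_smult by simp

lemma test_op_rho_v: "test_op * rho_v = rho_v"
proof -
  have eq: "(2 - sqrt 2) * (1 / 4) + (1 - sqrt 2) * (- 1 / 4) = 1 / 4"
    "(2 - sqrt 2) * (- 1 / 4) + (1 - sqrt 2) * (1 / 4) = - 1 / 4" by (simp_all add: field_simps)
  show ?thesis unfolding rho_v_eq test_op_def sym_mat_mult eq by simp
qed

lemma psd_test_op_minus: "positive_semidefinite (3 * 3) (test_op - complex_of_real 2 \<cdot>\<^sub>m rho_v)"
proof -
  have "test_op - complex_of_real 2 \<cdot>\<^sub>m rho_v = sym_mat (3 / 2 - sqrt 2) (3 / 2 - sqrt 2) 0 0 0"
    unfolding test_op_def rho_v_eq sym_mat_smult sym_mat_minus by simp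
  then show ?thesis using psd_sym_mat[of "3 / 2 - sqrt 2" "3 / 2 - sqrt 2" 0 0 0] sqrt2_bounds by simp
qed

lemma psd_test_op: "positive_semidefinite (3 * 3) test_op"
proof -
  have "\<bar>1 - sqrt 2\<bar> \<le> 2 - sqrt 2" using sqrt2_bounds by linarith
  then show ?thesis using psd_sym_mat[of "1 - sqrt 2" "2 - sqrt 2" 0 0 0] by (simp add: test_op_def)
qed

lemma psd_one_minus_test_op: "positive_semidefinite (3 * 3) (1\<^sub>m (3 * 3) - test_op)"
proof -
  have "1\<^sub>m (3 * 3) - test_op = sym_mat (sqrt 2 - 1) (sqrt 2 - 1) 0 1 1"
    by (simp add: test_op_def sym_mat_one sym_mat_minus)
  then show ?thesis using psd_sym_mat[of "sqrt 2 - 1" "sqrt 2 - 1" 0 1 1] by simp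
qed

lemma dominates_test_op:
  "dominates (3 * 3) (complex_of_real (2 - sqrt 2) \<cdot>\<^sub>m 1\<^sub>m (3 * 3)) (partial_transpose 3 3 test_op)"
proof -
  let ?a = "2 - sqrt 2"
  have I: "complex_of_real ?a \<cdot>\<^sub>m 1\<^sub>m 9 = sym_mat ?a 0 0 ?a ?a"
    unfolding sym_mat_one sym_mat_smult by simp
  \<comment> \<open>The balance that fixes the constants: sqrt 2 (sqrt 2 - 1) = 2 - sqrt 2. The
    upper bound is therefore attained both on the four vectors of the swap block and on the range of
    V.\<close>
  have b: "sqrt 2 * \<bar>1 - sqrt 2\<bar> \<le> ?a" "0 \<le> ?a" using sqrt2_bounds by (simp_all add: abs_if algebra_simps)
  have "positive_semidefinite 9 (sym_mat (?a + ?a) 0 (1 - sqrt 2) ?a ?a)"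
    "positive_semidefinite 9 (sym_mat 0 0 (- (1 - sqrt 2)) ?a ?a)"
    using b by (intro psd_sym_mat; simp add: abs_minus_commute)+
  moreover have "complex_of_real ?a \<cdot>\<^sub>m 1\<^sub>m 9 + sym_mat ?a 0 (1 - sqrt 2) 0 0 = sym_mat (?a + ?a) 0 (1 - sqrt 2) ?a ?a"
    "complex_of_real ?a \<cdot>\<^sub>m 1\<^sub>m 9 - sym_mat ?a 0 (1 - sqrt 2) 0 0 = sym_mat 0 0 (- (1 - sqrt 2)) ?a ?a"
    unfolding I sym_mat_add sym_mat_minus by simp_all
  ultimately have "dominates 9 (complex_of_real ?a \<cdot>\<^sub>m 1\<^sub>m 9) (sym_mat ?a 0 (1 - sqrt 2) 0 0)"
    by (simp only: dominates_def sym_mat_carrier smult_carrier_mat[OF one_carrier_mat] simp_thms)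
  then show ?thesis
    by (simp add: test_op_def sym_mat_partial_transpose)
qed

lemma partial_transpose_rho_v: "partial_transpose 3 3 rho_v = sym_mat (1 / 4) 0 (- 1 / 4) 0 0"
  by (simp add: rho_v_eq sym_mat_partial_transpose)

lemma dominates_modulus_op: "dominates (3 * 3) modulus_op (partial_transpose 3 3 rho_v)"
proof -
  have "positive_semidefinite 9 (sym_mat (1 / 2) 0 (- 1 / 4) (sqrt 2 / 4) 0)"
    "positive_semidefinite 9 (sym_mat 0 0 (1 / 4) (sqrt 2 / 4) 0)"
    by (intro psd_sym_mat; simp)+
  then show ?thesis
    by (simp add: dominates_def partial_transpose_rho_v modulus_op_def sym_mat_add sym_mat_minus)
qed

lemma modulus_op_trace: "mat_trace modulus_op = complex_of_real (1 + 1 / sqrt 2)"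
proof -
  have "4 * (1 / 4) + 2 * (sqrt 2 / 4) + 3 * 0 = 1 + 1 / sqrt 2" by (simp add: field_simps)
  then show ?thesis unfolding modulus_op_def sym_mat_trace by (rule arg_cong)
qed

text \<open>The scaled \<open>modulus_op\<close> is the positive root of the square of the partial
  transpose, because (sqrt 2 / 4)^2 = 2 (1 / 4)^2 on the range of V.\<close>

lemma trace_norm_scaled_rho_v:
  assumes "0 \<le> t"
  shows "trace_norm (partial_transpose 3 3 (complex_of_real t \<cdot>\<^sub>m rho_v)) = t * (1 + 1 / sqrt 2)"
proof -
  have X: "partial_transpose 3 3 (complex_of_real t \<cdot>\<^sub>m rho_v) = complex_of_real t \<cdot>\<^sub>m sym_mat (1 / 4) 0 (- 1 / 4) 0 0"
    unfolding partial_transpose_smult[OF rho_v_carrier] partial_transpose_rho_v ..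
  have "positive_semidefinite 9 (complex_of_real t \<cdot>\<^sub>m modulus_op)"
    unfolding modulus_op_def by (intro psd_smult psd_sym_mat assms) simp_all
  moreover have "(complex_of_real t \<cdot>\<^sub>m modulus_op) * (complex_of_real t \<cdot>\<^sub>m modulus_op)
    = mat_adjoint (complex_of_real t \<cdot>\<^sub>m sym_mat (1 / 4) 0 (- 1 / 4) 0 0) * (complex_of_real t \<cdot>\<^sub>m sym_mat (1 / 4) 0 (- 1 / 4) 0 0)"
    unfolding modulus_op_def sym_mat_smult sym_mat_adjoint sym_mat_mult by (simp add: field_simps)
  ultimately have "trace_norm (partial_transpose 3 3 (complex_of_real t \<cdot>\<^sub>m rho_v)) = Re (mat_trace (complex_of_real t \<cdot>\<^sub>m modulus_op))"
    unfolding X by (intro trace_norm_eq_trace[of _ 9]) simp_all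
  also have "mat_trace (complex_of_real t \<cdot>\<^sub>m modulus_op) = complex_of_real (t * (1 + 1 / sqrt 2))"
    using mat_trace_smult[OF modulus_op_carrier] by (simp add: modulus_op_trace)
  finally show ?thesis by simp
qed

lemma kappa_inverse: "(2 - sqrt 2) * (1 + 1 / sqrt 2) = 1"
  by (simp add: field_simps)

abbreviation rho_pow :: "nat \<Rightarrow> complex mat" where
  "rho_pow n \<equiv> bipartite_power 3 3 rho_v n"

lemma rho_pow_props:
  "mat_trace (rho_pow n) = 1" "positive_semidefinite (3 ^ n * 3 ^ n) (rho_pow n)"
  "rho_pow n * rho_pow n = complex_of_real ((1 / 2) ^ n) \<cdot>\<^sub>m rho_pow n"
proof -
  show "mat_trace (rho_pow n) = 1"
    using bipartite_power_trace[OF rho_v_carrier] by (simp add: rho_v_trace)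
  show "positive_semidefinite (3 ^ n * 3 ^ n) (rho_pow n)"
    by (rule psd_bipartite_power[OF psd_rho_v])
  show "rho_pow n * rho_pow n = complex_of_real ((1 / 2) ^ n) \<cdot>\<^sub>m rho_pow n"
    unfolding bipartite_power_mult[OF rho_v_carrier rho_v_carrier] rho_v_square
      bipartite_power_smult[OF rho_v_carrier] by simp
qed

lemma test_op_power:
  "bipartite_power 3 3 test_op n * rho_pow n = rho_pow n"
  "positive_semidefinite (3 ^ n * 3 ^ n) (bipartite_power 3 3 test_op n)"
  "positive_semidefinite (3 ^ n * 3 ^ n) (1\<^sub>m (3 ^ n * 3 ^ n) - bipartite_power 3 3 test_op n)"
  "positive_semidefinite (3 ^ n * 3 ^ n) (bipartite_power 3 3 test_op n - complex_of_real (2 ^ n) \<cdot>\<^sub>m rho_pow n)"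
  "dominates (3 ^ n * 3 ^ n) (complex_of_real ((2 - sqrt 2) ^ n) \<cdot>\<^sub>m 1\<^sub>m (3 ^ n * 3 ^ n))
     (partial_transpose (3 ^ n) (3 ^ n) (bipartite_power 3 3 test_op n))"
proof -
  show "bipartite_power 3 3 test_op n * rho_pow n = rho_pow n"
    unfolding bipartite_power_mult[OF test_op_carrier rho_v_carrier] test_op_rho_v ..
  show "positive_semidefinite (3 ^ n * 3 ^ n) (bipartite_power 3 3 test_op n)"
    by (rule psd_bipartite_power[OF psd_test_op])
  show "positive_semidefinite (3 ^ n * 3 ^ n) (1\<^sub>m (3 ^ n * 3 ^ n) - bipartite_power 3 3 test_op n)"
    using psd_power_mono[OF psd_test_op psd_one_minus_test_op one_carrier_mat, of n]
    unfolding bipartite_power_one .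
  have "positive_semidefinite (3 * 3) (complex_of_real 2 \<cdot>\<^sub>m rho_v)"
    by (rule psd_smult[OF psd_rho_v]) simp
  from psd_power_mono[OF this psd_test_op_minus test_op_carrier, of n]
  show "positive_semidefinite (3 ^ n * 3 ^ n) (bipartite_power 3 3 test_op n - complex_of_real (2 ^ n) \<cdot>\<^sub>m rho_pow n)"
    unfolding bipartite_power_smult[OF rho_v_carrier] by simp
  show "dominates (3 ^ n * 3 ^ n) (complex_of_real ((2 - sqrt 2) ^ n) \<cdot>\<^sub>m 1\<^sub>m (3 ^ n * 3 ^ n))
     (partial_transpose (3 ^ n) (3 ^ n) (bipartite_power 3 3 test_op n))"
    using dominates_power[OF dominates_test_op, of n]
    unfolding bipartite_power_smult[OF one_carrier_mat] bipartite_power_one partial_transpose_power[OF test_op_carrier]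
      of_real_power .
qed

section \<open>The Rains bound\<close>

text \<open>A single copy is enough for the upper bound, as the regularised quantity is an infimum
  over the number of copies. The factor 2 - sqrt 2 brings the trace norm of the partial transpose to
  exactly 1.\<close>

lemma rains_bound_rho_v_le: "rains_bound 3 3 rho_v \<le> ereal (log 2 (1 + 1 / sqrt 2))"
proof -
  let ?s = "complex_of_real (2 - sqrt 2) \<cdot>\<^sub>m rho_v"
  have pos: "0 < 2 - sqrt 2" using sqrt2_bounds by linarith
  have "rains_bound 3 3 rho_v \<le> relative_entropy rho_v ?s"
    unfolding rains_bound_def
  proof (intro INF_lower CollectI conjI)
    show "positive_semidefinite (3 * 3) ?s" by (rule psd_smult[OF psd_rho_v]) (use pos in simp)
    show "trace_norm (partial_transpose 3 3 ?s) \<le> 1"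
      using trace_norm_scaled_rho_v[of "2 - sqrt 2"] pos kappa_inverse by simp
  qed
  also have "\<dots> = ereal (- log 2 (2 - sqrt 2))"
    by (rule relative_entropy_scaled[OF rho_v_carrier psd_hermitian[OF psd_rho_v] rho_v_trace rho_v_square])
      (use pos in simp_all)
  also have "- log 2 (2 - sqrt 2) = log 2 (1 + 1 / sqrt 2)"
  proof -
    have "1 + 1 / sqrt 2 = inverse (2 - sqrt 2)"
      using kappa_inverse pos by (simp add: inverse_eq_divide field_simps)
    then show ?thesis using pos by (simp add: log_inverse)
  qed
  finally show ?thesis .
qed

text \<open>The overlap with a feasible \<sigma> is at most (1 / 2)^n (2 - sqrt 2)^n. Its first
  factor cancels against Tr (\<rho> log \<rho>) = -n, and the second contributes n log (1 + 1 / sqrt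
  2).\<close>

lemma rains_bound_rho_pow_ge:
  "ereal (real n * log 2 (1 + 1 / sqrt 2)) \<le> rains_bound (3 ^ n) (3 ^ n) (rho_pow n)"
  unfolding rains_bound_def
proof (rule INF_greatest, clarify)
  let ?d = "3 ^ n * 3 ^ n :: nat"
  let ?PT = "partial_transpose (3 ^ n) (3 ^ n)"
  let ?R = "bipartite_power 3 3 test_op n"
  fix \<sigma>
  assume \<sigma>: "positive_semidefinite ?d \<sigma>" and tn: "trace_norm (?PT \<sigma>) \<le> 1"
  have \<sigma>c: "\<sigma> \<in> carrier_mat ?d ?d" using \<sigma> psd_carrier by auto
  have pos: "0 < 2 - sqrt 2" using sqrt2_bounds by linarith
  note rho = rho_pow_props[of n]
  have "2 ^ n * Re (mat_trace (rho_pow n * \<sigma>)) = Re (mat_trace (\<sigma> * (complex_of_real (2 ^ n) \<cdot>\<^sub>m rho_pow n)))"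
    using mult_smult_distrib[OF \<sigma>c bipartite_power_carrier] mat_trace_comm[OF bipartite_power_carrier \<sigma>c]
      mat_trace_smult[OF mult_carrier_square[OF \<sigma>c bipartite_power_carrier]]
    by (simp del: of_real_power)
  also have "\<dots> \<le> Re (mat_trace (\<sigma> * ?R))"
    by (rule Re_trace_mult_mono[OF \<sigma> test_op_power(4)]) (simp_all del: of_real_power)
  also have "mat_trace (\<sigma> * ?R) = mat_trace (?PT ?R * ?PT \<sigma>)"
    using mat_trace_comm[OF \<sigma>c bipartite_power_carrier] trace_partial_transpose_mult[OF bipartite_power_carrier \<sigma>c] by simp
  also have "Re \<dots> \<le> cmod \<dots>" by (rule complex_Re_le_cmod)
  also have "\<dots> \<le> (2 - sqrt 2) ^ n * trace_norm (?PT \<sigma>)"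
    by (rule trace_mult_le_trace_norm[OF partial_transpose_carrier partial_transpose_carrier
          dominated_square_bound(2)[OF test_op_power(5)]]) (use pos in simp_all)
  also have "\<dots> \<le> (2 - sqrt 2) ^ n" using tn pos by (intro mult_left_le) simp_all
  finally have "Re (mat_trace (rho_pow n * \<sigma>)) \<le> (1 / 2) ^ n * (2 - sqrt 2) ^ n"
    by (simp add: field_simps)
  from relative_entropy_ge[OF rho(2,1) \<sigma> rho(3) _ this]
  have "ereal (log 2 ((1 / 2) ^ n) - log 2 ((1 / 2) ^ n * (2 - sqrt 2) ^ n)) \<le> relative_entropy (rho_pow n) \<sigma>" by simp
  moreover have "log 2 ((1 / 2) ^ n) - log 2 ((1 / 2) ^ n * (2 - sqrt 2) ^ n) = real n * log 2 (1 + 1 / sqrt 2)"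
  proof -
    have "1 + 1 / sqrt 2 = inverse (2 - sqrt 2)"
      using kappa_inverse pos by (simp add: inverse_eq_divide field_simps)
    then show ?thesis using pos by (simp add: log_inverse log_mult log_nat_power)
  qed
  ultimately show "ereal (real n * log 2 (1 + 1 / sqrt 2)) \<le> relative_entropy (rho_pow n) \<sigma>" by simp
qed

lemma regularized_rains_bound_rho_v:
  "regularized_rains_bound 3 3 rho_v = ereal (log 2 (1 + 1 / sqrt 2))"
proof (rule antisym)
  have "regularized_rains_bound 3 3 rho_v \<le> rains_bound (3 ^ 1) (3 ^ 1) (rho_pow 1) / ereal (real 1)"
    unfolding regularized_rains_bound_def by (rule INF_lower) simp
  also have "\<dots> = rains_bound 3 3 rho_v"
    unfolding bipartite_power_1[OF rho_v_carrier] by (simp add: one_ereal_def[symmetric])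
  finally show "regularized_rains_bound 3 3 rho_v \<le> ereal (log 2 (1 + 1 / sqrt 2))"
    using rains_bound_rho_v_le by simp
  show "ereal (log 2 (1 + 1 / sqrt 2)) \<le> regularized_rains_bound 3 3 rho_v"
    unfolding regularized_rains_bound_def
  proof (rule INF_greatest)
    fix n :: nat assume "n \<in> {1..}"
    then have "0 < ereal (real n)" by simp
    then show "ereal (log 2 (1 + 1 / sqrt 2)) \<le> rains_bound (3 ^ n) (3 ^ n) (rho_pow n) / ereal (real n)"
      using rains_bound_rho_pow_ge[of n] by (simp add: ereal_le_divide_pos)
  qed
qed

section \<open>Distillation rates\<close>

definition distillation_error :: "nat \<Rightarrow> nat \<Rightarrow> real" where
  "distillation_error n m = (INF \<Lambda> \<in> {\<Lambda>. ppt_operation (3 ^ n) (3 ^ n) (2 ^ m) (2 ^ m) \<Lambda>}.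
     trace_norm (\<Lambda> (rho_pow n) - Phi_pow m))"

lemma minus_Phi_pow_carrier: "X - Phi_pow m \<in> carrier_mat (2 ^ m * 2 ^ m) (2 ^ m * 2 ^ m)"
  by (rule minus_carrier_mat) simp

lemma ppt_operation_nonempty: "{\<Lambda>. ppt_operation (3 ^ n) (3 ^ n) (2 ^ m) (2 ^ m) \<Lambda>} \<noteq> {}"
  using ppt_operation_discard[of "2 ^ m" "2 ^ m"] by simp

text \<open>For the projection P onto the target, the trace norm of Y - P is at least 1 - Tr (Y P),
  by duality with P as test operator; \<open>ppt_overlap_bound\<close> limits this overlap uniformly
  over all PPT operations.\<close>

lemma distillation_error_ge:
  "1 - (1 / 2) ^ m * (1 + 1 / sqrt 2) ^ n \<le> distillation_error n m"
  unfolding distillation_error_def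
proof (rule cINF_greatest[OF ppt_operation_nonempty], clarify)
  fix \<Lambda> assume ppt: "ppt_operation (3 ^ n) (3 ^ n) (2 ^ m) (2 ^ m) \<Lambda>"
  let ?D = "2 ^ m * 2 ^ m :: nat" and ?PT = "partial_transpose (2 ^ m) (2 ^ m)"
  let ?Y = "\<Lambda> (rho_pow n)" and ?P = "Phi_pow m"
  have Y: "?Y \<in> carrier_mat ?D ?D" by (rule ppt_operationD(1)[OF ppt bipartite_power_carrier])
  have P: "?P \<in> carrier_mat ?D ?D" by simp
  have "Re (mat_trace (?Y * ?PT (swap_pow m))) \<le> Re (mat_trace (bipartite_power 3 3 modulus_op n))"
    using dominates_power[OF dominates_modulus_op, of n]
    by (intro ppt_overlap_bound[OF ppt bipartite_power_carrier _ dominates_one_swap_pow])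
      (simp only: partial_transpose_power[OF rho_v_carrier])
  also have "mat_trace (bipartite_power 3 3 modulus_op n) = complex_of_real ((1 + 1 / sqrt 2) ^ n)"
    unfolding bipartite_power_trace[OF modulus_op_carrier] modulus_op_trace of_real_power ..
  finally have "Re (mat_trace (?Y * ?PT (swap_pow m))) \<le> (1 + 1 / sqrt 2) ^ n"
    by (simp only: Re_complex_of_real)
  \<comment> \<open>The target is rewritten as 2^-m times the partial transpose of the swap, since
    the overlap bound speaks of partial transposes of operators between -1 and 1.\<close>
  moreover have "?P = complex_of_real ((1 / 2) ^ m) \<cdot>\<^sub>m ?PT (swap_pow m)"
    using arg_cong[OF Phi_pow_props(5)[of m], of ?PT] partial_transpose_involutive[OF P]
      partial_transpose_smult[OF bipartite_power_carrier] by simp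
  then have "mat_trace (?Y * ?P) = complex_of_real ((1 / 2) ^ m) * mat_trace (?Y * ?PT (swap_pow m))"
    using mult_smult_distrib[OF Y partial_transpose_carrier]
      mat_trace_smult[OF mult_carrier_square[OF Y partial_transpose_carrier]] by metis
  ultimately have overlap: "Re (mat_trace (?Y * ?P)) \<le> (1 / 2) ^ m * (1 + 1 / sqrt 2) ^ n"
    by (simp add: mult_left_mono del: of_real_power)
  have "mat_trace (?P * (?Y - ?P)) = mat_trace (?Y * ?P) - 1"
  proof -
    have "?P * (?Y - ?P) = ?P * ?Y - ?P" using mult_minus_distrib_mat[OF P Y P] Phi_pow_props(1) by simp
    then show ?thesis
      using mat_trace_minus[OF mult_carrier_square[OF P Y] P] mat_trace_comm[OF P Y] Phi_pow_props(3) by simp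
  qed
  then have "1 - Re (mat_trace (?Y * ?P)) \<le> cmod (mat_trace (?P * (?Y - ?P)))"
    using abs_Re_le_cmod[of "mat_trace (?P * (?Y - ?P))"] by simp
  also have "\<dots> \<le> 1 * trace_norm (?Y - ?P)"
  proof (rule trace_mult_le_trace_norm[OF minus_Phi_pow_carrier P])
    show "positive_semidefinite ?D (complex_of_real (1\<^sup>2) \<cdot>\<^sub>m 1\<^sub>m ?D - ?P * mat_adjoint ?P)"
      using psd_one_diff_Phi_pow[of m] by (simp only: Phi_pow_props power_one of_real_1 smult_one_mat)
  qed simp
  finally show "1 - (1 / 2) ^ m * (1 + 1 / sqrt 2) ^ n \<le> trace_norm (?Y - ?P)"
    using overlap by simp
qed

lemma trace_norm_zero: "trace_norm (0\<^sub>m d d) = 0"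
proof -
  have "0\<^sub>m d d * 0\<^sub>m d d = mat_adjoint (0\<^sub>m d d) * (0\<^sub>m d d :: complex mat)" by (intro eq_matI) auto
  then have "trace_norm (0\<^sub>m d d) = Re (mat_trace (0\<^sub>m d d))"
    by (rule trace_norm_eq_trace[OF zero_carrier_mat psd_zero])
  then show ?thesis by (simp add: mat_trace_def)
qed

text \<open>The tensor power of \<open>test_op\<close> fixes the copies of the state, so the
  operation of \<open>ppt_distillation\<close> succeeds with certainty and the infimum is attained
  with error exactly 0. The condition on m and n is the required bound 2^m (2 - sqrt 2)^n \<le> 1,
  because 2 - sqrt 2 is the inverse of 1 + 1 / sqrt 2.\<close>

lemma distillation_error_eq_0:
  assumes m: "1 \<le> m" and le: "2 ^ m \<le> (1 + 1 / sqrt 2) ^ n"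
  shows "distillation_error n m = 0"
proof -
  have pos: "0 < 2 - sqrt 2" using sqrt2_bounds by linarith
  have "2 ^ m * (2 - sqrt 2) ^ n \<le> (1 + 1 / sqrt 2) ^ n * (2 - sqrt 2) ^ n"
    using le pos by (intro mult_right_mono) simp_all
  also have "\<dots> = 1" unfolding power_mult_distrib[symmetric] using kappa_inverse by (simp add: mult.commute)
  finally have c: "2 ^ m * (2 - sqrt 2) ^ n \<le> 1" .
  obtain \<Lambda> where ppt: "ppt_operation (3 ^ n) (3 ^ n) (2 ^ m) (2 ^ m) \<Lambda>"
    and \<Lambda>: "\<And>\<rho>. \<rho> \<in> carrier_mat (3 ^ n * 3 ^ n) (3 ^ n * 3 ^ n) \<Longrightarrow> bipartite_power 3 3 test_op n * \<rho> = \<rho>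
      \<Longrightarrow> mat_trace \<rho> = 1 \<Longrightarrow> \<Lambda> \<rho> = Phi_pow m"
    using ppt_distillation[OF test_op_power(2,3,5) c m] by blast
  have "\<Lambda> (rho_pow n) = Phi_pow m"
    by (rule \<Lambda>[OF bipartite_power_carrier test_op_power(1) rho_pow_props(1)])
  then have tn: "trace_norm (\<Lambda> (rho_pow n) - Phi_pow m) = 0"
    using minus_r_inv_mat[OF bipartite_power_carrier] trace_norm_zero by metis
  show ?thesis unfolding distillation_error_def
  proof (rule antisym)
    have bdd: "bdd_below ((\<lambda>\<Lambda>. trace_norm (\<Lambda> (rho_pow n) - Phi_pow m)) `
        {\<Lambda>. ppt_operation (3 ^ n) (3 ^ n) (2 ^ m) (2 ^ m) \<Lambda>})"
      using trace_norm_ge0[OF minus_Phi_pow_carrier] by (intro bdd_belowI[of _ 0]) auto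
    show "(INF \<Lambda> \<in> {\<Lambda>. ppt_operation (3 ^ n) (3 ^ n) (2 ^ m) (2 ^ m) \<Lambda>}. trace_norm (\<Lambda> (rho_pow n) - Phi_pow m)) \<le> 0"
      using cINF_lower[OF bdd, of \<Lambda>] ppt tn by simp
    show "0 \<le> (INF \<Lambda> \<in> {\<Lambda>. ppt_operation (3 ^ n) (3 ^ n) (2 ^ m) (2 ^ m) \<Lambda>}. trace_norm (\<Lambda> (rho_pow n) - Phi_pow m))"
      using trace_norm_ge0[OF minus_Phi_pow_carrier] by (intro cINF_greatest[OF ppt_operation_nonempty]) auto
  qed
qed

theorem proposition3:
  shows "distillable_entanglement 3 3 rho_v = regularized_rains_bound 3 3 rho_v \<and>
         regularized_rains_bound 3 3 rho_v = ereal (log 2 (1 + 1 / sqrt 2))"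
proof -
  define \<kappa> :: real where "\<kappa> = 1 + 1 / sqrt 2"
  define r0 where "r0 = log 2 \<kappa>"
  have \<kappa>: "0 < \<kappa>" by (simp add: \<kappa>_def add_pos_pos)
  have powr_r0: "2 powr (r0 * real n) = \<kappa> ^ n" for n
    using \<kappa> by (simp add: r0_def powr_powr[symmetric] powr_realpow)
  \<comment> \<open>A rate of at least 1 / 2 produces at least one pair as soon as n is 2, and exact
    distillation is available only for a positive number of pairs.\<close>
  have r0: "1 / 2 \<le> r0"
  proof -
    have "1 \<le> 2 * sqrt 2" using sqrt2_bounds by linarith
    then have "2 \<le> \<kappa>\<^sup>2" by (simp add: \<kappa>_def power2_eq_square field_simps)
    then have "2 powr 1 \<le> 2 powr (r0 * real 2)" unfolding powr_r0 by simp
    then have "1 \<le> r0 * real 2" by (subst (asm) powr_le_cancel_iff) simp_all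
    then show ?thesis by simp
  qed
  let ?err = "\<lambda>r n. distillation_error n (nat \<lfloor>r * real n\<rfloor>)"
  have E: "distillable_entanglement 3 3 rho_v = Sup (ereal ` {r. 0 \<le> r \<and> ?err r \<longlonglongrightarrow> 0})"
    unfolding distillable_entanglement_def distillation_error_def Let_def ..
  have "?err r0 \<longlonglongrightarrow> 0"
  proof (rule tendsto_eventually, rule eventually_sequentiallyI)
    fix n :: nat assume n: "2 \<le> n"
    let ?m = "nat \<lfloor>r0 * real n\<rfloor>"
    have "1 / 2 * 2 \<le> r0 * real n" using r0 n by (intro mult_mono) auto
    then have m: "1 \<le> ?m" by (simp add: le_nat_floor)
    have "2 ^ ?m = 2 powr real ?m" by (simp add: powr_realpow)
    also have "\<dots> \<le> 2 powr (r0 * real n)" using r0 by (intro powr_mono) (auto simp: of_nat_floor)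
    finally have "2 ^ ?m \<le> \<kappa> ^ n" by (simp only: powr_r0)
    then show "?err r0 n = 0" unfolding \<kappa>_def by (rule distillation_error_eq_0[OF m])
  qed
  then have "r0 \<in> {r. 0 \<le> r \<and> ?err r \<longlonglongrightarrow> 0}" using r0 by simp
  then have "ereal r0 \<le> distillable_entanglement 3 3 rho_v" unfolding E by (intro Sup_upper imageI)
  moreover have "r \<le> r0" if r: "0 \<le> r" "?err r \<longlonglongrightarrow> 0" for r
  proof (rule ccontr)
    assume "\<not> r \<le> r0"
    then have less: "r0 < r" by simp
    \<comment> \<open>This is \<kappa> / 2^r, the decay per copy of the overlap at a rate above log
      \<kappa>.\<close>
    define q where "q = 2 powr (r0 - r)"
    have q: "0 < q" "q < 1" using less by (simp_all add: q_def powr_less_one)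
    \<comment> \<open>Rounding r n down loses less than one pair; this costs the factor 2. In the
      limit a vanishing error would give 1 \<le> 0.\<close>
    have bound: "1 \<le> ?err r n + 2 * q ^ n" for n
    proof -
      let ?m = "nat \<lfloor>r * real n\<rfloor>"
      have "r * real n - 1 \<le> real ?m" by linarith
      then have "(1 / 2) ^ ?m \<le> 2 powr (1 - r * real n)"
        by (simp add: powr_realpow[symmetric] power_one_over powr_minus_divide[symmetric])
      then have "(1 / 2) ^ ?m * \<kappa> ^ n \<le> 2 powr (1 - r * real n) * \<kappa> ^ n"
        using \<kappa> by (intro mult_right_mono) simp_all
      also have "\<dots> = 2 * q ^ n"
        by (simp add: powr_r0[symmetric] q_def powr_realpow[symmetric] powr_powr powr_add[symmetric] powr_mult_base algebra_simps)
      finally show ?thesis using distillation_error_ge[of ?m n] by (simp only: \<kappa>_def[symmetric])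
    qed
    have "(\<lambda>n. ?err r n + 2 * q ^ n) \<longlonglongrightarrow> 0 + 2 * 0"
      using q by (intro tendsto_add tendsto_mult r tendsto_const LIMSEQ_realpow_zero) auto
    then have "1 \<le> (0 + 2 * 0 :: real)"
      by (rule LIMSEQ_le_const) (use bound in blast)
    then show False by simp
  qed
  then have "distillable_entanglement 3 3 rho_v \<le> ereal r0"
    unfolding E by (intro Sup_least) auto
  ultimately have "distillable_entanglement 3 3 rho_v = ereal r0" by (rule antisym[rotated])
  then show ?thesis
    using regularized_rains_bound_rho_v by (simp add: r0_def \<kappa>_def)
qed

end
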